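(* Let $(\Gamma,S)$ be a Coxeter group and let $\mathcal W$ be the set of all its walls. Then $\mathcal W$ admits a limit $\Gamma$-aperiodic coloring by finitely many colors, i.e. there exist a finite set $F$ and a limit $\Gamma$-aperiodic coloring $\phi:\mathcal W\to F$.
   Context: A Coxeter matrix $M=(m_{ij})$ is a (finite) symmetric square matrix with $1$ on the diagonal and all other entries in $\{0\}\cup\mathbb N$ (off-diagonal entries are $0$ or $\geq 2$; $0$ plays the role usually denoted $\infty$). A Coxeter group $\Gamma$ with finite generating set $S=\{s_1,\dots,s_k\}$ is a group with presentation $\langle S\mid (s_is_j)^{m_{ij}}=1\rangle$, with the convention $a^0=1$. Walls: let $K$ be the Cayley graph of $(\Gamma,S)$ (as a topological graph, with one edge between $g$ and $gs$ for $s\in S$), on which $\Gamma$ acts from the left. Every conjugate $w=gcg^{-1}$ of a generator $c\in S$ acts on $K$ as a reflection; its fixed point set $M_w\subset K$ is called the wall of $w$. $\mathcal W$ is the set of all walls, and $\Gamma$ acts on $\mathcal W$ since $uM_w=M_{uwu^{-1}}$. Colorings of $G$-spaces: if a group $G$ acts on a set $X$, it acts on the set of colorings $F^X$ (product topology, $F$ discrete) by $(g\phi)(x)=\phi(g^{-1}x)$. Let $K_0$ be the kernel of the action. A coloring $\phi:X\to F$ is $G$-aperiodic if $g\phi\neq\phi$ for all $g\in G\setminus K_0$, and limit $G$-aperiodic if every coloring in the closure $\overline{G\phi}\subset F^X$ is $G$-aperiodic. *)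

theory Defs
  imports "HOL-Algebra.Group_Action" "HOL-Analysis.Function_Topology"
begin

section \<open>Group presentations\<close>

text \<open>
  A letter \<open>(i, True)\<close> stands for the generator with index \<open>i\<close>, and \<open>(i, False)\<close> for its formal
  inverse.
\<close>

type_synonym 'i word = "('i \<times> bool) list"

definition words :: "'i set \<Rightarrow> 'i word set"
  where "words I = lists (I \<times> UNIV)"

fun word_value :: "('a, 'b) monoid_scheme \<Rightarrow> ('i \<Rightarrow> 'a) \<Rightarrow> 'i word \<Rightarrow> 'a"
  where
    "word_value G s [] = \<one>\<^bsub>G\<^esub>"
  | "word_value G s ((i, b) # w) = (if b then s i else inv\<^bsub>G\<^esub> (s i)) \<otimes>\<^bsub>G\<^esub> word_value G s w"

text \<open>
  The classes of \<open>word_equiv I R\<close> on \<^term>\<open>words I\<close> are the elements of the free group on \<open>I\<close> modulo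
  the normal closure of \<open>R\<close>: inserting a relator anywhere inside a word multiplies the word by a
  conjugate of that relator.
\<close>

inductive word_equiv :: "'i set \<Rightarrow> 'i word set \<Rightarrow> 'i word \<Rightarrow> 'i word \<Rightarrow> bool"
  for I :: "'i set" and R :: "'i word set"
  where
    insert_inverse: "i \<in> I \<Longrightarrow> word_equiv I R (u @ [(i, b), (i, \<not> b)] @ v) (u @ v)"
  | insert_relator: "r \<in> R \<Longrightarrow> word_equiv I R (u @ r @ v) (u @ v)"
  | equiv_refl: "word_equiv I R u u"
  | equiv_sym: "word_equiv I R u v \<Longrightarrow> word_equiv I R v u"
  | equiv_trans: "word_equiv I R u v \<Longrightarrow> word_equiv I R v w \<Longrightarrow> word_equiv I R u w"

definition has_presentation ::
    "('a, 'b) monoid_scheme \<Rightarrow> ('i \<Rightarrow> 'a) \<Rightarrow> 'i set \<Rightarrow> 'i word set \<Rightarrow> bool"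
  where "has_presentation G s I R \<longleftrightarrow>
    s \<in> I \<rightarrow> carrier G \<and>
    word_value G s ` words I = carrier G \<and>
    (\<forall>u\<in>words I. \<forall>v\<in>words I. word_value G s u = word_value G s v \<longleftrightarrow> word_equiv I R u v)"

section \<open>Coxeter groups\<close>

text \<open>The entry \<open>0\<close> plays the role of \<open>\<infinity>\<close>.\<close>

definition coxeter_matrix :: "'i set \<Rightarrow> ('i \<Rightarrow> 'i \<Rightarrow> nat) \<Rightarrow> bool"
  where "coxeter_matrix I m \<longleftrightarrow>
    finite I \<and>
    (\<forall>i\<in>I. m i i = 1) \<and>
    (\<forall>i\<in>I. \<forall>j\<in>I. m i j = m j i) \<and>
    (\<forall>i\<in>I. \<forall>j\<in>I. i \<noteq> j \<longrightarrow> m i j = 0 \<or> 2 \<le> m i j)"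

text \<open>An entry \<open>0\<close> yields the empty relator, in accordance with \<open>a\<^sup>0 = 1\<close>.\<close>

definition coxeter_relators :: "'i set \<Rightarrow> ('i \<Rightarrow> 'i \<Rightarrow> nat) \<Rightarrow> 'i word set"
  where "coxeter_relators I m =
    {concat (replicate (m i j) [(i, True), (j, True)]) | i j. i \<in> I \<and> j \<in> I}"

locale coxeter_system = group G for G (structure) +
  fixes I :: "'i set" and m :: "'i \<Rightarrow> 'i \<Rightarrow> nat" and s :: "'i \<Rightarrow> 'a"
  assumes coxeter_matrix: "coxeter_matrix I m"
    and has_presentation: "has_presentation G s I (coxeter_relators I m)"

section \<open>The Cayley graph and its walls\<close>

text \<open>
  The Cayley graph has a single edge \<open>{g, gc}\<close> for \<open>c \<in> S\<close>. The points of the topological graph are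
  given by their barycentric coordinates: a point is a probability weight on the vertices whose
  support lies in a vertex or in an edge.
\<close>

definition cayley_cells :: "('a, 'b) monoid_scheme \<Rightarrow> 'a set \<Rightarrow> 'a set set"
  where "cayley_cells G S =
    {{g} | g. g \<in> carrier G} \<union> {{g, g \<otimes>\<^bsub>G\<^esub> c} | g c. g \<in> carrier G \<and> c \<in> S}"

definition cayley_graph :: "('a, 'b) monoid_scheme \<Rightarrow> 'a set \<Rightarrow> ('a \<Rightarrow> real) set"
  where "cayley_graph G S =
    {p. (\<forall>v. 0 \<le> p v) \<and> (\<exists>\<sigma>\<in>cayley_cells G S. {v. p v \<noteq> 0} \<subseteq> \<sigma> \<and> sum p \<sigma> = 1)}"

definition cayley_action ::
    "('a, 'b) monoid_scheme \<Rightarrow> 'a set \<Rightarrow> 'a \<Rightarrow> ('a \<Rightarrow> real) \<Rightarrow> 'a \<Rightarrow> real"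
  where "cayley_action G S g =
    (\<lambda>p\<in>cayley_graph G S. \<lambda>v. if v \<in> carrier G then p (inv\<^bsub>G\<^esub> g \<otimes>\<^bsub>G\<^esub> v) else 0)"

definition reflections :: "('a, 'b) monoid_scheme \<Rightarrow> 'a set \<Rightarrow> 'a set"
  where "reflections G S = {g \<otimes>\<^bsub>G\<^esub> c \<otimes>\<^bsub>G\<^esub> inv\<^bsub>G\<^esub> g | g c. g \<in> carrier G \<and> c \<in> S}"

definition wall :: "('a, 'b) monoid_scheme \<Rightarrow> 'a set \<Rightarrow> 'a \<Rightarrow> ('a \<Rightarrow> real) set"
  where "wall G S w = invariants (cayley_graph G S) (cayley_action G S) w"

definition walls :: "('a, 'b) monoid_scheme \<Rightarrow> 'a set \<Rightarrow> ('a \<Rightarrow> real) set set"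
  where "walls G S = wall G S ` reflections G S"

definition wall_action ::
    "('a, 'b) monoid_scheme \<Rightarrow> 'a set \<Rightarrow> 'a \<Rightarrow> ('a \<Rightarrow> real) set \<Rightarrow> ('a \<Rightarrow> real) set"
  where "wall_action G S g = (\<lambda>M\<in>walls G S. cayley_action G S g ` M)"

section \<open>Colorings of a set with a group action\<close>

definition coloring_action ::
    "('a, 'b) monoid_scheme \<Rightarrow> 'x set \<Rightarrow> ('a \<Rightarrow> 'x \<Rightarrow> 'x) \<Rightarrow> 'f set
      \<Rightarrow> 'a \<Rightarrow> ('x \<Rightarrow> 'f) \<Rightarrow> 'x \<Rightarrow> 'f"
  where "coloring_action G X act F g =
    (\<lambda>\<phi>\<in>X \<rightarrow>\<^sub>E F. \<lambda>x\<in>X. \<phi> (act (inv\<^bsub>G\<^esub> g) x))"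

definition coloring_topology :: "'x set \<Rightarrow> 'f set \<Rightarrow> ('x \<Rightarrow> 'f) topology"
  where "coloring_topology X F = product_topology (\<lambda>_. discrete_topology F) X"

definition aperiodic ::
    "('a, 'b) monoid_scheme \<Rightarrow> 'x set \<Rightarrow> ('a \<Rightarrow> 'x \<Rightarrow> 'x) \<Rightarrow> 'f set \<Rightarrow> ('x \<Rightarrow> 'f) \<Rightarrow> bool"
  where "aperiodic G X act F \<phi> \<longleftrightarrow>
    (\<forall>g \<in> carrier G - kernel G (BijGroup X) act. coloring_action G X act F g \<phi> \<noteq> \<phi>)"

definition limit_aperiodic ::
    "('a, 'b) monoid_scheme \<Rightarrow> 'x set \<Rightarrow> ('a \<Rightarrow> 'x \<Rightarrow> 'x) \<Rightarrow> 'f set \<Rightarrow> ('x \<Rightarrow> 'f) \<Rightarrow> bool"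
  where "limit_aperiodic G X act F \<phi> \<longleftrightarrow>
    (\<forall>\<psi> \<in> coloring_topology X F closure_of orbit G (coloring_action G X act F) \<phi>.
      aperiodic G X act F \<psi>)"

section \<open>The maps above are actions\<close>

lemma group_actionI:
  fixes G (structure)
  assumes "group G"
    and "\<And>g x. g \<in> carrier G \<Longrightarrow> x \<in> X \<Longrightarrow> act g x \<in> X"
    and "\<And>g. g \<in> carrier G \<Longrightarrow> act g \<in> extensional X"
    and "\<And>x. x \<in> X \<Longrightarrow> act \<one>\<^bsub>G\<^esub> x = x"
    and "\<And>g h x. g \<in> carrier G \<Longrightarrow> h \<in> carrier G \<Longrightarrow> x \<in> X \<Longrightarrow>
      act (g \<otimes>\<^bsub>G\<^esub> h) x = act g (act h x)"
  shows "group_action G X act"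
proof -
  interpret group G by fact
  have inv_act: "act (inv g) (act g x) = x" "act g (act (inv g) x) = x"
    if "g \<in> carrier G" "x \<in> X" for g x
    using that assms(4) assms(5)[of "inv g" g x] assms(5)[of g "inv g" x] by auto
  have bij: "act g \<in> Bij X" if "g \<in> carrier G" for g
    using that assms(2,3) inv_act
    by (auto simp: Bij_def intro!: bij_betwI[where g = "act (inv g)"])
  have "act (g \<otimes> h) = act g \<otimes>\<^bsub>BijGroup X\<^esub> act h"
    if "g \<in> carrier G" "h \<in> carrier G" for g h
    using that bij assms(3)[of "g \<otimes> h"] assms(5)
    by (auto simp: BijGroup_def compose_def extensional_def fun_eq_iff)
  then have "act \<in> hom G (BijGroup X)"
    using bij by (auto simp: hom_def BijGroup_def)
  then show ?thesis
    by (simp add: group_action_def group_hom_def group_hom_axioms_def group_BijGroup assms(1))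
qed

context group
begin

lemma cayley_cells_subset: "S \<subseteq> carrier G \<Longrightarrow> \<sigma> \<in> cayley_cells G S \<Longrightarrow> \<sigma> \<subseteq> carrier G"
  by (auto simp: cayley_cells_def)

lemma cayley_cells_translate:
  assumes "S \<subseteq> carrier G" "\<sigma> \<in> cayley_cells G S" "g \<in> carrier G"
  shows "(\<lambda>v. g \<otimes> v) ` \<sigma> \<in> cayley_cells G S"
  using assms(2)
  unfolding cayley_cells_def
proof (elim UnE CollectE exE conjE)
  fix h assume "\<sigma> = {h}" "h \<in> carrier G"
  then show "(\<lambda>v. g \<otimes> v) ` \<sigma> \<in> {{g} |g. g \<in> carrier G} \<union>
      {{g, g \<otimes> c} |g c. g \<in> carrier G \<and> c \<in> S}"
    using assms(3) by auto
next
  fix h c assume "\<sigma> = {h, h \<otimes> c}" "h \<in> carrier G" "c \<in> S"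
  then have "(\<lambda>v. g \<otimes> v) ` \<sigma> = {g \<otimes> h, g \<otimes> h \<otimes> c}" "g \<otimes> h \<in> carrier G" "c \<in> S"
    using assms by (auto simp: m_assoc subset_iff)
  then show "(\<lambda>v. g \<otimes> v) ` \<sigma> \<in> {{g} |g. g \<in> carrier G} \<union>
      {{g, g \<otimes> c} |g c. g \<in> carrier G \<and> c \<in> S}"
    by blast
qed

lemma cayley_graph_outside:
  "S \<subseteq> carrier G \<Longrightarrow> p \<in> cayley_graph G S \<Longrightarrow> v \<notin> carrier G \<Longrightarrow> p v = 0"
  using cayley_cells_subset[of S] unfolding cayley_graph_def by blast

lemma cayley_action_closed:
  assumes "S \<subseteq> carrier G" "p \<in> cayley_graph G S" "g \<in> carrier G"
  shows "cayley_action G S g p \<in> cayley_graph G S"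
proof -
  from assms(2) obtain \<sigma> where \<sigma>: "\<sigma> \<in> cayley_cells G S" "{v. p v \<noteq> 0} \<subseteq> \<sigma>" "sum p \<sigma> = 1"
    and pos: "\<And>v. 0 \<le> p v"
    by (auto simp: cayley_graph_def)
  define q where "q = (\<lambda>v. if v \<in> carrier G then p (inv g \<otimes> v) else 0)"
  have sub: "\<sigma> \<subseteq> carrier G" using \<sigma>(1) assms(1) by (rule cayley_cells_subset[rotated])
  have q: "q (g \<otimes> v) = p v" if "v \<in> carrier G" for v
    using that assms(3) by (simp add: q_def flip: m_assoc)
  have "inj_on (\<lambda>v. g \<otimes> v) \<sigma>"
    using sub assms(3) by (meson inj_on_cmult inj_on_subset)
  then have "sum q ((\<lambda>v. g \<otimes> v) ` \<sigma>) = sum p \<sigma>"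
    using q sub by (auto simp: sum.reindex intro!: sum.cong)
  moreover have "{v. q v \<noteq> 0} \<subseteq> (\<lambda>v. g \<otimes> v) ` \<sigma>"
  proof
    fix v assume "v \<in> {v. q v \<noteq> 0}"
    then have "v \<in> carrier G" "inv g \<otimes> v \<in> \<sigma>"
      using \<sigma>(2) by (auto simp: q_def split: if_splits)
    moreover from this have "v = g \<otimes> (inv g \<otimes> v)"
      using assms(3) by (simp flip: m_assoc)
    ultimately show "v \<in> (\<lambda>v. g \<otimes> v) ` \<sigma>" by blast
  qed
  moreover have "cayley_action G S g p = q"
    using assms(2) by (simp add: cayley_action_def q_def)
  moreover have "0 \<le> q v" for v
    using pos by (simp add: q_def)
  ultimately show ?thesis
    using cayley_cells_translate[OF assms(1) \<sigma>(1) assms(3)] \<sigma>(3)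
    by (auto simp: cayley_graph_def)
qed

lemma group_action_cayley_graph:
  assumes "S \<subseteq> carrier G"
  shows "group_action G (cayley_graph G S) (cayley_action G S)"
proof (rule group_actionI)
  fix g h p assume gh: "g \<in> carrier G" "h \<in> carrier G" and p: "p \<in> cayley_graph G S"
  then show "cayley_action G S (g \<otimes> h) p = cayley_action G S g (cayley_action G S h p)"
    using cayley_action_closed[OF assms p gh(2)]
    by (simp add: cayley_action_def inv_mult_group m_assoc fun_eq_iff)
next
  fix p assume "p \<in> cayley_graph G S"
  then show "cayley_action G S \<one> p = p"
    using cayley_graph_outside[OF assms] by (auto simp: cayley_action_def fun_eq_iff)
next
  fix g assume "g \<in> carrier G"
  show "cayley_action G S g \<in> extensional (cayley_graph G S)"
    by (simp add: cayley_action_def)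
qed (use assms in \<open>simp_all add: cayley_action_closed is_group\<close>)

lemma reflections_subset: "S \<subseteq> carrier G \<Longrightarrow> reflections G S \<subseteq> carrier G"
  by (auto simp: reflections_def)

lemma reflections_conjugate:
  assumes "S \<subseteq> carrier G" "w \<in> reflections G S" "u \<in> carrier G"
  shows "u \<otimes> w \<otimes> inv u \<in> reflections G S"
proof -
  obtain g c where w: "w = g \<otimes> c \<otimes> inv g" "g \<in> carrier G" "c \<in> S"
    using assms(2) unfolding reflections_def by blast
  then have c: "c \<in> carrier G" using assms(1) by blast
  have "u \<otimes> w \<otimes> inv u = (u \<otimes> g) \<otimes> c \<otimes> inv (u \<otimes> g)"
    using w(2) c assms(3) by (simp add: w(1) m_assoc inv_mult_group)
  moreover have "u \<otimes> g \<in> carrier G" using w(2) assms(3) by simp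
  ultimately show ?thesis
    using w(3) unfolding reflections_def by blast
qed

lemma cayley_action_wall:
  assumes "S \<subseteq> carrier G" "w \<in> carrier G" "u \<in> carrier G"
  shows "cayley_action G S u ` wall G S w = wall G S (u \<otimes> w \<otimes> inv u)"
proof -
  interpret A: group_action G "cayley_graph G S" "cayley_action G S"
    using assms(1) by (rule group_action_cayley_graph)
  let ?a = "cayley_action G S"
  have sub: "?a u ` wall G S w \<subseteq> wall G S (u \<otimes> w \<otimes> inv u)"
    if uw: "u \<in> carrier G" "w \<in> carrier G" for u w
  proof
    fix q assume "q \<in> ?a u ` wall G S w"
    then obtain p where p: "q = ?a u p" "p \<in> cayley_graph G S" "?a w p = p"
      by (auto simp: wall_def invariants_def)
    then have q: "q \<in> cayley_graph G S"
      using A.element_image that by blast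
    have "?a (u \<otimes> w \<otimes> inv u) q = ?a (u \<otimes> w \<otimes> inv u \<otimes> u) p"
      using p uw by (simp add: A.composition_rule)
    also have "u \<otimes> w \<otimes> inv u \<otimes> u = u \<otimes> w"
      using uw by (simp add: m_assoc)
    also have "?a (u \<otimes> w) p = q"
      using p uw by (simp add: A.composition_rule)
    finally show "q \<in> wall G S (u \<otimes> w \<otimes> inv u)"
      using q by (simp add: wall_def invariants_def)
  qed
  have "wall G S (u \<otimes> w \<otimes> inv u) \<subseteq> ?a u ` wall G S w"
  proof
    fix q assume q: "q \<in> wall G S (u \<otimes> w \<otimes> inv u)"
    then have "?a (inv u) q \<in> wall G S (inv u \<otimes> (u \<otimes> w \<otimes> inv u) \<otimes> inv (inv u))"
      using sub[of "inv u" "u \<otimes> w \<otimes> inv u"] assms by blast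
    also have "inv u \<otimes> (u \<otimes> w \<otimes> inv u) \<otimes> inv (inv u) = w"
      using assms by (simp add: m_assoc) (simp flip: m_assoc)
    finally have "?a (inv u) q \<in> wall G S w" .
    moreover have "q \<in> cayley_graph G S"
      using q by (simp add: wall_def invariants_def)
    then have "?a u (?a (inv u) q) = q"
      using assms by (simp flip: A.composition_rule A.id_eq_one)
    ultimately show "q \<in> ?a u ` wall G S w" by (metis imageI)
  qed
  with sub[OF assms(3,2)] show ?thesis by blast
qed

lemma group_action_walls:
  assumes "S \<subseteq> carrier G"
  shows "group_action G (walls G S) (wall_action G S)"
proof (rule group_actionI)
  interpret A: group_action G "cayley_graph G S" "cayley_action G S"
    using assms by (rule group_action_cayley_graph)
  have sub: "M \<subseteq> cayley_graph G S" if "M \<in> walls G S" for M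
    using that by (auto simp: walls_def wall_def invariants_def)
  show closed: "wall_action G S g M \<in> walls G S" if "g \<in> carrier G" "M \<in> walls G S" for g M
    using that reflections_subset[OF assms] reflections_conjugate[OF assms]
    by (auto simp: wall_action_def walls_def cayley_action_wall[OF assms] subset_iff)
  show "wall_action G S \<one> M = M" if "M \<in> walls G S" for M
    using that sub[OF that] by (force simp: wall_action_def simp flip: A.id_eq_one)
  show "wall_action G S (g \<otimes> h) M = wall_action G S g (wall_action G S h M)"
    if gh: "g \<in> carrier G" "h \<in> carrier G" and M: "M \<in> walls G S" for g h M
  proof -
    have "cayley_action G S (g \<otimes> h) ` M = cayley_action G S g ` cayley_action G S h ` M"
      unfolding image_image
      using sub[OF M] gh by (intro image_cong) (auto simp: A.composition_rule)
    then show ?thesis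
      using M closed[OF gh(2) M] by (simp add: wall_action_def)
  qed
qed (auto simp: is_group wall_action_def)

end

lemma (in group_action) group_action_colorings:
  "group_action G (E \<rightarrow>\<^sub>E F) (coloring_action G E \<phi> F)"
proof -
  interpret group_hom G "BijGroup E" \<phi> by (rule group_hom)
  have image: "\<phi> g x \<in> E" if "g \<in> carrier G" "x \<in> E" for g x
    using element_image[OF that refl] .
  have closed: "coloring_action G E \<phi> F g c \<in> E \<rightarrow>\<^sub>E F"
    if "g \<in> carrier G" "c \<in> E \<rightarrow>\<^sub>E F" for g c
    using that image[of "inv g"] by (auto simp: coloring_action_def)
  show ?thesis
  proof (rule group_actionI)
    fix g h c assume gh: "g \<in> carrier G" "h \<in> carrier G" and c: "c \<in> E \<rightarrow>\<^sub>E F"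
    have "\<phi> (inv (g \<otimes> h)) x = \<phi> (inv h) (\<phi> (inv g) x)" if "x \<in> E" for x
      using gh that composition_rule[OF that, of "inv h" "inv g"]
      by (simp add: G.inv_mult_group del: hom_inv)
    then show "coloring_action G E \<phi> F (g \<otimes> h) c =
        coloring_action G E \<phi> F g (coloring_action G E \<phi> F h c)"
      using c closed[OF gh(2) c] image[of "inv g"] gh
      by (simp add: coloring_action_def fun_eq_iff)
  next
    fix c assume c: "c \<in> E \<rightarrow>\<^sub>E F"
    have "\<phi> \<one> x = x" if "x \<in> E" for x
      using that by (metis id_eq_one restrict_apply')
    then show "coloring_action G E \<phi> F \<one> c = c"
      using c by (auto simp: coloring_action_def fun_eq_iff PiE_def extensional_def)
  next
    fix g c assume "g \<in> carrier G" "c \<in> E \<rightarrow>\<^sub>E F"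
    then show "coloring_action G E \<phi> F g c \<in> E \<rightarrow>\<^sub>E F"
      by (rule closed)
  qed (auto simp: coloring_action_def)
qed

end

theory Submission
  imports Defs "HOL-Algebra.Generated_Groups"
begin

text \<open>
  Walls correspond to reflections, on which \<open>\<Gamma>\<close> acts by conjugation, and an element acts trivially
  iff it is central. Let \<open>K\<close> be a normal subgroup of finite index that contains none of finitely
  many given nontrivial elements; it exists because the geometric representation is defined over a
  ring that is finitely generated as an abelian group. The color of a reflection \<open>x\<close> consists of its
  coset \<open>K x\<close> and of \<open>\<tau> (d x)\<close>, where \<open>d x\<close> counts the walls in the same coset that separate the
  wall of \<open>x\<close> from the identity, and \<open>\<tau> n\<close> is the parity of \<open>\<lfloor>n \<theta>\<rfloor>\<close> for an irrational \<open>\<theta>\<close>.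

  If \<open>g\<close> preserves a limit of translates of this coloring, then \<open>g x g\<^sup>-\<^sup>1 \<in> K x\<close> for all reflections \<open>x\<close>.
  An element \<open>g\<close> of finite order is conjugate into a finite standard parabolic subgroup, so there are
  finitely many cases, and a suitable choice of \<open>K\<close> forces \<open>g\<close> to be central. Crossing walls generate
  a finite group, so \<open>K\<close> can also be chosen such that distinct walls in one coset do not cross. If \<open>g\<close> has
  infinite order, then among the elements preserving the limit coloring there is some \<open>a\<close> that maps a
  half-space \<open>H\<close> to a strictly larger one. The numbers \<open>d\<close> of the walls of the \<open>a\<^sup>j H\<close>, computed
  from a base point in \<open>H\<close>, form an arithmetic progression, along which \<open>\<tau>\<close> is not constant.
\<close>

section \<open>Presentations and words\<close>

text \<open>A limit \<open>\<psi>\<close> of translates agrees on each finite set of walls with the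
  translate by some \<open>h\<close>, but \<open>h\<close> changes with the set. So whatever is read
  off from \<open>\<psi>\<close> must be independent of \<open>h\<close>. For cosets this holds
  because conjugation by \<open>h\<close> permutes the cosets of a normal subgroup. For depths, the
  translate by \<open>h\<close> shows the depth as measured from the chamber \<open>h\<close>; only
  the increments along the translates of \<open>H\<close> are independent of it. Hence
  \<open>\<tau>\<close> must fail to be constant on every arithmetic progression, whatever its first
  term, and within a number of steps that depends on the common difference alone, because the finite
  set of walls is fixed before \<open>h\<close> is known. A periodic sequence fails when the
  difference is a multiple of the period, which is why an irrational number enters. Since it is also
  unknown on which side of the wall \<open>h\<close> lies, both \<open>H\<close> with
  \<open>a\<close> and its complement with the inverse of \<open>a\<close> are prepared. That depths
  are additive along the progression relies on nestedness; this is why depth is counted within one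
  coset rather than among all walls.\<close>

fun letter_map :: "('i \<Rightarrow> 'v \<Rightarrow> 'v) \<Rightarrow> 'i word \<Rightarrow> 'v \<Rightarrow> 'v"
  where
    "letter_map \<sigma> [] = id"
  | "letter_map \<sigma> ((i, b) # w) = \<sigma> i \<circ> letter_map \<sigma> w"

lemma letter_map_append: "letter_map \<sigma> (u @ v) = letter_map \<sigma> u \<circ> letter_map \<sigma> v"
  by (induction \<sigma> u rule: letter_map.induct) (auto simp: comp_assoc)

lemma letter_map_relator:
  "letter_map \<sigma> (concat (replicate n [(i, True), (j, True)])) = (\<sigma> i \<circ> \<sigma> j) ^^ n"
  by (induction n) (auto simp: comp_assoc)

context coxeter_system
begin

lemma finite_I: "finite I"
  and m_diag: "i \<in> I \<Longrightarrow> m i i = 1"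
  and m_sym: "i \<in> I \<Longrightarrow> j \<in> I \<Longrightarrow> m i j = m j i"
  and m_off_diag: "i \<in> I \<Longrightarrow> j \<in> I \<Longrightarrow> i \<noteq> j \<Longrightarrow> m i j = 0 \<or> 2 \<le> m i j"
  using coxeter_matrix by (auto simp: coxeter_matrix_def)

lemma s_closed [simp, intro]: "i \<in> I \<Longrightarrow> s i \<in> carrier G"
  using has_presentation by (auto simp: has_presentation_def)

lemma word_value_closed: "w \<in> words I \<Longrightarrow> word_value G s w \<in> carrier G"
  using has_presentation by (auto simp: has_presentation_def)

lemma word_value_surj: "g \<in> carrier G \<Longrightarrow> \<exists>w\<in>words I. word_value G s w = g"
proof -
  assume "g \<in> carrier G"
  then have "g \<in> word_value G s ` words I"
    using has_presentation by (simp add: has_presentation_def)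
  then show ?thesis by blast
qed

lemma word_value_eq_iff:
  "u \<in> words I \<Longrightarrow> v \<in> words I \<Longrightarrow>
    word_value G s u = word_value G s v \<longleftrightarrow> word_equiv I (coxeter_relators I m) u v"
  using has_presentation by (auto simp: has_presentation_def)

lemma words_append: "u \<in> words I \<Longrightarrow> v \<in> words I \<Longrightarrow> u @ v \<in> words I"
  by (auto simp: words_def)

lemma words_Cons: "i \<in> I \<Longrightarrow> v \<in> words I \<Longrightarrow> (i, b) # v \<in> words I"
  by (auto simp: words_def)

lemma words_Nil: "[] \<in> words I"
  by (auto simp: words_def)

lemma word_value_append:
  "u \<in> words I \<Longrightarrow> v \<in> words I \<Longrightarrow>
    word_value G s (u @ v) = word_value G s u \<otimes> word_value G s v"
proof (induction u)
  case Nil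
  then show ?case by (simp add: word_value_closed)
next
  case (Cons x u)
  obtain i b where x: "x = (i, b)" by fastforce
  with Cons.prems have "i \<in> I" "u \<in> words I" by (auto simp: words_def)
  with Cons x show ?case by (auto simp: m_assoc word_value_closed)
qed

lemma relator_value:
  assumes "i \<in> I" "j \<in> I"
  shows "(s i \<otimes> s j) [^] m i j = \<one>"
proof -
  let ?r = "\<lambda>n. concat (replicate n [(i, True), (j, True)])"
  have r: "?r n \<in> words I" for n
    using assms by (induction n) (auto simp: words_def)
  have "word_value G s (?r n) = (s i \<otimes> s j) [^] n" for n
  proof (induction n)
    case (Suc n)
    then show ?case
      using assms nat_pow_Suc2[of "s i \<otimes> s j" n] by (simp add: m_assoc del: nat_pow_Suc)
  qed simp
  moreover have "word_equiv I (coxeter_relators I m) ([] @ ?r (m i j) @ []) ([] @ [])"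
    using assms by (intro insert_relator) (auto simp: coxeter_relators_def)
  then have "word_value G s (?r (m i j)) = word_value G s []"
    using word_value_eq_iff[OF r words_Nil] by simp
  ultimately show ?thesis by simp
qed

lemma s_square [simp]: "i \<in> I \<Longrightarrow> s i \<otimes> s i = \<one>"
  using relator_value[of i i] by (simp add: m_diag)

lemma inv_s [simp]: "i \<in> I \<Longrightarrow> inv (s i) = s i"
  by (simp add: inv_equality)

lemma s_s_mult [simp]: "i \<in> I \<Longrightarrow> g \<in> carrier G \<Longrightarrow> s i \<otimes> (s i \<otimes> g) = g"
  by (simp flip: m_assoc)

text \<open>The universal property of the presentation, for actions by involutions. Inverse letters
  then act like the letters themselves, so \<open>letter_map\<close> can ignore the flag, and free
  cancellation becomes \<open>\<sigma> i \<circ> \<sigma> i = id\<close>.\<close>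

lemma presentation_lift:
  fixes \<sigma> :: "'i \<Rightarrow> 'v \<Rightarrow> 'v"
  assumes inv: "\<And>i. i \<in> I \<Longrightarrow> \<sigma> i \<circ> \<sigma> i = id"
    and rel: "\<And>i j. i \<in> I \<Longrightarrow> j \<in> I \<Longrightarrow> (\<sigma> i \<circ> \<sigma> j) ^^ m i j = id"
  shows "\<exists>\<rho>. \<rho> \<one> = id \<and>
    (\<forall>g\<in>carrier G. \<forall>h\<in>carrier G. \<rho> (g \<otimes> h) = \<rho> g \<circ> \<rho> h) \<and> (\<forall>i\<in>I. \<rho> (s i) = \<sigma> i)"
proof -
  have equiv: "letter_map \<sigma> u = letter_map \<sigma> v"
    if "word_equiv I (coxeter_relators I m) u v" for u v
    using that
  proof (induction rule: word_equiv.induct)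
    case (insert_inverse i u b v)
    then have "\<sigma> i (\<sigma> i x) = x" for x
      using inv[of i] by (simp add: pointfree_idE)
    then show ?case by (auto simp: letter_map_append)
  next
    case (insert_relator r u v)
    then obtain i j where "i \<in> I" "j \<in> I" "r = concat (replicate (m i j) [(i, True), (j, True)])"
      by (auto simp: coxeter_relators_def)
    then have "letter_map \<sigma> r = id"
      using rel[of i j] by (simp only: letter_map_relator)
    then show ?case by (simp add: letter_map_append)
  qed auto
  \<comment> \<open>The choice of a word is harmless: words of equal value are equivalent and hence
    have the same \<open>letter_map\<close>.\<close>
  define \<rho> where "\<rho> g = letter_map \<sigma> (SOME w. w \<in> words I \<and> word_value G s w = g)" for g
  have \<rho>: "\<rho> (word_value G s w) = letter_map \<sigma> w" if "w \<in> words I" for w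
  proof -
    let ?w = "SOME v. v \<in> words I \<and> word_value G s v = word_value G s w"
    have "?w \<in> words I \<and> word_value G s ?w = word_value G s w"
      by (rule someI[of _ w]) (use that in simp)
    then have "word_equiv I (coxeter_relators I m) ?w w"
      using word_value_eq_iff[of ?w w] that by blast
    then show ?thesis
      unfolding \<rho>_def by (rule equiv)
  qed
  have "\<rho> \<one> = id" using \<rho>[OF words_Nil] by simp
  moreover have "\<rho> (g \<otimes> h) = \<rho> g \<circ> \<rho> h" if gh: "g \<in> carrier G" "h \<in> carrier G" for g h
  proof -
    obtain u v where "u \<in> words I" "v \<in> words I" "word_value G s u = g" "word_value G s v = h"
      using gh word_value_surj by meson
    then show ?thesis
      using \<rho>[of "u @ v"] \<rho>[of u] \<rho>[of v]
      by (simp add: word_value_append words_append letter_map_append)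
  qed
  moreover have "\<rho> (s i) = \<sigma> i" if "i \<in> I" for i
    using \<rho>[of "[(i, True)]"] that by (simp add: words_Cons words_Nil)
  ultimately show ?thesis by blast
qed

lemma gen_induct [consumes 1, case_names one mult]:
  assumes "g \<in> carrier G" "P \<one>"
    and "\<And>i g. i \<in> I \<Longrightarrow> g \<in> carrier G \<Longrightarrow> P g \<Longrightarrow> P (s i \<otimes> g)"
  shows "P g"
proof -
  have "P (word_value G s w)" if "w \<in> words I" for w
    using that
  proof (induction w)
    case (Cons x w)
    obtain i b where "x = (i, b)" by fastforce
    moreover from this Cons.prems have "i \<in> I" "w \<in> words I" by (auto simp: words_def)
    ultimately show ?case using Cons.IH assms(3) by (auto simp: word_value_closed)
  qed (use assms(2) in simp)
  then show ?thesis using assms(1) word_value_surj by blast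
qed

section \<open>Word length\<close>

definition len :: "'a \<Rightarrow> nat"
  where "len g = (LEAST n. \<exists>w\<in>words I. length w = n \<and> word_value G s w = g)"

lemma len_le: "w \<in> words I \<Longrightarrow> len (word_value G s w) \<le> length w"
  unfolding len_def by (rule Least_le) blast

lemma len_word: "g \<in> carrier G \<Longrightarrow> \<exists>w\<in>words I. length w = len g \<and> word_value G s w = g"
  unfolding len_def by (rule LeastI_ex) (use word_value_surj in blast)

lemma len_one [simp]: "len \<one> = 0"
  using len_le[OF words_Nil] by simp

lemma len_mult_s_le:
  assumes "g \<in> carrier G" "i \<in> I"
  shows "len (g \<otimes> s i) \<le> Suc (len g)"
proof -
  obtain w where w: "w \<in> words I" "length w = len g" "word_value G s w = g"
    using len_word assms(1) by blast
  then have "word_value G s (w @ [(i, True)]) = g \<otimes> s i"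
    using assms by (simp add: word_value_append words_Cons words_Nil)
  then show ?thesis
    using len_le[of "w @ [(i, True)]"] w assms by (simp add: words_append words_Cons words_Nil)
qed

text \<open>The sign homomorphism: relators have even length, so sending every generator to
  \<open>Not\<close> on the booleans extends to the group. Its purpose is that multiplication by a
  generator always changes the length.\<close>

lemma len_parity: "\<exists>\<epsilon>. (\<forall>g\<in>carrier G. \<epsilon> g = even (len g)) \<and>
    (\<forall>g\<in>carrier G. \<forall>i\<in>I. \<epsilon> (g \<otimes> s i) = (\<not> \<epsilon> g))"
proof -
  have "(Not \<circ> Not) = id" by (rule ext) simp
  then have "\<exists>\<rho>. \<rho> \<one> = id \<and>
    (\<forall>g\<in>carrier G. \<forall>h\<in>carrier G. \<rho> (g \<otimes> h) = \<rho> g \<circ> \<rho> h) \<and> (\<forall>i\<in>I. \<rho> (s i) = Not)"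
    by (intro presentation_lift) simp_all
  then obtain \<rho> where "\<rho> \<one> = id \<and>
    (\<forall>g\<in>carrier G. \<forall>h\<in>carrier G. \<rho> (g \<otimes> h) = \<rho> g \<circ> \<rho> h) \<and> (\<forall>i\<in>I. \<rho> (s i) = Not)" ..
  then have \<rho>: "\<rho> \<one> = id" "\<And>i. i \<in> I \<Longrightarrow> \<rho> (s i) = Not"
      "\<And>g h. g \<in> carrier G \<Longrightarrow> h \<in> carrier G \<Longrightarrow> \<rho> (g \<otimes> h) = \<rho> g \<circ> \<rho> h"
    by blast+
  have word: "\<rho> (word_value G s w) b = (b = even (length w))" if "w \<in> words I" for w b
    using that
  proof (induction w arbitrary: b)
    case (Cons x w)
    obtain i b' where "x = (i, b')" by fastforce
    moreover from this Cons.prems have "i \<in> I" "w \<in> words I" by (auto simp: words_def)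
    ultimately show ?case using Cons.IH \<rho> by (auto simp: word_value_closed)
  qed (use \<rho> in simp)
  have "\<rho> g b = (b = even (len g))" if "g \<in> carrier G" for g b
    using len_word[OF that] word by metis
  then show ?thesis
    using \<rho> by (intro exI[of _ "\<lambda>g. \<rho> g True"]) auto
qed

lemma len_mult_s_neq: "g \<in> carrier G \<Longrightarrow> i \<in> I \<Longrightarrow> len (g \<otimes> s i) \<noteq> len g"
  using len_parity by (metis m_closed s_closed)

lemma len_mult_s_ge:
  assumes "g \<in> carrier G" "i \<in> I"
  shows "len g \<le> Suc (len (g \<otimes> s i))"
  using len_mult_s_le[of "g \<otimes> s i" i] assms by (simp add: m_assoc)

lemma len_descent:
  assumes "g \<in> carrier G" "g \<noteq> \<one>"
  shows "\<exists>i\<in>I. len g = Suc (len (g \<otimes> s i))"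
proof -
  obtain w where w: "w \<in> words I" "length w = len g" "word_value G s w = g"
    using len_word assms(1) by blast
  with assms(2) have "w \<noteq> []" by auto
  then obtain v i b where v: "w = v @ [(i, b)]"
    by (metis append_butlast_last_id surj_pair)
  then have i: "i \<in> I" and vI: "v \<in> words I" using w(1) by (auto simp: words_def)
  then have "g = word_value G s v \<otimes> s i"
    using w v by (auto simp: word_value_append words_Cons words_Nil)
  then have "g \<otimes> s i = word_value G s v"
    using i vI by (simp add: m_assoc word_value_closed)
  then have "len (g \<otimes> s i) \<le> length v" using len_le[OF vI] by simp
  then have "Suc (len (g \<otimes> s i)) \<le> len g" using w v by simp
  then show ?thesis using len_mult_s_ge[OF assms(1) i] i by (metis le_antisym)
qed

end

section \<open>The geometric representation\<close>

definition simple_root :: "'i \<Rightarrow> 'i \<Rightarrow> real"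
  where "simple_root i = (\<lambda>k. if k = i then 1 else 0)"

definition linear_map :: "(('i \<Rightarrow> real) \<Rightarrow> 'j \<Rightarrow> real) \<Rightarrow> bool"
  where "linear_map f \<longleftrightarrow>
    (\<forall>x y v w. f (\<lambda>k. x * v k + y * w k) = (\<lambda>k. x * f v k + y * f w k))"

lemma linear_mapD:
  "linear_map f \<Longrightarrow> f (\<lambda>k. x * v k + y * w k) = (\<lambda>k. x * f v k + y * f w k)"
  by (simp add: linear_map_def)

lemma linear_map_scale: "linear_map f \<Longrightarrow> f (\<lambda>k. x * v k) = (\<lambda>k. x * f v k)"
  using linear_mapD[of f x v 0 v] by simp

lemma linear_map_zero: "linear_map f \<Longrightarrow> f (\<lambda>k. 0) = (\<lambda>k. 0)"
  using linear_mapD[of f 0 "\<lambda>_. 0" 0 "\<lambda>_. 0"] by simp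

lemma linear_map_minus: "linear_map f \<Longrightarrow> f (\<lambda>k. - v k) = (\<lambda>k. - f v k)"
  using linear_map_scale[of f "-1" v] by simp

lemma linear_map_diff_scale:
  "linear_map f \<Longrightarrow> f (\<lambda>k. v k - x * w k) = (\<lambda>k. f v k - x * f w k)"
  using linear_mapD[of f 1 v "-x" w] by simp

definition vec_nonneg :: "('i \<Rightarrow> real) \<Rightarrow> bool"
  where "vec_nonneg v \<longleftrightarrow> (\<forall>k. 0 \<le> v k)"

definition vec_nonpos :: "('i \<Rightarrow> real) \<Rightarrow> bool"
  where "vec_nonpos v \<longleftrightarrow> (\<forall>k. v k \<le> 0)"

lemma vec_nonneg_combination:
  "vec_nonneg v \<Longrightarrow> vec_nonneg w \<Longrightarrow> 0 \<le> x \<Longrightarrow> 0 \<le> y \<Longrightarrow> vec_nonneg (\<lambda>k. x * v k + y * w k)"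
  by (simp add: vec_nonneg_def)

lemma vec_nonneg_scale_iff: "0 < c \<Longrightarrow> vec_nonneg (\<lambda>k. c * v k) \<longleftrightarrow> vec_nonneg v"
  by (simp add: vec_nonneg_def zero_le_mult_iff)

lemma vec_nonneg_minus: "vec_nonneg (\<lambda>k. - v k) \<longleftrightarrow> vec_nonpos v"
  by (simp add: vec_nonneg_def vec_nonpos_def)

lemma vec_nonneg_nonpos: "vec_nonneg v \<Longrightarrow> vec_nonpos v \<Longrightarrow> v = (\<lambda>_. 0)"
  by (auto simp: vec_nonneg_def vec_nonpos_def fun_eq_iff intro: antisym)

text \<open>The ratio \<open>sin (k\<theta>) / sin \<theta>\<close>, extended by its limit to \<open>\<theta> = 0\<close>.\<close>

definition sin_ratio :: "real \<Rightarrow> nat \<Rightarrow> real"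
  where "sin_ratio \<theta> k = (if \<theta> = 0 then real k else sin (real k * \<theta>) / sin \<theta>)"

lemma sin_ratio_0 [simp]: "sin_ratio \<theta> 0 = 0"
  by (simp add: sin_ratio_def)

lemma sin_ratio_1: "\<theta> = 0 \<or> sin \<theta> \<noteq> 0 \<Longrightarrow> sin_ratio \<theta> (Suc 0) = 1"
  by (auto simp: sin_ratio_def)

text \<open>The recurrence of the Chebyshev polynomials of the second kind at
  \<open>cos \<theta>\<close>. The limit case \<open>\<theta> = 0\<close> obeys it as well, so
  finite and infinite \<open>m i j\<close> are treated alike in \<open>geo_alt\<close>.\<close>

lemma sin_ratio_rec:
  "sin_ratio \<theta> (Suc (Suc k)) = 2 * cos \<theta> * sin_ratio \<theta> (Suc k) - sin_ratio \<theta> k"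
proof -
  have "sin (real (Suc (Suc k)) * \<theta>) = sin (real (Suc k) * \<theta> + \<theta>)"
    by (simp add: algebra_simps)
  also have "\<dots> = 2 * (sin (real (Suc k) * \<theta>) * cos \<theta>)
      - (sin (real (Suc k) * \<theta>) * cos \<theta> - cos (real (Suc k) * \<theta>) * sin \<theta>)"
    by (simp only: sin_add)
  also have "\<dots> = 2 * (sin (real (Suc k) * \<theta>) * cos \<theta>) - sin (real (Suc k) * \<theta> - \<theta>)"
    by (simp only: sin_diff)
  also have "real (Suc k) * \<theta> - \<theta> = real k * \<theta>"
    by (simp add: algebra_simps)
  finally show ?thesis
    by (simp add: sin_ratio_def diff_divide_distrib)
qed

context coxeter_system
begin

text \<open>
  For \<open>m i j = 0\<close> the division by \<open>0\<close> yields \<open>- cos 0 = - 1\<close>, which is the standard choice for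
  \<open>m i j = \<infinity>\<close>.
\<close>

definition gram :: "'i \<Rightarrow> 'i \<Rightarrow> real"
  where "gram i j = - cos (pi / real (m i j))"

definition root_pairing :: "('i \<Rightarrow> real) \<Rightarrow> 'i \<Rightarrow> real"
  where "root_pairing v i = (\<Sum>j\<in>I. v j * gram j i)"

definition reflect :: "'i \<Rightarrow> ('i \<Rightarrow> real) \<Rightarrow> 'i \<Rightarrow> real"
  where "reflect i v = (\<lambda>k. v k - 2 * root_pairing v i * simple_root i k)"

lemma gram_diag: "i \<in> I \<Longrightarrow> gram i i = 1"
  by (simp add: gram_def m_diag)

lemma gram_sym: "i \<in> I \<Longrightarrow> j \<in> I \<Longrightarrow> gram i j = gram j i"
  by (simp add: gram_def m_sym)

lemma root_pairing_linear:
  "root_pairing (\<lambda>k. x * v k + y * w k) i = x * root_pairing v i + y * root_pairing w i"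
  by (simp add: root_pairing_def sum_distrib_left algebra_simps sum.distrib)

lemma root_pairing_simple [simp]: "j \<in> I \<Longrightarrow> root_pairing (simple_root j) i = gram j i"
  using finite_I by (simp add: root_pairing_def simple_root_def if_distrib[of "\<lambda>x. x * _"] cong: if_cong)

lemma reflect_linear: "linear_map (reflect i)"
  by (auto simp: linear_map_def reflect_def root_pairing_linear algebra_simps)

lemma root_pairing_reflect:
  assumes "i \<in> I"
  shows "root_pairing (reflect i v) j = root_pairing v j - 2 * root_pairing v i * gram i j"
  using root_pairing_linear[of 1 v "- 2 * root_pairing v i" "simple_root i" j] assms
  by (simp add: reflect_def)

lemma reflect_simple: "i \<in> I \<Longrightarrow> reflect i (simple_root i) = (\<lambda>k. - simple_root i k)"
  by (simp add: reflect_def gram_diag)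

lemma reflect_simple_other:
  "i \<in> I \<Longrightarrow> j \<in> I \<Longrightarrow>
    reflect i (simple_root j) = (\<lambda>k. simple_root j k + 2 * cos (pi / real (m i j)) * simple_root i k)"
  by (simp add: reflect_def gram_sym[of j i]) (simp add: gram_def)

lemma reflect_involution: "i \<in> I \<Longrightarrow> reflect i \<circ> reflect i = id"
  by (rule ext)+ (simp add: reflect_def[of i "reflect i _"] root_pairing_reflect gram_diag,
      simp add: reflect_def)

text \<open>For distinct indices and finite \<open>m i j\<close>, the product of the two reflections
  rotates the plane of the two simple roots by \<open>2 * \<theta>\<close> and fixes all vectors
  that pair to zero with both. For \<open>m i j = 0\<close> the power is trivial.\<close>

lemma reflect_braid:
  assumes ij: "i \<in> I" "j \<in> I"
  shows "(reflect i \<circ> reflect j) ^^ m i j = id"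
proof -
  consider "i = j" | "m i j = 0" | "i \<noteq> j" "2 \<le> m i j"
    using m_off_diag[OF ij] by metis
  then show ?thesis
  proof cases
    case 3
    define n where "n = m i j"
    define \<theta> where "\<theta> = pi / real n"
    have "2 \<le> n" using 3 by (simp add: n_def)
    then have \<theta>: "0 < \<theta>" "\<theta> < pi" "real n * \<theta> = pi"
      by (auto simp: \<theta>_def field_simps)
    then have sin: "sin \<theta> \<noteq> 0" using sin_gt_zero[of \<theta>] by simp
    have g: "gram i j = - cos \<theta>" "gram j i = - cos \<theta>" "gram i i = 1" "gram j j = 1"
      using ij gram_sym[of j i] by (auto simp: gram_def \<theta>_def n_def m_diag)
    let ?T = "reflect i \<circ> reflect j"
    have lin: "linear_map (?T ^^ k)" for k
    proof (induction k)
      case (Suc k)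
      then show ?case
        using reflect_linear by (simp add: linear_map_def)
    qed (simp add: linear_map_def)
    \<comment> \<open>The simple roots form the angle \<open>pi - \<theta>\<close>, so
      \<open>rot \<phi>\<close> is \<open>sin \<theta>\<close> times the unit vector of their plane
      at angle \<open>\<phi>\<close> from \<open>simple_root i\<close>.\<close>
    define rot where "rot \<phi> = (\<lambda>k. sin (\<phi> + \<theta>) * simple_root i k + sin \<phi> * simple_root j k)" for \<phi>
    have rot_step: "?T (rot \<phi>) = rot (\<phi> + 2 * \<theta>)" for \<phi>
    proof -
      have j: "root_pairing (rot \<phi>) j = - sin (\<phi> + \<theta>) * cos \<theta> + sin \<phi>"
        using ij by (simp add: rot_def root_pairing_linear g)
      have i: "root_pairing (rot \<phi>) i = sin (\<phi> + \<theta>) - sin \<phi> * cos \<theta>"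
        using ij by (simp add: rot_def root_pairing_linear g)
      have s1: "sin (\<phi> + 2 * \<theta>) = 2 * sin (\<phi> + \<theta>) * cos \<theta> - sin \<phi>" for \<phi>
      proof -
        have "sin (\<phi> + 2 * \<theta>) = sin ((\<phi> + \<theta>) + \<theta>)" "sin \<phi> = sin ((\<phi> + \<theta>) - \<theta>)"
          by (simp_all add: algebra_simps)
        then show ?thesis by (simp only: sin_add[of "\<phi> + \<theta>"] sin_diff[of "\<phi> + \<theta>"])
      qed
      have s2: "sin (\<phi> + 2 * \<theta> + \<theta>) = 2 * sin (\<phi> + 2 * \<theta>) * cos \<theta> - sin (\<phi> + \<theta>)"
        using s1[of "\<phi> + \<theta>"] by (simp add: algebra_simps)
      show ?thesis
      proof
        fix k
        have "?T (rot \<phi>) k = rot \<phi> k - 2 * (- sin (\<phi> + \<theta>) * cos \<theta> + sin \<phi>) * simple_root j k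
            - 2 * (sin (\<phi> + \<theta>) - sin \<phi> * cos \<theta>
              + 2 * (- sin (\<phi> + \<theta>) * cos \<theta> + sin \<phi>) * cos \<theta>) * simple_root i k"
          using ij by (simp add: reflect_def[of i] root_pairing_reflect i j g) (simp add: reflect_def[of j] j)
        also have "\<dots> = rot (\<phi> + 2 * \<theta>) k"
          unfolding rot_def s2 s1 by algebra
        finally show "?T (rot \<phi>) k = rot (\<phi> + 2 * \<theta>) k" .
      qed
    qed
    have rot_pow: "(?T ^^ k) (rot \<phi>) = rot (\<phi> + 2 * (real k * \<theta>))" for k \<phi>
    proof (induction k)
      case (Suc k)
      then show ?case using rot_step[of "\<phi> + 2 * (real k * \<theta>)"] by (simp add: algebra_simps)
    qed simp
    have rot_n: "(?T ^^ n) (rot \<phi>) = rot \<phi>" for \<phi>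
    proof -
      have "sin (\<phi> + 2 * pi + \<theta>) = sin (\<phi> + \<theta>)"
        using sin_periodic[of "\<phi> + \<theta>"] by (simp add: algebra_simps)
      then show ?thesis unfolding rot_pow \<theta>(3) by (simp add: rot_def)
    qed
    show ?thesis
    proof (rule ext)
      fix v
      let ?a = "root_pairing v i" and ?b = "root_pairing v j"
      \<comment> \<open>\<open>x\<close> and \<open>y\<close> solve the Gram system of the plane,
        whose determinant is the square of \<open>sin \<theta>\<close>. Thus \<open>r\<close> is the
        component of \<open>v\<close> orthogonal to both roots.\<close>
      define x where "x = (?a + ?b * cos \<theta>) / (sin \<theta>)\<^sup>2"
      define y where "y = (?b + ?a * cos \<theta>) / (sin \<theta>)\<^sup>2"
      define r where "r = (\<lambda>k. v k - (x * simple_root i k + y * simple_root j k))"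
      have xy: "x - y * cos \<theta> = ?a" "y - x * cos \<theta> = ?b"
      proof -
        have "x - y * cos \<theta> = ((?a + ?b * cos \<theta>) - (?b + ?a * cos \<theta>) * cos \<theta>) / (sin \<theta>)\<^sup>2"
          "y - x * cos \<theta> = ((?b + ?a * cos \<theta>) - (?a + ?b * cos \<theta>) * cos \<theta>) / (sin \<theta>)\<^sup>2"
          by (simp_all add: x_def y_def diff_divide_distrib)
        moreover have "(?a + ?b * cos \<theta>) - (?b + ?a * cos \<theta>) * cos \<theta> = ?a * (sin \<theta>)\<^sup>2"
          "(?b + ?a * cos \<theta>) - (?a + ?b * cos \<theta>) * cos \<theta> = ?b * (sin \<theta>)\<^sup>2"
          unfolding sin_squared_eq by algebra+
        ultimately show "x - y * cos \<theta> = ?a" "y - x * cos \<theta> = ?b"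
          using sin by simp_all
      qed
      have pr: "root_pairing r l = root_pairing v l - (x * gram i l + y * gram j l)" for l
        using ij root_pairing_linear[of 1 v "-1" "\<lambda>k. x * simple_root i k + y * simple_root j k" l]
        by (simp add: r_def root_pairing_linear diff_diff_eq[symmetric] add_diff_eq)
      have "?T r = r"
      proof -
        have "root_pairing r i = 0" "root_pairing r j = 0"
          using xy by (simp_all add: pr g)
        then show ?thesis by (simp add: reflect_def)
      qed
      then have r: "(?T ^^ n) r = r" by (induction n) auto
      \<comment> \<open>As \<open>sin \<theta>\<close> is nonzero, \<open>rot 0\<close> and
        \<open>rot (pi / 2)\<close> form a basis of the plane.\<close>
      have rot0: "rot 0 k = sin \<theta> * simple_root i k"
        and rot1: "rot (pi / 2) k = cos \<theta> * simple_root i k + simple_root j k" for k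
        by (simp_all add: rot_def sin_add)
      have v: "v = (\<lambda>k. 1 * r k + 1 * (((x - y * cos \<theta>) / sin \<theta>) * rot 0 k + y * rot (pi / 2) k))"
        using sin by (rule_tac ext) (simp add: r_def rot0 rot1, algebra)
      have "(?T ^^ n) (\<lambda>k. 1 * r k + 1 * (((x - y * cos \<theta>) / sin \<theta>) * rot 0 k + y * rot (pi / 2) k))
          = (\<lambda>k. 1 * r k + 1 * (((x - y * cos \<theta>) / sin \<theta>) * rot 0 k + y * rot (pi / 2) k))"
        unfolding linear_mapD[OF lin] r rot_n ..
      then have "(?T ^^ n) v = v"
        unfolding v[symmetric] .
      then show "(?T ^^ m i j) v = id v" by (simp add: n_def)
    qed
  qed (use ij in \<open>auto simp: m_diag reflect_involution\<close>)
qed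

text \<open>The geometric representation of Tits, in the coordinates given by the simple roots.
  Vectors are functions on the whole index type; coordinates outside \<open>I\<close> are never
  changed.\<close>

definition geo :: "'a \<Rightarrow> ('i \<Rightarrow> real) \<Rightarrow> 'i \<Rightarrow> real"
  where "geo = (SOME \<rho>. \<rho> \<one> = id \<and>
    (\<forall>g\<in>carrier G. \<forall>h\<in>carrier G. \<rho> (g \<otimes> h) = \<rho> g \<circ> \<rho> h) \<and> (\<forall>i\<in>I. \<rho> (s i) = reflect i))"

lemma geo_one [simp]: "geo \<one> v = v"
  and geo_mult: "g \<in> carrier G \<Longrightarrow> h \<in> carrier G \<Longrightarrow> geo (g \<otimes> h) v = geo g (geo h v)"
  and geo_s [simp]: "i \<in> I \<Longrightarrow> geo (s i) v = reflect i v"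
  using someI_ex[OF presentation_lift[of reflect, OF reflect_involution reflect_braid]]
  unfolding geo_def[symmetric] by auto

lemma geo_inv [simp]:
  "g \<in> carrier G \<Longrightarrow> geo (inv g) (geo g v) = v" "g \<in> carrier G \<Longrightarrow> geo g (geo (inv g) v) = v"
  by (simp_all flip: geo_mult)

lemma geo_linear: "g \<in> carrier G \<Longrightarrow> linear_map (geo g)"
proof (induction g rule: gen_induct)
  case (mult i g)
  then show ?case using reflect_linear[of i] by (simp add: linear_map_def geo_mult)
qed (simp add: linear_map_def)

lemma geo_simple_nonzero:
  assumes "g \<in> carrier G"
  shows "geo g (simple_root i) \<noteq> (\<lambda>_. 0)"
proof
  assume "geo g (simple_root i) = (\<lambda>_. 0)"
  then have "geo (inv g) (geo g (simple_root i)) = (\<lambda>_. 0)"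
    using assms by (simp add: linear_map_zero geo_linear)
  then have "simple_root i i = 0" using assms by (simp add: fun_eq_iff)
  then show False by (simp add: simple_root_def)
qed

section \<open>Positive and negative roots\<close>

text \<open>The alternating product of \<open>k\<close> generators whose last factor is
  \<open>s j\<close>. New factors are added on the left, so that the image of
  \<open>simple_root i\<close> can be computed recursively.\<close>

primrec alt :: "'i \<Rightarrow> 'i \<Rightarrow> nat \<Rightarrow> 'a"
  where
    "alt i j 0 = \<one>"
  | "alt i j (Suc k) = s (if even k then j else i) \<otimes> alt i j k"

lemma alt_closed [simp]: "i \<in> I \<Longrightarrow> j \<in> I \<Longrightarrow> alt i j k \<in> carrier G"
  by (induction k) auto

lemma alt_Suc_right: "i \<in> I \<Longrightarrow> j \<in> I \<Longrightarrow> alt i j (Suc k) = alt j i k \<otimes> s j"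
proof (induction k)
  case (Suc k)
  have "alt i j (Suc (Suc k)) = s (if even (Suc k) then j else i) \<otimes> (alt j i k \<otimes> s j)"
    using Suc by (simp only: alt.simps(2)[of i j "Suc k"])
  also have "\<dots> = alt j i (Suc k) \<otimes> s j"
    using Suc.prems by (simp add: m_assoc)
  finally show ?case .
qed simp

text \<open>For \<open>k = m i j\<close> the right-hand side is the value of a relator, which turns
  the Coxeter relation into the braid relation.\<close>

lemma alt_swap_quotient:
  assumes ij: "i \<in> I" "j \<in> I"
  shows "alt i j k \<otimes> inv (alt j i k) = (if even k then s i \<otimes> s j else s j \<otimes> s i) [^] k"
proof (induction k)
  case (Suc k)
  let ?x = "if even k then j else i" and ?y = "if even k then i else j"
  have xy: "?x \<in> I" "?y \<in> I" using ij by auto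
  have rot: "s x \<otimes> (s y \<otimes> s x) [^] n \<otimes> s y = (s x \<otimes> s y) [^] Suc n" if "x \<in> I" "y \<in> I" for x y and n :: nat
    using that
  proof (induction n)
    case (Suc n)
    have "s x \<otimes> (s y \<otimes> s x) [^] Suc n \<otimes> s y = (s x \<otimes> (s y \<otimes> s x) [^] n \<otimes> s y) \<otimes> (s x \<otimes> s y)"
      using Suc.prems by (simp add: m_assoc)
    then show ?case using Suc by simp
  qed simp
  have "alt i j (Suc k) \<otimes> inv (alt j i (Suc k)) = s ?x \<otimes> (alt i j k \<otimes> inv (alt j i k)) \<otimes> s ?y"
    using ij by (simp add: inv_mult_group m_assoc)
  also have "\<dots> = s ?x \<otimes> (s ?y \<otimes> s ?x) [^] k \<otimes> s ?y"
    using Suc.IH by simp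
  also have "\<dots> = (s ?x \<otimes> s ?y) [^] Suc k"
    using rot[OF xy] .
  finally show ?case by simp
qed (use ij in simp)

lemma alt_braid:
  assumes ij: "i \<in> I" "j \<in> I"
  shows "alt i j (m i j) = alt j i (m i j)"
proof -
  have "(if even (m i j) then s i \<otimes> s j else s j \<otimes> s i) [^] m i j = \<one>"
    using relator_value[OF ij] relator_value[OF ij(2,1)] m_sym[OF ij] by auto
  then have "alt i j (m i j) \<otimes> inv (alt j i (m i j)) = \<one>"
    using alt_swap_quotient[OF ij] by simp
  then show ?thesis
    using ij inv_equality[of "alt i j (m i j)" "inv (alt j i (m i j))"] by simp
qed

lemma len_mult_alt: "g \<in> carrier G \<Longrightarrow> i \<in> I \<Longrightarrow> j \<in> I \<Longrightarrow> len (g \<otimes> alt i j k) \<le> len g + k"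
proof (induction k arbitrary: g)
  case (Suc k)
  let ?x = "if even k then j else i"
  have x: "?x \<in> I" using Suc.prems by auto
  have "len (g \<otimes> alt i j (Suc k)) = len ((g \<otimes> s ?x) \<otimes> alt i j k)"
    using Suc.prems x by (simp add: m_assoc)
  also have "\<dots> \<le> len (g \<otimes> s ?x) + k"
    using Suc.prems x by (intro Suc.IH) auto
  also have "\<dots> \<le> len g + Suc k"
    using len_mult_s_le[OF Suc.prems(1) x] by simp
  finally show ?case .
qed simp

context
  fixes i j :: 'i and \<theta> :: real
  assumes ij: "i \<in> I" "j \<in> I" "i \<noteq> j"
  defines "\<theta> \<equiv> pi / real (m i j)"
begin

lemma dihedral_angle: "\<theta> = 0 \<or> sin \<theta> \<noteq> 0"
proof -
  consider "m i j = 0" | "2 \<le> m i j" using m_off_diag[OF ij] by auto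
  then show ?thesis
  proof cases
    case 2
    then have "0 < \<theta>" "\<theta> < pi" by (auto simp: \<theta>_def field_simps)
    then show ?thesis using sin_gt_zero[of \<theta>] by simp
  qed (simp add: \<theta>_def)
qed

lemma sin_ratio_nonneg:
  assumes "m i j = 0 \<or> k \<le> m i j"
  shows "0 \<le> sin_ratio \<theta> k"
proof -
  consider "m i j = 0" | "m i j \<noteq> 0" "2 \<le> m i j" "k \<le> m i j"
    using m_off_diag[OF ij] assms by auto
  then show ?thesis
  proof cases
    case 2
    then have "0 < \<theta>" "\<theta> < pi" "real k * \<theta> \<le> pi"
      by (auto simp: \<theta>_def field_simps)
    then show ?thesis
      using sin_ge_zero[of \<theta>] sin_ge_zero[of "real k * \<theta>"] by (simp add: sin_ratio_def)
  qed (simp add: \<theta>_def sin_ratio_def)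
qed

text \<open>The reflections alternate, so each step changes only one of the two coordinates, and the
  new value is the one given by the Chebyshev recurrence.\<close>

lemma geo_alt:
  "geo (alt i j k) (simple_root i) =
    (\<lambda>l. sin_ratio \<theta> (if even k then Suc k else k) * simple_root i l +
         sin_ratio \<theta> (if even k then k else Suc k) * simple_root j l)"
proof (induction k)
  case 0
  then show ?case using dihedral_angle by (simp add: sin_ratio_1)
next
  case (Suc k)
  let ?x = "if even k then j else i"
  have x: "?x \<in> I" using ij by auto
  have r: "reflect j (simple_root i) = (\<lambda>k. simple_root i k + 2 * cos \<theta> * simple_root j k)"
    "reflect i (simple_root j) = (\<lambda>k. simple_root j k + 2 * cos \<theta> * simple_root i k)"
    using ij reflect_simple_other[of i j] reflect_simple_other[of j i] m_sym[of i j]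
    by (simp_all add: \<theta>_def)
  have "geo (alt i j (Suc k)) (simple_root i) = reflect ?x (geo (alt i j k) (simple_root i))"
    using ij x by (simp add: geo_mult)
  then show ?case
    unfolding Suc.IH linear_mapD[OF reflect_linear]
    using ij by (auto simp: r reflect_simple sin_ratio_rec algebra_simps fun_eq_iff)
qed

end

text \<open>The key fact on the geometric representation: ascents of the length give positive roots.
  The element is split as \<open>w = v k \<otimes> alt i j k\<close> with additive lengths, such
  that both \<open>s i\<close> and \<open>s j\<close> lengthen \<open>v k\<close>. Induction applies
  to \<open>v k\<close>, and the dihedral factor contributes nonnegative coefficients.\<close>

lemma simple_root_image_nonneg:
  "w \<in> carrier G \<Longrightarrow> i \<in> I \<Longrightarrow> len w < len (w \<otimes> s i) \<Longrightarrow> vec_nonneg (geo w (simple_root i))"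
proof (induction "len w" arbitrary: w i rule: less_induct)
  case less
  show ?case
  proof (cases "w = \<one>")
    case True
    then show ?thesis by (simp add: vec_nonneg_def simple_root_def)
  next
    case False
    obtain j where j: "j \<in> I" "len w = Suc (len (w \<otimes> s j))"
      using len_descent[OF less.prems(1) False] by blast
    then have ij: "i \<in> I" "j \<in> I" "i \<noteq> j" using less.prems by auto
    define v where "v k = w \<otimes> inv (alt i j k)" for k
    have v_closed: "v k \<in> carrier G" for k using ij less.prems by (simp add: v_def)
    have v_Suc: "v (Suc k) = v k \<otimes> s (if even k then j else i)" for k
      using ij less.prems by (simp add: v_def inv_mult_group m_assoc)
    have w: "w = v k \<otimes> alt i j k" for k
      using ij less.prems by (simp add: v_def m_assoc)
    \<comment> \<open>The \<open>k\<close> for which splitting off the alternating product keeps the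
      lengths additive. By maximality of the chosen \<open>k\<close>, one of the two generators
      lengthens \<open>v k\<close>; the other one leads back to the longer
      \<open>v k'\<close>.\<close>
    define K where "K = {k. len (v k) + k = len w}"
    have "K \<subseteq> {..len w}" by (auto simp: K_def)
    then have "finite K" by (rule finite_subset) simp
    have v1: "v 0 = w" "v (Suc 0) = w \<otimes> s j" using v_Suc[of 0] less.prems by (auto simp: v_def)
    then have K01: "0 \<in> K" "Suc 0 \<in> K" using j by (auto simp: K_def)
    have K_down: "k \<in> K" if "Suc k \<in> K" for k
    proof -
      have "len w \<le> len (v k) + k"
        using len_mult_alt[OF v_closed ij(1,2)] w[of k] by metis
      moreover have "len (v k) \<le> Suc (len (v (Suc k)))"
        using len_mult_s_ge[OF v_closed, of "if even k then j else i"] ij by (auto simp: v_Suc)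
      ultimately show ?thesis using that by (simp add: K_def)
    qed
    define k where "k = Max K"
    have k: "k \<in> K" "Suc k \<notin> K" "k \<noteq> 0"
      using Max_in[OF \<open>finite K\<close>] Max_ge[OF \<open>finite K\<close>] K01 unfolding k_def by force+
    then obtain k' where k': "k = Suc k'" by (cases k) auto
    have "k' \<in> K" using K_down k k' by simp
    let ?a = "if even k then j else i" and ?b = "if even k then i else j"
    have ab: "?a \<in> I" "?b \<in> I" using ij by auto
    have a: "len (v k) < len (v k \<otimes> s ?a)"
      using k len_mult_s_ge[OF v_closed ab(1), of k] len_mult_s_neq[OF v_closed ab(1), of k]
      by (auto simp: K_def v_Suc)
    have "v k \<otimes> s ?b = v k'"
      using ij v_closed[of k'] k' by (auto simp: v_Suc m_assoc)
    then have b: "len (v k) < len (v k \<otimes> s ?b)"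
      using k \<open>k' \<in> K\<close> k' by (simp add: K_def)
    have small: "len (v k) < len w" using k by (auto simp: K_def)
    have "vec_nonneg (geo (v k) (simple_root ?a))" "vec_nonneg (geo (v k) (simple_root ?b))"
      using less.hyps[OF small v_closed] ab a b by blast+
    then have pos: "vec_nonneg (geo (v k) (simple_root i))" "vec_nonneg (geo (v k) (simple_root j))"
      by (auto split: if_splits)
    \<comment> \<open>If \<open>k\<close> reached \<open>m i j\<close>, the braid relation would let
      the alternating factor end in \<open>s i\<close>, and \<open>w \<otimes> s i\<close> would be
      shorter than \<open>w\<close>. The strict bound keeps \<open>Suc k\<close> within the range
      where \<open>sin_ratio\<close> is nonnegative.\<close>
    have "m i j = 0 \<or> k < m i j"
    proof (rule ccontr)
      assume "\<not> ?thesis"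
      then have m: "m i j \<noteq> 0" "m i j \<le> k" by auto
      have down: "k - l \<in> K" for l
      proof (induction l)
        case (Suc l)
        then show ?case using K_down[of "k - Suc l"] by (cases "l < k") (auto simp: Suc_diff_Suc)
      qed (use k in simp)
      obtain n where n: "m i j = Suc n" using m by (cases "m i j") auto
      have "Suc n \<in> K" using down[of "k - Suc n"] m n by simp
      have "w \<otimes> s i = v (Suc n) \<otimes> alt j i (Suc n) \<otimes> s i"
        using w[of "Suc n"] alt_braid[OF ij(1,2)] n by simp
      also have "\<dots> = v (Suc n) \<otimes> alt i j n"
        using ij v_closed unfolding alt_Suc_right[OF ij(2,1)] by (simp add: m_assoc)
      finally have "len (w \<otimes> s i) \<le> len (v (Suc n)) + n"
        using len_mult_alt[OF v_closed ij(1,2)] by simp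
      then show False using \<open>Suc n \<in> K\<close> less.prems(3) by (simp add: K_def)
    qed
    then have "0 \<le> sin_ratio (pi / real (m i j)) k" "0 \<le> sin_ratio (pi / real (m i j)) (Suc k)"
      using sin_ratio_nonneg[OF ij] by auto
    moreover have "geo w (simple_root i) = geo (v k) (geo (alt i j k) (simple_root i))"
      using w[of k] geo_mult[OF v_closed, of "alt i j k"] ij by simp
    ultimately show ?thesis
      unfolding geo_alt[OF ij] linear_mapD[OF geo_linear[OF v_closed]]
      using pos by (auto intro!: vec_nonneg_combination)
  qed
qed

lemma simple_root_image_nonpos:
  assumes "w \<in> carrier G" "i \<in> I" "len (w \<otimes> s i) < len w"
  shows "vec_nonpos (geo w (simple_root i))"
proof -
  have "vec_nonneg (geo (w \<otimes> s i) (simple_root i))"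
    using assms by (intro simple_root_image_nonneg) (auto simp: m_assoc)
  moreover have "geo (w \<otimes> s i) (simple_root i) = (\<lambda>k. - geo w (simple_root i) k)"
    using assms by (simp add: geo_mult reflect_simple linear_map_minus geo_linear)
  ultimately show ?thesis by (simp add: vec_nonneg_minus)
qed

lemma root_sign:
  assumes "w \<in> carrier G" "i \<in> I"
  shows "vec_nonneg (geo w (simple_root i)) \<or> vec_nonpos (geo w (simple_root i))"
    and "\<not> (vec_nonneg (geo w (simple_root i)) \<and> vec_nonpos (geo w (simple_root i)))"
  using assms simple_root_image_nonneg simple_root_image_nonpos len_mult_s_neq
    geo_simple_nonzero vec_nonneg_nonpos by (meson linorder_neqE_nat)+

text \<open>Otherwise some \<open>s i\<close> shortens \<open>w\<close>, and that simple root goes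
  to a negative one. This is the form in which faithfulness of the representation enters.\<close>

lemma nonneg_on_simple_imp_one:
  assumes "w \<in> carrier G" "\<And>i. i \<in> I \<Longrightarrow> vec_nonneg (geo w (simple_root i))"
  shows "w = \<one>"
proof (rule ccontr)
  assume "w \<noteq> \<one>"
  then obtain i where i: "i \<in> I" "len w = Suc (len (w \<otimes> s i))"
    using len_descent[OF assms(1)] by blast
  then show False
    using simple_root_image_nonpos[OF assms(1) i(1)] root_sign(2)[OF assms(1) i(1)] assms(2)[OF i(1)]
    by simp
qed

lemma s_neq_one: "i \<in> I \<Longrightarrow> s i \<noteq> \<one>"
proof
  assume "i \<in> I" "s i = \<one>"
  then have "(\<lambda>k. - simple_root i k) = simple_root i"
    using reflect_simple[of i] geo_s[of i "simple_root i"] by simp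
  then have "- simple_root i i = simple_root i i" by (rule fun_cong)
  then show False by (simp add: simple_root_def)
qed

section \<open>Half-spaces\<close>

text \<open>Group elements play the role of chambers. The root \<open>geo w (simple_root i)\<close>
  is positive as seen from \<open>u\<close> iff \<open>u\<close> is on the same side as
  \<open>w\<close> of the wall between \<open>w\<close> and \<open>w \<otimes> s i\<close>.\<close>

definition half_space :: "'a \<Rightarrow> 'i \<Rightarrow> 'a set"
  where "half_space w i = {u \<in> carrier G. vec_nonneg (geo (inv u \<otimes> w) (simple_root i))}"

definition half_spaces :: "'a set set"
  where "half_spaces = {half_space w i | w i. w \<in> carrier G \<and> i \<in> I}"

definition half_space_refl :: "'a set \<Rightarrow> 'a"
  where "half_space_refl H =
    (THE x. \<exists>w\<in>carrier G. \<exists>i\<in>I. H = half_space w i \<and> x = w \<otimes> s i \<otimes> inv w)"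

text \<open>Only the half-space on the side of \<open>u\<close> is collected, so each separating
  wall counts once.\<close>

definition separating :: "'a \<Rightarrow> 'a \<Rightarrow> 'a set set"
  where "separating u v = {H \<in> half_spaces. u \<in> H \<and> v \<notin> H}"

lemma half_spacesI [intro]: "w \<in> carrier G \<Longrightarrow> i \<in> I \<Longrightarrow> half_space w i \<in> half_spaces"
  by (auto simp: half_spaces_def)

lemma half_spacesE:
  assumes "H \<in> half_spaces"
  obtains w i where "w \<in> carrier G" "i \<in> I" "H = half_space w i"
  using assms by (auto simp: half_spaces_def)

lemma half_space_subset: "H \<in> half_spaces \<Longrightarrow> H \<subseteq> carrier G"
  by (auto simp: half_spaces_def half_space_def)

lemma half_space_base: "w \<in> carrier G \<Longrightarrow> i \<in> I \<Longrightarrow> w \<in> half_space w i"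
  by (simp add: half_space_def vec_nonneg_def simple_root_def)

lemma half_space_compl:
  assumes "w \<in> carrier G" "i \<in> I"
  shows "carrier G - half_space w i = half_space (w \<otimes> s i) i"
proof -
  have "vec_nonneg (geo (inv u \<otimes> (w \<otimes> s i)) (simple_root i)) \<longleftrightarrow>
      \<not> vec_nonneg (geo (inv u \<otimes> w) (simple_root i))" if "u \<in> carrier G" for u
  proof -
    have "geo (inv u \<otimes> (w \<otimes> s i)) (simple_root i) = (\<lambda>k. - geo (inv u \<otimes> w) (simple_root i) k)"
      using that assms
      by (simp add: geo_mult[of "inv u \<otimes> w" "s i"] m_assoc[symmetric] reflect_simple linear_map_minus geo_linear)
    then show ?thesis
      using root_sign[of "inv u \<otimes> w" i] that assms by (auto simp: vec_nonneg_minus)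
  qed
  then show ?thesis by (auto simp: half_space_def)
qed

lemma half_spaces_compl: "H \<in> half_spaces \<Longrightarrow> carrier G - H \<in> half_spaces"
  using half_space_compl half_spacesI by (force elim!: half_spacesE)

lemma half_space_ne: "H \<in> half_spaces \<Longrightarrow> H \<noteq> {}"
  using half_space_base by (auto elim!: half_spacesE)

lemma mem_l_coset_iff:
  assumes "g \<in> carrier G" "H \<subseteq> carrier G"
  shows "u \<in> g <# H \<longleftrightarrow> u \<in> carrier G \<and> inv g \<otimes> u \<in> H"
proof
  assume "u \<in> carrier G \<and> inv g \<otimes> u \<in> H"
  moreover from this have "u = g \<otimes> (inv g \<otimes> u)" using assms by (simp add: m_assoc[symmetric])
  ultimately show "u \<in> g <# H" unfolding l_coset_def by blast
qed (use assms in \<open>auto simp: l_coset_def m_assoc[symmetric] subset_iff\<close>)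

lemma half_space_translate:
  assumes "g \<in> carrier G" "w \<in> carrier G" "i \<in> I"
  shows "g <# half_space w i = half_space (g \<otimes> w) i"
  using assms half_space_subset[of "half_space w i"]
  by (auto simp: mem_l_coset_iff half_spacesI half_space_def inv_mult_group m_assoc)

lemma half_spaces_translate: "g \<in> carrier G \<Longrightarrow> H \<in> half_spaces \<Longrightarrow> g <# H \<in> half_spaces"
  using half_spacesI by (force elim!: half_spacesE simp: half_space_translate)

lemma half_space_scale:
  assumes "w \<in> carrier G" "u \<in> carrier G"
    and c: "geo w (simple_root j) = (\<lambda>k. c * geo u (simple_root i) k)" "0 < c"
  shows "half_space w j = half_space u i"
proof -
  have "vec_nonneg (geo (inv v \<otimes> w) (simple_root j)) = vec_nonneg (geo (inv v \<otimes> u) (simple_root i))"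
    if "v \<in> carrier G" for v
    using that assms by (simp add: geo_mult linear_map_scale geo_linear vec_nonneg_scale_iff)
  then show ?thesis by (auto simp: half_space_def)
qed

text \<open>An edge crosses only its own wall: \<open>s i\<close> changes only coordinate
  \<open>i\<close>, so a positive root that it makes negative is a positive multiple of
  \<open>simple_root i\<close>.\<close>

lemma half_space_edge:
  assumes wu: "w \<in> carrier G" "u \<in> carrier G" and ij: "i \<in> I" "j \<in> I"
    and sep: "u \<in> half_space w j" "u \<otimes> s i \<notin> half_space w j"
  shows "\<exists>c>0. geo w (simple_root j) = (\<lambda>k. c * geo u (simple_root i) k)"
    and "half_space w j = half_space u i"
    and "w \<otimes> s j \<otimes> inv w = u \<otimes> s i \<otimes> inv u"
proof -
  define p where "p = inv u \<otimes> w"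
  have p: "p \<in> carrier G" "w = u \<otimes> p" using wu by (auto simp: p_def m_assoc[symmetric])
  define \<beta> where "\<beta> = geo p (simple_root j)"
  define c where "c = \<beta> i"
  have pos: "vec_nonneg \<beta>" using sep(1) by (simp add: half_space_def \<beta>_def p_def)
  have "inv (u \<otimes> s i) \<otimes> w = s i \<otimes> p"
    using wu ij by (simp add: p_def inv_mult_group m_assoc)
  then have "\<not> vec_nonneg (reflect i \<beta>)"
    using sep(2) wu ij p by (simp add: half_space_def \<beta>_def geo_mult)
  then have "vec_nonpos (reflect i \<beta>)"
    using root_sign(1)[of "s i \<otimes> p" j] p ij by (simp add: geo_mult \<beta>_def)
  then have "\<beta> k \<le> 0" if "k \<noteq> i" for k
    using that by (auto simp: vec_nonpos_def reflect_def simple_root_def dest!: spec[of _ k])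
  then have \<beta>: "\<beta> = (\<lambda>k. c * simple_root i k)"
    using pos by (auto simp: fun_eq_iff c_def simple_root_def vec_nonneg_def intro: antisym)
  have "c \<noteq> 0"
    using geo_simple_nonzero[OF p(1), of j] \<beta> by (auto simp: \<beta>_def[symmetric])
  moreover have "0 \<le> c" using pos by (simp add: c_def vec_nonneg_def)
  ultimately have c: "0 < c" by simp
  have w: "geo w (simple_root j) = (\<lambda>k. c * geo u (simple_root i) k)"
    using wu p \<beta> by (simp add: geo_mult \<beta>_def[symmetric] linear_map_scale geo_linear)
  then show "\<exists>c>0. geo w (simple_root j) = (\<lambda>k. c * geo u (simple_root i) k)"
    using c by blast
  show "half_space w j = half_space u i"
    using half_space_scale[OF wu w c] .
  text \<open>The two reflections have proportional roots, so their product \<open>s i \<otimes> y\<close> maps every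
    simple root to a positive one.\<close>
  define y where "y = p \<otimes> s j \<otimes> inv p"
  have y: "y \<in> carrier G" using p ij by (simp add: y_def)
  have geo_y: "geo y v = (\<lambda>k. v k - 2 * root_pairing (geo (inv p) v) j * c * simple_root i k)" for v
  proof -
    have "geo y v = geo p (reflect j (geo (inv p) v))"
      using p ij by (simp add: y_def geo_mult)
    also have "\<dots> = (\<lambda>k. v k - 2 * root_pairing (geo (inv p) v) j * \<beta> k)"
      unfolding reflect_def linear_map_diff_scale[OF geo_linear[OF p(1)]]
      using p by (simp add: \<beta>_def)
    finally show ?thesis by (simp add: \<beta> mult.assoc)
  qed
  have "vec_nonneg (geo (s i \<otimes> y) (simple_root k))" if k: "k \<in> I" for k
  proof (cases "k = i")
    case True
    have "simple_root i = (\<lambda>k. (1 / c) * \<beta> k)" using c by (simp add: \<beta>)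
    then have "geo (inv p) (simple_root i) = (\<lambda>k. (1 / c) * geo (inv p) \<beta> k)"
      using linear_map_scale[OF geo_linear[of "inv p"], of "1 / c" \<beta>] p by simp
    then have "geo (inv p) (simple_root i) = (\<lambda>k. (1 / c) * simple_root j k)"
      using p by (simp add: \<beta>_def)
    then have "root_pairing (geo (inv p) (simple_root i)) j = 1 / c"
      using root_pairing_linear[of "1 / c" "simple_root j" 0 "simple_root j" j] ij
      by (simp add: gram_diag)
    then have "geo y (simple_root i) = (\<lambda>k. - simple_root i k)"
      using c by (simp add: geo_y)
    then have "geo (s i \<otimes> y) (simple_root i) = simple_root i"
      using y ij by (simp add: geo_mult linear_map_minus[OF reflect_linear] reflect_simple)
    then show ?thesis using True by (simp add: vec_nonneg_def simple_root_def)
  next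
    case False
    \<comment> \<open>Both \<open>s i\<close> and \<open>y\<close> alter only coordinate
      \<open>i\<close>.\<close>
    have "geo (s i \<otimes> y) (simple_root k) k = 1"
      using y ij False by (simp add: geo_mult reflect_def geo_y) (simp add: simple_root_def)
    then have "\<not> vec_nonpos (geo (s i \<otimes> y) (simple_root k))"
      by (metis vec_nonpos_def not_one_le_zero)
    then show ?thesis using root_sign(1)[of "s i \<otimes> y" k] y ij k by auto
  qed
  then have "s i \<otimes> y = \<one>"
    using y ij by (intro nonneg_on_simple_imp_one) auto
  then have "y = s i" using y ij by (metis inv_equality inv_inv inv_s s_closed)
  have "w \<otimes> s j \<otimes> inv w = u \<otimes> y \<otimes> inv u"
    using p wu ij by (simp add: y_def inv_mult_group m_assoc)
  then show "w \<otimes> s j \<otimes> inv w = u \<otimes> s i \<otimes> inv u"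
    using \<open>y = s i\<close> by simp
qed

lemma half_space_not_base_s:
  assumes "w \<in> carrier G" "i \<in> I"
  shows "w \<otimes> s i \<notin> half_space w i"
  using half_space_compl[OF assms] half_space_base[of "w \<otimes> s i" i] assms by auto

text \<open>The definite description is justified because the edge from \<open>w\<close> to
  \<open>w \<otimes> s i\<close> leaves the half-space, and such an edge determines the
  reflection.\<close>

lemma half_space_refl:
  assumes "w \<in> carrier G" "i \<in> I"
  shows "half_space_refl (half_space w i) = w \<otimes> s i \<otimes> inv w"
  unfolding half_space_refl_def
proof (rule the_equality)
  fix x assume "\<exists>u\<in>carrier G. \<exists>j\<in>I. half_space w i = half_space u j \<and> x = u \<otimes> s j \<otimes> inv u"
  then obtain u j where uj: "u \<in> carrier G" "j \<in> I" "half_space w i = half_space u j" "x = u \<otimes> s j \<otimes> inv u"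
    by blast
  then show "x = w \<otimes> s i \<otimes> inv w"
    using half_space_edge(3)[OF uj(1) assms(1) assms(2) uj(2)] half_space_base[OF assms]
      half_space_not_base_s[OF assms] by simp
qed (use assms in blast)

lemma half_space_refl_reflection:
  "H \<in> half_spaces \<Longrightarrow> half_space_refl H \<in> reflections G (s ` I)"
  by (force elim!: half_spacesE simp: half_space_refl reflections_def)

lemma reflection_half_space:
  assumes "x \<in> reflections G (s ` I)"
  obtains w i where "w \<in> carrier G" "i \<in> I" "x = w \<otimes> s i \<otimes> inv w" "half_space_refl (half_space w i) = x"
  using assms half_space_refl by (auto simp: reflections_def)

lemma half_space_refl_translate:
  "g \<in> carrier G \<Longrightarrow> H \<in> half_spaces \<Longrightarrow>
    half_space_refl (g <# H) = g \<otimes> half_space_refl H \<otimes> inv g"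
  by (auto elim!: half_spacesE simp: half_space_translate half_space_refl inv_mult_group m_assoc)

text \<open>Equal reflections give \<open>s i \<otimes> p = p \<otimes> s j\<close>, so
  \<open>s i\<close> negates \<open>geo p (simple_root j)\<close>, which is therefore a multiple of
  \<open>simple_root i\<close>. The sign of the factor decides between the two sides.\<close>

lemma half_space_refl_eqD:
  assumes "H \<in> half_spaces" "K \<in> half_spaces" "half_space_refl H = half_space_refl K"
  shows "H = K \<or> H = carrier G - K"
proof -
  obtain w j u i where H: "w \<in> carrier G" "j \<in> I" "H = half_space w j"
    and K: "u \<in> carrier G" "i \<in> I" "K = half_space u i"
    using assms by (metis half_spacesE)
  have eq: "w \<otimes> s j \<otimes> inv w = u \<otimes> s i \<otimes> inv u"
    using assms H K by (simp add: half_space_refl)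
  define p where "p = inv u \<otimes> w"
  have p: "p \<in> carrier G" "w = u \<otimes> p" using H K by (auto simp: p_def m_assoc[symmetric])
  have "s i \<otimes> p = inv u \<otimes> (u \<otimes> s i \<otimes> inv u) \<otimes> w"
    using H K by (simp add: p_def m_assoc) (simp add: m_assoc[symmetric])
  also have "\<dots> = p \<otimes> s j"
    unfolding eq[symmetric] using H K by (simp add: p_def m_assoc)
  finally have sp: "s i \<otimes> p = p \<otimes> s j" .
  define \<alpha> where "\<alpha> = geo p (simple_root j)"
  define c where "c = \<alpha> i"
  have "reflect i \<alpha> = geo (s i \<otimes> p) (simple_root j)"
    using p K by (simp add: geo_mult \<alpha>_def)
  also have "\<dots> = (\<lambda>k. - \<alpha> k)"
    using p H by (simp add: sp geo_mult \<alpha>_def reflect_simple linear_map_minus geo_linear)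
  finally have "\<alpha> k = 0" if "k \<noteq> i" for k
    using that by (auto simp: reflect_def simple_root_def fun_eq_iff dest!: spec[of _ k])
  then have \<alpha>: "\<alpha> = (\<lambda>k. c * simple_root i k)"
    by (auto simp: fun_eq_iff c_def simple_root_def)
  have "c \<noteq> 0"
    using geo_simple_nonzero[OF p(1), of j] \<alpha> by (auto simp: \<alpha>_def[symmetric])
  have w: "geo w (simple_root j) = (\<lambda>k. c * geo u (simple_root i) k)"
    using H K p \<alpha> by (simp add: geo_mult \<alpha>_def[symmetric] linear_map_scale geo_linear)
  show ?thesis
  proof (cases "0 < c")
    case True
    then show ?thesis using half_space_scale[OF H(1) K(1) w] H K by simp
  next
    case False
    have "geo w (simple_root j) = (\<lambda>k. (- c) * geo (u \<otimes> s i) (simple_root i) k)"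
      using K w by (simp add: geo_mult reflect_simple linear_map_minus geo_linear)
    then have "half_space w j = half_space (u \<otimes> s i) i"
      using False \<open>c \<noteq> 0\<close> H K by (intro half_space_scale[where c = "- c"]) auto
    then show ?thesis using half_space_compl H K by simp
  qed
qed

lemma separating_edge:
  assumes "u \<in> carrier G" "i \<in> I"
  shows "separating u (u \<otimes> s i) = {half_space u i}"
proof
  show "separating u (u \<otimes> s i) \<subseteq> {half_space u i}"
  proof
    fix H assume "H \<in> separating u (u \<otimes> s i)"
    then have H: "H \<in> half_spaces" "u \<in> H" "u \<otimes> s i \<notin> H" by (auto simp: separating_def)
    then obtain w j where w: "w \<in> carrier G" "j \<in> I" "H = half_space w j" by (elim half_spacesE)
    then show "H \<in> {half_space u i}"
      using half_space_edge(2)[OF w(1) assms w(2)] H by simp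
  qed
  show "{half_space u i} \<subseteq> separating u (u \<otimes> s i)"
    using half_space_base[OF assms] half_space_not_base_s[OF assms] half_spacesI[OF assms]
    by (simp add: separating_def)
qed

text \<open>Along a path in the Cayley graph, each edge contributes a single half-space.\<close>

lemma finite_separating:
  assumes "u \<in> carrier G" "v \<in> carrier G"
  shows "finite (separating u v)"
proof -
  have "\<forall>u\<in>carrier G. finite (separating u (u \<otimes> g))" if "g \<in> carrier G" for g
    using that
  proof (induction g rule: gen_induct)
    case (mult i g)
    show ?case
    proof
      fix u assume u: "u \<in> carrier G"
      have "separating u (u \<otimes> (s i \<otimes> g)) \<subseteq>
          separating u (u \<otimes> s i) \<union> separating (u \<otimes> s i) (u \<otimes> s i \<otimes> g)"
        using u mult by (auto simp: separating_def m_assoc)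
      moreover have "finite (separating (u \<otimes> s i) (u \<otimes> s i \<otimes> g))"
        using u mult by simp
      ultimately show "finite (separating u (u \<otimes> (s i \<otimes> g)))"
        using separating_edge[OF u mult(1)] by (metis finite_Un finite_insert finite.emptyI finite_subset)
    qed
  qed (simp add: separating_def)
  from this[of "inv u \<otimes> v"] show ?thesis
    using assms by (auto simp: m_assoc[symmetric] dest!: bspec[of _ _ u])
qed

lemma eq_one_if_no_separating:
  assumes "u \<in> carrier G" "separating \<one> u = {}"
  shows "u = \<one>"
proof -
  have "u \<in> half_space \<one> i" if "i \<in> I" for i
    using assms(2) half_space_base[OF one_closed that] half_spacesI[OF one_closed that]
    by (auto simp: separating_def)
  then have "inv u = \<one>"
    using assms by (intro nonneg_on_simple_imp_one) (auto simp: half_space_def)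
  then show ?thesis using assms(1) by (metis inv_inv inv_one)
qed

lemma separating_translate:
  assumes "g \<in> carrier G" "u \<in> carrier G" "v \<in> carrier G"
  shows "separating (g \<otimes> u) (g \<otimes> v) = (\<lambda>H. g <# H) ` separating u v"
proof -
  have sub: "g <# H \<in> separating (g \<otimes> u) (g \<otimes> v)"
    if "g \<in> carrier G" "u \<in> carrier G" "v \<in> carrier G" "H \<in> separating u v" for g u v H
  proof -
    have "H \<in> half_spaces" "H \<subseteq> carrier G"
      using that half_space_subset by (auto simp: separating_def)
    then show ?thesis
      using that by (simp add: separating_def half_spaces_translate mem_l_coset_iff m_assoc[symmetric])
  qed
  show ?thesis
  proof (intro subset_antisym subsetI)
    fix H assume H: "H \<in> separating (g \<otimes> u) (g \<otimes> v)"
    then have "inv g <# H \<in> separating (inv g \<otimes> (g \<otimes> u)) (inv g \<otimes> (g \<otimes> v))"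
      using assms sub by simp
    then have "inv g <# H \<in> separating u v"
      using assms by (simp add: m_assoc[symmetric])
    moreover have "H \<subseteq> carrier G" using H half_space_subset by (auto simp: separating_def)
    then have "H = g <# (inv g <# H)"
      using assms by (simp add: lcos_m_assoc lcos_mult_one)
    ultimately show "H \<in> (\<lambda>H. g <# H) ` separating u v" by blast
  qed (use sub assms in blast)
qed

lemma l_coset_cancel:
  assumes "g \<in> carrier G" "H \<subseteq> carrier G" "K \<subseteq> carrier G" "g <# H = g <# K"
  shows "H = K"
proof -
  have "inv g <# (g <# H) = inv g <# (g <# K)" using assms(4) by simp
  then show ?thesis using assms(1-3) by (simp add: lcos_m_assoc lcos_mult_one)
qed

text \<open>Every \<open>u \<noteq> \<one>\<close> lies behind the wall of some generator
  \<open>s i\<close>, and fewer half-spaces separate the identity from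
  \<open>s i \<otimes> u\<close>. So the ball of radius \<open>Suc n\<close> is covered by the
  identity and finitely many translates of the ball of radius \<open>n\<close>.\<close>

lemma finite_few_separating:
  "finite {u \<in> carrier G. card (separating \<one> u) \<le> n}"
proof (induction n)
  case 0
  have "{u \<in> carrier G. card (separating \<one> u) \<le> 0} \<subseteq> {\<one>}"
    using finite_separating eq_one_if_no_separating by auto
  then show ?case by (rule finite_subset) simp
next
  case (Suc n)
  have "{u \<in> carrier G. card (separating \<one> u) \<le> Suc n} \<subseteq>
      insert \<one> (\<Union>i\<in>I. (\<lambda>u. s i \<otimes> u) ` {u \<in> carrier G. card (separating \<one> u) \<le> n})"
  proof
    fix u assume "u \<in> {u \<in> carrier G. card (separating \<one> u) \<le> Suc n}"
    then have u: "u \<in> carrier G" "card (separating \<one> u) \<le> Suc n" by auto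
    show "u \<in> insert \<one> (\<Union>i\<in>I. (\<lambda>u. s i \<otimes> u) ` {u \<in> carrier G. card (separating \<one> u) \<le> n})"
    proof (cases "u = \<one>")
      case False
      obtain i where i: "i \<in> I" "u \<notin> half_space \<one> i"
      proof -
        have "\<exists>i\<in>I. \<not> vec_nonneg (geo (inv u) (simple_root i))"
          using nonneg_on_simple_imp_one[of "inv u"] u False by (metis inv_closed inv_inv inv_one)
        then show ?thesis using that u by (auto simp: half_space_def)
      qed
      have edge: "separating (s i) (s i \<otimes> s i) = {half_space (s i) i}"
        using separating_edge[of "s i" i] i by simp
      have "separating (s i) u \<subseteq> separating \<one> u - {half_space \<one> i}"
      proof
        fix H assume H: "H \<in> separating (s i) u"
        have "\<one> \<in> H"
        proof (rule ccontr)
          assume "\<one> \<notin> H"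
          then have "H \<in> separating (s i) (s i \<otimes> s i)"
            using H i by (auto simp: separating_def)
          then have "H = half_space (s i) i" using edge by simp
          also have "\<dots> = carrier G - half_space \<one> i"
            using half_space_compl[OF one_closed i(1)] i by simp
          finally show False using H i u by (auto simp: separating_def)
        qed
        moreover have "s i \<notin> half_space \<one> i"
          using half_space_not_base_s[OF one_closed i(1)] i by simp
        ultimately show "H \<in> separating \<one> u - {half_space \<one> i}"
          using H by (auto simp: separating_def)
      qed
      moreover have "half_space \<one> i \<in> separating \<one> u"
        using i half_space_base by (auto simp: separating_def)
      ultimately have "card (separating (s i) u) < card (separating \<one> u)"
        using finite_separating[of \<one> u] u by (intro psubset_card_mono) auto
      moreover have "separating (s i) u = (\<lambda>H. s i <# H) ` separating \<one> (s i \<otimes> u)"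
        using separating_translate[of "s i" \<one> "s i \<otimes> u"] i u by simp
      moreover have "inj_on (\<lambda>H. s i <# H) (separating \<one> (s i \<otimes> u))"
        using i half_space_subset l_coset_cancel[of "s i"]
        by (intro inj_onI) (auto simp: separating_def)
      ultimately have "card (separating \<one> (s i \<otimes> u)) \<le> n"
        using u by (simp add: card_image)
      moreover have "u = s i \<otimes> (s i \<otimes> u)" using i u by simp
      ultimately show ?thesis using i u by blast
    qed simp
  qed
  then show ?case
    by (rule finite_subset) (use Suc finite_I in auto)
qed

section \<open>Crossing walls\<close>

lemma reflection_square:
  assumes "x \<in> reflections G (s ` I)"
  shows "x \<in> carrier G" "x \<otimes> x = \<one>" "inv x = x"
proof -
  obtain w i where w: "w \<in> carrier G" "i \<in> I" "x = w \<otimes> s i \<otimes> inv w"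
    using assms by (rule reflection_half_space)
  then show x: "x \<in> carrier G" by simp
  show "x \<otimes> x = \<one>"
    using w by (simp add: m_assoc) (simp add: m_assoc[symmetric])
  then show "inv x = x" using x inv_equality by blast
qed

lemma geo_reflection:
  assumes "w \<in> carrier G" "i \<in> I"
  shows "geo (w \<otimes> s i \<otimes> inv w) v =
    (\<lambda>k. v k - 2 * root_pairing (geo (inv w) v) i * geo w (simple_root i) k)"
proof -
  have "geo (w \<otimes> s i \<otimes> inv w) v = geo w (reflect i (geo (inv w) v))"
    using assms by (simp add: geo_mult)
  then show ?thesis
    unfolding reflect_def linear_map_diff_scale[OF geo_linear[OF assms(1)]]
    using assms by simp
qed

text \<open>
  The roots of the conjugates of \<open>x\<close> by powers of \<open>x \<otimes> y\<close> lie in the plane spanned by the roots of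
  \<open>x\<close> and \<open>y\<close>, so each of their half-spaces separates two opposite corners. As these are finitely
  many, some power of \<open>x \<otimes> y\<close> commutes with \<open>x\<close>.
\<close>

lemma crossing_finite_order:
  assumes H: "H \<in> half_spaces" and K: "K \<in> half_spaces"
    and corners: "H \<inter> K \<noteq> {}" "H - K \<noteq> {}" "K - H \<noteq> {}" "carrier G - (H \<union> K) \<noteq> {}"
  shows "\<exists>n>0. (half_space_refl H \<otimes> half_space_refl K) [^] (n::nat) = \<one>"
proof -
  obtain w i where wi: "w \<in> carrier G" "i \<in> I" "H = half_space w i" using H by (elim half_spacesE)
  obtain u j where uj: "u \<in> carrier G" "j \<in> I" "K = half_space u j" using K by (elim half_spacesE)
  define x where "x = half_space_refl H"
  define y where "y = half_space_refl K"
  have x: "x = w \<otimes> s i \<otimes> inv w" and y: "y = u \<otimes> s j \<otimes> inv u"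
    using wi uj by (simp_all add: x_def y_def half_space_refl)
  have "x \<in> reflections G (s ` I)" "y \<in> reflections G (s ` I)"
    using H K by (simp_all add: x_def y_def half_space_refl_reflection)
  note xx = reflection_square[OF this(1)] and yy = reflection_square[OF this(2)]
  define z where "z = x \<otimes> y"
  have z: "z \<in> carrier G" using xx yy by (simp add: z_def)
  define \<alpha> where "\<alpha> = geo w (simple_root i)"
  define \<beta> where "\<beta> = geo u (simple_root j)"
  have plane: "\<exists>a b. geo (z [^] n) \<alpha> = (\<lambda>k. a * \<alpha> k + b * \<beta> k)" for n :: nat
  proof (induction n)
    case 0
    show ?case by (rule exI[of _ 1], rule exI[of _ 0]) simp
  next
    case (Suc n)
    then obtain a b where ab: "geo (z [^] n) \<alpha> = (\<lambda>k. a * \<alpha> k + b * \<beta> k)" by blast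
    have "z [^] Suc n = x \<otimes> (y \<otimes> z [^] n)"
      using z xx yy nat_pow_Suc2[OF z, of n] by (simp add: z_def m_assoc del: nat_pow_Suc)
    then have "geo (z [^] Suc n) \<alpha> = geo x (geo y (geo (z [^] n) \<alpha>))"
      using z xx yy by (simp add: geo_mult)
    moreover obtain p where "geo y (geo (z [^] n) \<alpha>) = (\<lambda>k. geo (z [^] n) \<alpha> k - p * \<beta> k)"
      using geo_reflection[OF uj(1,2)] y by (metis \<beta>_def)
    moreover obtain q where "geo x (geo y (geo (z [^] n) \<alpha>)) =
        (\<lambda>k. geo y (geo (z [^] n) \<alpha>) k - q * \<alpha> k)"
      using geo_reflection[OF wi(1,2)] x by (metis \<alpha>_def)
    ultimately have "geo (z [^] Suc n) \<alpha> = (\<lambda>k. (a - q) * \<alpha> k + (b - p) * \<beta> k)"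
      using ab by (simp add: algebra_simps)
    then show ?case by blast
  qed
  obtain p1 where p1: "p1 \<in> H" "p1 \<in> K" using corners by blast
  obtain p2 where p2: "p2 \<in> H" "p2 \<notin> K" using corners by blast
  obtain p3 where p3: "p3 \<notin> H" "p3 \<in> K" using corners by blast
  obtain p4 where p4: "p4 \<notin> H" "p4 \<notin> K" "p4 \<in> carrier G" using corners by blast
  have p: "p1 \<in> carrier G" "p2 \<in> carrier G" "p3 \<in> carrier G" "p4 \<in> carrier G"
    using p1 p2 p3 p4 half_space_subset[OF H] half_space_subset[OF K] by auto
  \<comment> \<open>These half-spaces contain one of two opposite corners and miss the other. The
    signs of the coefficients \<open>a\<close> and \<open>b\<close> decide which of the four ordered
    pairs is separated by \<open>Hn n\<close>.\<close>
  define T where "T = separating p1 p4 \<union> separating p2 p3 \<union> separating p3 p2 \<union> separating p4 p1"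
  have "finite T" using p by (simp add: T_def finite_separating)
  define Hn where "Hn n = half_space (z [^] n \<otimes> w) i" for n :: nat
  have mem_H: "v \<in> H \<longleftrightarrow> vec_nonneg (geo (inv v) \<alpha>)" "v \<in> K \<longleftrightarrow> vec_nonneg (geo (inv v) \<beta>)"
    "vec_nonneg (geo (inv v) \<alpha>) \<or> vec_nonpos (geo (inv v) \<alpha>)"
    "vec_nonneg (geo (inv v) \<beta>) \<or> vec_nonpos (geo (inv v) \<beta>)"
    if "v \<in> carrier G" for v
    using that wi uj root_sign(1)[of "inv v \<otimes> w" i] root_sign(1)[of "inv v \<otimes> u" j]
    by (simp_all add: half_space_def geo_mult \<alpha>_def \<beta>_def)
  have "Hn n \<in> T" for n
  proof -
    obtain a b where ab: "geo (z [^] n) \<alpha> = (\<lambda>k. a * \<alpha> k + b * \<beta> k)" using plane by blast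
    have Hn: "Hn n \<in> half_spaces" using z wi by (auto simp: Hn_def)
    define f where "f v = geo (inv v) (geo (z [^] n) \<alpha>)" for v
    have f: "f v = (\<lambda>k. a * geo (inv v) \<alpha> k + b * geo (inv v) \<beta> k)"
      and mem: "v \<in> Hn n \<longleftrightarrow> vec_nonneg (f v)" and nz: "vec_nonneg (f v) \<Longrightarrow> \<not> vec_nonpos (f v)"
      if "v \<in> carrier G" for v
    proof -
      show "f v = (\<lambda>k. a * geo (inv v) \<alpha> k + b * geo (inv v) \<beta> k)"
        unfolding f_def ab using that by (intro linear_mapD geo_linear) simp
      have f': "f v = geo (inv v \<otimes> (z [^] n \<otimes> w)) (simple_root i)"
        using that z wi by (simp add: f_def \<alpha>_def geo_mult)
      show "v \<in> Hn n \<longleftrightarrow> vec_nonneg (f v)"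
        using that by (simp add: Hn_def half_space_def f')
      show "\<not> vec_nonpos (f v)" if "vec_nonneg (f v)"
        using root_sign(2)[of "inv v \<otimes> (z [^] n \<otimes> w)" i] \<open>v \<in> carrier G\<close> z wi that
        by (simp add: f')
    qed
    have comb: "v \<in> Hn n \<and> v' \<notin> Hn n"
      if v: "v \<in> carrier G" "v' \<in> carrier G"
        and sgn: "\<And>k. 0 \<le> a * geo (inv v) \<alpha> k" "\<And>k. 0 \<le> b * geo (inv v) \<beta> k"
          "\<And>k. a * geo (inv v') \<alpha> k \<le> 0" "\<And>k. b * geo (inv v') \<beta> k \<le> 0" for v v'
    proof -
      have "vec_nonneg (f v)" "vec_nonpos (f v')"
        using sgn by (simp_all add: f v vec_nonneg_def vec_nonpos_def add_nonpos_nonpos)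
      then show ?thesis using mem nz v by blast
    qed
    have pos: "0 \<le> geo (inv p1) \<alpha> k" "0 \<le> geo (inv p1) \<beta> k"
      "0 \<le> geo (inv p2) \<alpha> k" "geo (inv p2) \<beta> k \<le> 0"
      "geo (inv p3) \<alpha> k \<le> 0" "0 \<le> geo (inv p3) \<beta> k"
      "geo (inv p4) \<alpha> k \<le> 0" "geo (inv p4) \<beta> k \<le> 0" for k
      using p1 p2 p3 p4 mem_H[OF p(1)] mem_H[OF p(2)] mem_H[OF p(3)] mem_H[OF p(4)]
      unfolding vec_nonneg_def vec_nonpos_def by metis+
    consider "0 \<le> a" "0 \<le> b" | "0 \<le> a" "b \<le> 0" | "a \<le> 0" "0 \<le> b" | "a \<le> 0" "b \<le> 0"
      by linarith
    then show ?thesis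
    proof cases
      case 1
      then have "p1 \<in> Hn n \<and> p4 \<notin> Hn n" by (intro comb p) (simp_all add: pos zero_le_mult_iff mult_le_0_iff)
      then show ?thesis using Hn by (simp add: T_def separating_def)
    next
      case 2
      then have "p2 \<in> Hn n \<and> p3 \<notin> Hn n" by (intro comb p) (simp_all add: pos zero_le_mult_iff mult_le_0_iff)
      then show ?thesis using Hn by (simp add: T_def separating_def)
    next
      case 3
      then have "p3 \<in> Hn n \<and> p2 \<notin> Hn n" by (intro comb p) (simp_all add: pos zero_le_mult_iff mult_le_0_iff)
      then show ?thesis using Hn by (simp add: T_def separating_def)
    next
      case 4
      then have "p4 \<in> Hn n \<and> p1 \<notin> Hn n" by (intro comb p) (simp_all add: pos zero_le_mult_iff mult_le_0_iff)
      then show ?thesis using Hn by (simp add: T_def separating_def)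
    qed
  qed
  then have "range Hn \<subseteq> T" by blast
  then have "\<not> inj Hn" using \<open>finite T\<close> by (metis finite_subset finite_imageD infinite_UNIV_nat)
  then obtain n n' where n: "n < n'" "Hn n = Hn n'"
    unfolding inj_on_def by (metis linorder_neqE_nat)
  define k where "k = n' - n"
  have k: "0 < k" "n' = n + k" using n by (auto simp: k_def)
  have refl_Hn: "half_space_refl (Hn l) = z [^] l \<otimes> x \<otimes> inv (z [^] l)" for l
    using z wi by (simp add: Hn_def half_space_refl x inv_mult_group m_assoc)
  have "z [^] n \<otimes> x \<otimes> inv (z [^] n) = z [^] n' \<otimes> x \<otimes> inv (z [^] n')"
    using n(2) refl_Hn by metis
  also have "\<dots> = z [^] n \<otimes> (z [^] k \<otimes> x \<otimes> inv (z [^] k)) \<otimes> inv (z [^] n)"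
    using z xx k by (simp add: nat_pow_mult[symmetric] inv_mult_group m_assoc)
  finally have "x = z [^] k \<otimes> x \<otimes> inv (z [^] k)"
    using z xx by simp
  then have comm: "x \<otimes> z [^] k = z [^] k \<otimes> x"
    using z xx by (metis inv_solve_right' m_closed nat_pow_closed)
  \<comment> \<open>The reflection \<open>x\<close> inverts \<open>z = x \<otimes> y\<close>. A
    power \<open>z [^] k\<close> that commutes with \<open>x\<close> is therefore its own inverse,
    so the order of \<open>z\<close> divides \<open>k + k\<close>.\<close>
  have conj: "x \<otimes> z [^] l \<otimes> x = inv (z [^] l)" for l :: nat
  proof (induction l)
    case (Suc l)
    have "x \<otimes> z [^] Suc l \<otimes> x = (x \<otimes> z [^] l \<otimes> x) \<otimes> (x \<otimes> z \<otimes> x)"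
      using z xx by (simp add: m_assoc) (simp add: m_assoc[symmetric])
    also have "x \<otimes> z \<otimes> x = inv z"
      using xx yy by (simp add: z_def inv_mult_group m_assoc[symmetric])
    also have "(x \<otimes> z [^] l \<otimes> x) \<otimes> inv z = inv (z \<otimes> z [^] l)"
      using Suc z by (simp add: inv_mult_group)
    also have "z \<otimes> z [^] l = z [^] Suc l" using nat_pow_Suc2[OF z] by simp
    finally show ?case .
  qed (use xx in simp)
  have "z [^] k = x \<otimes> z [^] k \<otimes> x"
    using comm z xx by (simp add: m_assoc)
  also have "\<dots> = inv (z [^] k)" by (rule conj)
  finally have "z [^] (k + k) = \<one>"
    using z by (metis nat_pow_mult nat_pow_closed r_inv)
  then show ?thesis using k by (intro exI[of _ "k + k"]) (simp add: z_def x_def y_def)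
qed

section \<open>Elements of finite order\<close>

definition parabolic :: "'i set \<Rightarrow> 'a set"
  where "parabolic J = generate G (s ` J)"

text \<open>A finite set, as \<open>I\<close> has finitely many subsets; up to conjugation it
  contains all elements of finite order.\<close>

definition spherical :: "'a set"
  where "spherical = \<Union> (parabolic ` {J. J \<subseteq> I \<and> finite (parabolic J)})"

lemma finite_spherical: "finite spherical"
  using finite_I by (auto simp: spherical_def)

lemma spherical_subset: "spherical \<subseteq> carrier G"
proof
  fix g assume "g \<in> spherical"
  then obtain J where J: "J \<subseteq> I" "g \<in> generate G (s ` J)"
    by (auto simp: spherical_def parabolic_def)
  then show "g \<in> carrier G" by (intro generate_in_carrier[of "s ` J"]) auto
qed

text \<open>The index type may be infinite, so the finite support that makes the expansion valid is
  tracked explicitly.\<close>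

lemma functional_expand:
  assumes lin: "\<And>x y v w. \<nu> (\<lambda>k. x * v k + y * w k) = x * \<nu> v + y * (\<nu> w :: real)"
    and A: "finite A" "\<And>k. k \<notin> A \<Longrightarrow> v k = 0"
  shows "\<nu> v = (\<Sum>k\<in>A. v k * \<nu> (simple_root k))"
proof -
  have "\<nu> (\<lambda>l. if l \<in> B then v l else 0) = (\<Sum>k\<in>B. v k * \<nu> (simple_root k))" if "finite B" for B
    using that
  proof (induction B)
    case empty
    then show ?case using lin[of 0 v 0 v] by simp
  next
    case (insert b B)
    have "(\<lambda>l. if l \<in> insert b B then v l else 0) =
        (\<lambda>l. v b * simple_root b l + 1 * (if l \<in> B then v l else 0))"
      using insert by (auto simp: simple_root_def fun_eq_iff)
    then have "\<nu> (\<lambda>l. if l \<in> insert b B then v l else 0) =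
        \<nu> (\<lambda>l. v b * simple_root b l + 1 * (if l \<in> B then v l else 0))"
      by (rule arg_cong)
    also have "\<dots> = v b * \<nu> (simple_root b) + 1 * \<nu> (\<lambda>l. if l \<in> B then v l else 0)"
      by (rule lin)
    finally show ?case using insert by simp
  qed
  moreover have "(\<lambda>l. if l \<in> A then v l else 0) = v" using A by auto
  ultimately show ?thesis using A by metis
qed

lemma geo_support:
  assumes "w \<in> carrier G" "i \<in> I" "k \<notin> I"
  shows "geo w (simple_root i) k = 0"
proof -
  have "geo g v k = v k" if "g \<in> carrier G" for g v
    using that
  proof (induction g arbitrary: v rule: gen_induct)
    case (mult j g)
    moreover have "k \<noteq> j" using \<open>k \<notin> I\<close> mult by blast
    ultimately show ?case by (simp add: geo_mult reflect_def simple_root_def)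
  qed simp
  then show ?thesis using assms by (auto simp: simple_root_def)
qed

text \<open>Roots are nonzero, supported in \<open>I\<close> and have coordinates of one sign, so
  their coordinate sum is nonzero and has that sign.\<close>

lemma sum_root_neg_iff:
  assumes "w \<in> carrier G" "i \<in> I"
  shows "(\<Sum>k\<in>I. geo w (simple_root i) k) < 0 \<longleftrightarrow> vec_nonpos (geo w (simple_root i))"
    and "(\<Sum>k\<in>I. geo w (simple_root i) k) \<noteq> 0"
proof -
  note support = geo_support[OF assms]
  let ?v = "geo w (simple_root i)"
  have pos: "0 < (\<Sum>k\<in>I. v k)" if v: "vec_nonneg v" "v \<noteq> (\<lambda>_. 0)" "\<And>k. k \<notin> I \<Longrightarrow> v k = 0" for v :: "'i \<Rightarrow> real"
  proof -
    obtain k where "v k \<noteq> 0" using v(2) by auto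
    then have "k \<in> I" "0 < v k" using v(1,3) by (auto simp: vec_nonneg_def less_le)
    then show ?thesis using finite_I v(1) by (intro sum_pos2[of I k]) (auto simp: vec_nonneg_def)
  qed
  have nz: "?v \<noteq> (\<lambda>_. 0)" using geo_simple_nonzero assms by blast
  have "0 < (\<Sum>k\<in>I. ?v k)" if "vec_nonneg ?v" using pos[OF that nz support] .
  moreover have "(\<Sum>k\<in>I. ?v k) < 0" if "vec_nonpos ?v"
    using pos[of "\<lambda>k. - ?v k"] that nz support by (force simp: vec_nonneg_minus sum_negf fun_eq_iff)
  ultimately show "(\<Sum>k\<in>I. ?v k) < 0 \<longleftrightarrow> vec_nonpos ?v" "(\<Sum>k\<in>I. ?v k) \<noteq> 0"
    using root_sign[OF assms] by fastforce+
qed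

text \<open>
  The functional \<open>\<mu>\<close>, the sum of the coordinates averaged over \<open>\<langle>g\<rangle>\<close>, is negative on only finitely
  many positive roots. Moving it by the group makes it nonnegative on the simple roots. Then its
  stabilizer is generated by the simple reflections whose root it annihilates, and it is finite.
\<close>

lemma finite_order_conj_spherical:
  assumes g: "g \<in> carrier G" and n: "0 < n" "g [^] (n::nat) = \<one>"
  shows "\<exists>u\<in>carrier G. inv u \<otimes> g \<otimes> u \<in> spherical"
proof -
  define \<mu> where "\<mu> v = (\<Sum>k<n. \<Sum>l\<in>I. geo (g [^] k) v l)" for v
  have \<mu>_linear: "\<mu> (\<lambda>k. x * v k + y * w k) = x * \<mu> v + y * \<mu> w" for x y v w
    using g by (simp add: \<mu>_def linear_mapD geo_linear sum.distrib sum_distrib_left)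
  have \<mu>_scale: "\<mu> (\<lambda>k. x * v k) = x * \<mu> v" for x v
    using \<mu>_linear[of x v 0 v] by simp
  have \<mu>_minus: "\<mu> (\<lambda>k. - v k) = - \<mu> v" for v
    using \<mu>_scale[of "-1" v] by simp
  have \<mu>_g: "\<mu> (geo g v) = \<mu> v" for v
  proof -
    have "\<mu> (geo g v) = (\<Sum>k<n. \<Sum>l\<in>I. geo (g [^] Suc k) v l)"
      using g by (simp add: \<mu>_def geo_mult)
    also have "\<dots> = (\<Sum>k<Suc n. \<Sum>l\<in>I. geo (g [^] k) v l) - (\<Sum>l\<in>I. geo (g [^] (0::nat)) v l)"
      by (subst sum.lessThan_Suc_shift) simp
    also have "\<dots> = \<mu> v"
      using n by (simp add: \<mu>_def)
    finally show ?thesis .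
  qed
  \<comment> \<open>\<open>bad u\<close> includes the roots on which \<open>\<mu>\<close> vanishes,
    \<open>neg u\<close> below does not. Minimizing \<open>neg\<close> makes \<open>\<mu>\<close>
    nonnegative on simple roots, whereas the size of \<open>bad\<close> bounds the
    stabilizer.\<close>
  define bad where "bad u = {half_space w i | w i.
    w \<in> carrier G \<and> i \<in> I \<and> u \<in> half_space w i \<and> \<mu> (geo w (simple_root i)) \<le> 0}" for u
  have finite_bad: "finite (bad u)" if u: "u \<in> carrier G" for u
  proof (rule finite_subset)
    show "bad u \<subseteq> (\<Union>k<n. separating u (inv (g [^] k)))"
    proof
      fix H assume "H \<in> bad u"
      then obtain w i where H: "H = half_space w i" "w \<in> carrier G" "i \<in> I" "u \<in> half_space w i"
        "\<mu> (geo w (simple_root i)) \<le> 0"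
        by (auto simp: bad_def)
      have eq: "geo (g [^] k) (geo w (simple_root i)) = geo (g [^] k \<otimes> w) (simple_root i)" for k :: nat
        using g H by (simp add: geo_mult)
      \<comment> \<open>The coordinate sum of a root never vanishes, so without a negative term
        \<open>\<mu>\<close> would be strictly positive. The index \<open>k\<close> of a negative
        term yields a chamber outside the half-space.\<close>
      have "\<exists>k<n. (\<Sum>l\<in>I. geo (g [^] k \<otimes> w) (simple_root i) l) < 0"
      proof (rule ccontr)
        assume "\<not> ?thesis"
        then have "\<forall>k<n. 0 < (\<Sum>l\<in>I. geo (g [^] k \<otimes> w) (simple_root i) l)"
          using sum_root_neg_iff(2)[of "g [^] k \<otimes> w" i for k] g H
          by (metis linorder_less_linear m_closed nat_pow_closed)
        then have "0 < \<mu> (geo w (simple_root i))"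
          unfolding \<mu>_def eq using n by (intro sum_pos[of "{..<n}"]) auto
        then show False using H by simp
      qed
      then obtain k where k: "k < n" "(\<Sum>l\<in>I. geo (g [^] k \<otimes> w) (simple_root i) l) < 0" by blast
      then have "inv (g [^] k) \<notin> H"
        using sum_root_neg_iff(1)[of "g [^] k \<otimes> w" i] root_sign(2)[of "g [^] k \<otimes> w" i] g H
        by (auto simp: half_space_def)
      then show "H \<in> (\<Union>k<n. separating u (inv (g [^] k)))"
        using H k by (auto simp: separating_def)
    qed
  qed (use u g in \<open>auto intro: finite_separating\<close>)
  define neg where "neg u = {half_space w i | w i.
    w \<in> carrier G \<and> i \<in> I \<and> u \<in> half_space w i \<and> \<mu> (geo w (simple_root i)) < 0}" for u
  have neg_bad: "neg u \<subseteq> bad u" for u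
    unfolding neg_def bad_def by fastforce
  have ex_dominant: "\<exists>u\<in>carrier G. \<forall>i\<in>I. 0 \<le> \<mu> (geo u (simple_root i))"
  proof -
    \<comment> \<open>At a minimizer of \<open>card (neg u)\<close> no simple root can have a
      negative value: crossing its wall would remove that half-space and add none, since the
      opposite root has a positive value.\<close>
    obtain u where u: "u \<in> carrier G" "\<And>v. v \<in> carrier G \<Longrightarrow> card (neg u) \<le> card (neg v)"
      using ex_has_least_nat[of "\<lambda>u. u \<in> carrier G" \<one> "\<lambda>u. card (neg u)"] by auto
    have "0 \<le> \<mu> (geo u (simple_root i))" if i: "i \<in> I" for i
    proof (rule ccontr)
      assume "\<not> ?thesis"
      then have lt: "\<mu> (geo u (simple_root i)) < 0" by simp
      have "neg (u \<otimes> s i) \<subseteq> neg u - {half_space u i}"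
      proof
        fix H assume "H \<in> neg (u \<otimes> s i)"
        then obtain w j where H: "H = half_space w j" "w \<in> carrier G" "j \<in> I"
          "u \<otimes> s i \<in> half_space w j" "\<mu> (geo w (simple_root j)) < 0"
          by (auto simp: neg_def)
        have ne: "H \<noteq> half_space u i"
          using H half_space_not_base_s[OF u(1) i] by auto
        have "u \<in> H"
        proof (rule ccontr)
          assume "u \<notin> H"
          then obtain c where c: "0 < c"
              "geo w (simple_root j) = (\<lambda>k. c * geo (u \<otimes> s i) (simple_root i) k)"
            using half_space_edge(1)[OF H(2) _ i H(3,4)] H u i by (auto simp: m_assoc)
          then have "\<mu> (geo w (simple_root j)) = - c * \<mu> (geo u (simple_root i))"
            using u i by (simp add: geo_mult reflect_simple linear_map_minus geo_linear \<mu>_scale[of "- c"] del: mult_minus_left flip: mult_minus_left)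
          then show False using mult_pos_neg[OF c(1) lt] H(5) by simp
        qed
        then show "H \<in> neg u - {half_space u i}" using H ne by (auto simp: neg_def)
      qed
      moreover have "half_space u i \<in> neg u"
        using u i lt half_space_base[OF u(1) i] unfolding neg_def by blast
      moreover have "finite (neg u)" using finite_bad[OF u(1)] neg_bad finite_subset by blast
      ultimately have "card (neg (u \<otimes> s i)) < card (neg u)"
        by (intro psubset_card_mono) auto
      then show False using u(2)[of "u \<otimes> s i"] u(1) i by simp
    qed
    then show ?thesis using u by blast
  qed
  then obtain u where u: "u \<in> carrier G" and dom: "\<And>i. i \<in> I \<Longrightarrow> 0 \<le> \<mu> (geo u (simple_root i))"
    by blast
  define \<nu> where "\<nu> v = \<mu> (geo u v)" for v
  have \<nu>_linear: "\<nu> (\<lambda>k. x * v k + y * w k) = x * \<nu> v + y * \<nu> w" for x y v w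
    using u by (simp add: \<nu>_def linear_mapD geo_linear \<mu>_linear)
  define J where "J = {i \<in> I. \<nu> (simple_root i) = 0}"
  define stab where "stab = {z \<in> carrier G. \<forall>v. \<nu> (geo z v) = \<nu> v}"
  have dom': "0 \<le> \<nu> (simple_root i)" if "i \<in> I" for i
    using dom[OF that] by (simp add: \<nu>_def)
  have expand: "\<nu> (geo z (simple_root i)) = (\<Sum>k\<in>I. geo z (simple_root i) k * \<nu> (simple_root k))"
    if "z \<in> carrier G" "i \<in> I" for z i
    using that by (intro functional_expand \<nu>_linear finite_I geo_support)
  have inv_stab: "\<nu> (geo (inv z) v) = \<nu> v" if "z \<in> stab" for z v
  proof -
    have z: "z \<in> carrier G" "\<And>v. \<nu> (geo z v) = \<nu> v" using that by (auto simp: stab_def)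
    show ?thesis using z(2)[of "geo (inv z) v"] z(1) by simp
  qed
  \<comment> \<open>Nonnegativity on the simple roots bounds
    \<open>\<nu> (geo z (simple_root i))\<close> above by 0. But \<open>z\<close> preserves
    \<open>\<nu>\<close>, so this is the nonnegative number \<open>\<nu> (simple_root i)\<close>. It
    vanishes, and hence \<open>s i\<close> preserves \<open>\<nu>\<close> too.\<close>
  have descend: "i \<in> J \<and> z \<otimes> s i \<in> stab"
    if z: "z \<in> stab" and i: "i \<in> I" "vec_nonpos (geo z (simple_root i))" for z i
  proof -
    have zG: "z \<in> carrier G" "\<And>v. \<nu> (geo z v) = \<nu> v" using z by (auto simp: stab_def)
    have "\<nu> (geo z (simple_root i)) \<le> 0"
      unfolding expand[OF zG(1) i(1)] using i dom'
      by (intro sum_nonpos mult_nonpos_nonneg) (auto simp: vec_nonpos_def)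
    then have 0: "\<nu> (simple_root i) = 0" using zG(2) dom'[OF i(1)] by (metis order_antisym)
    have "\<nu> (reflect i v) = \<nu> v" for v
      using \<nu>_linear[of 1 v "- 2 * root_pairing v i" "simple_root i"] 0 by (simp add: reflect_def)
    then have "z \<otimes> s i \<in> stab" using zG i by (simp add: stab_def geo_mult)
    then show ?thesis using 0 i by (simp add: J_def)
  qed
  have stab_parabolic: "z \<in> parabolic J" if "z \<in> stab" for z
    using that
  proof (induction "len z" arbitrary: z rule: less_induct)
    case less
    then have z: "z \<in> carrier G" by (simp add: stab_def)
    show ?case
    proof (cases "z = \<one>")
      case True
      then show ?thesis by (simp add: parabolic_def generate.one)
    next
      case False
      then obtain i where i: "i \<in> I" "len z = Suc (len (z \<otimes> s i))" using len_descent[OF z] by blast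
      then have "vec_nonpos (geo z (simple_root i))"
        using simple_root_image_nonpos[OF z i(1)] by simp
      then have iJ: "i \<in> J" "z \<otimes> s i \<in> stab" using descend less.prems i by auto
      then have "z \<otimes> s i \<in> parabolic J" using less.hyps i by simp
      then have "(z \<otimes> s i) \<otimes> s i \<in> parabolic J"
        unfolding parabolic_def by (rule generate.eng) (use iJ in \<open>auto intro: generate.incl\<close>)
      then show ?thesis using z i by (simp add: m_assoc)
    qed
  qed
  have "s i \<in> stab" if "i \<in> J" for i
  proof -
    have "\<nu> (reflect i v) = \<nu> v" for v
      using \<nu>_linear[of 1 v "- 2 * root_pairing v i" "simple_root i"] that
      by (simp add: reflect_def J_def)
    then show ?thesis using that by (simp add: stab_def J_def)
  qed
  then have parabolic_stab: "parabolic J \<subseteq> stab"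
    unfolding parabolic_def
  proof (intro subsetI)
    fix z assume "z \<in> generate G (s ` J)"
    then show "z \<in> stab"
    proof (induction z rule: generate.induct)
      case (inv h)
      then show ?case using \<open>\<And>i. i \<in> J \<Longrightarrow> s i \<in> stab\<close> J_def by auto
    next
      case (eng h1 h2)
      then show ?case by (simp add: stab_def geo_mult)
    qed (use \<open>\<And>i. i \<in> J \<Longrightarrow> s i \<in> stab\<close> in \<open>auto simp: stab_def\<close>)
  qed
  \<comment> \<open>For a half-space separating the identity from \<open>z\<close>, the image of its
    root under \<open>inv z\<close> is negative and has the same \<open>\<nu>\<close>-value. This
    value is therefore at most 0, so translation by \<open>u\<close> embeds these half-spaces into
    \<open>bad u\<close>.\<close>
  have "stab \<subseteq> {z \<in> carrier G. card (separating \<one> z) \<le> card (bad u)}"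
  proof
    fix z assume z: "z \<in> stab"
    then have zG: "z \<in> carrier G" by (simp add: stab_def)
    have "(\<lambda>H. u <# H) ` separating \<one> z \<subseteq> bad u"
    proof
      fix H' assume "H' \<in> (\<lambda>H. u <# H) ` separating \<one> z"
      then obtain H where H': "H' = u <# H" "H \<in> separating \<one> z" by blast
      then obtain w i where H: "H = half_space w i" "w \<in> carrier G" "i \<in> I"
        "\<one> \<in> half_space w i" "z \<notin> half_space w i"
        by (auto simp: separating_def elim!: half_spacesE)
      then have "vec_nonpos (geo (inv z \<otimes> w) (simple_root i))"
        using root_sign(1)[of "inv z \<otimes> w" i] zG by (auto simp: half_space_def)
      then have "\<nu> (geo (inv z \<otimes> w) (simple_root i)) \<le> 0"
        using expand[of "inv z \<otimes> w" i] zG H dom'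
        by (auto intro!: sum_nonpos mult_nonpos_nonneg simp: vec_nonpos_def)
      then have "\<nu> (geo w (simple_root i)) \<le> 0"
        using inv_stab[OF z] zG H by (simp add: geo_mult)
      then have "\<mu> (geo (u \<otimes> w) (simple_root i)) \<le> 0"
        using u H by (simp add: \<nu>_def geo_mult)
      moreover have "u \<in> half_space (u \<otimes> w) i"
        using u H by (auto simp: half_space_def m_assoc[symmetric])
      moreover have "H' = half_space (u \<otimes> w) i" using H H' u by (simp add: half_space_translate)
      ultimately show "H' \<in> bad u" using u H by (auto simp: bad_def)
    qed
    moreover have "inj_on (\<lambda>H. u <# H) (separating \<one> z)"
      using u half_space_subset l_coset_cancel[OF u]
      by (intro inj_onI) (simp add: separating_def)
    ultimately show "z \<in> {z \<in> carrier G. card (separating \<one> z) \<le> card (bad u)}"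
      using zG finite_bad[OF u] card_mono card_image by (metis (mono_tags, lifting) mem_Collect_eq)
  qed
  then have "finite stab" using finite_few_separating finite_subset by blast
  then have "finite (parabolic J)" using parabolic_stab finite_subset by blast
  moreover have "J \<subseteq> I" by (auto simp: J_def)
  ultimately have "parabolic J \<subseteq> spherical" by (auto simp: spherical_def)
  moreover have "inv u \<otimes> g \<otimes> u \<in> stab"
    using u g \<mu>_g by (simp add: stab_def \<nu>_def geo_mult)
  ultimately show ?thesis using stab_parabolic u by blast
qed

end

section \<open>Residual finiteness\<close>

lemma finite_image_factor:
  assumes "finite (f ` A)" "\<And>x y. x \<in> A \<Longrightarrow> y \<in> A \<Longrightarrow> f x = f y \<Longrightarrow> q x = q y"
  shows "finite (q ` A)"
proof -
  have "q ` A \<subseteq> (\<lambda>t. q (SOME x. x \<in> A \<and> f x = t)) ` (f ` A)"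
  proof
    fix t assume "t \<in> q ` A"
    then obtain x where x: "x \<in> A" "t = q x" by blast
    let ?y = "SOME y. y \<in> A \<and> f y = f x"
    have "?y \<in> A \<and> f ?y = f x" by (rule someI[of _ x]) (use x in simp)
    then have "t = q ?y" using assms(2)[OF x(1)] x by metis
    then show "t \<in> (\<lambda>t. q (SOME x. x \<in> A \<and> f x = t)) ` (f ` A)" using x by blast
  qed
  then show ?thesis using assms(1) by (meson finite_imageI finite_subset)
qed

section \<open>Finitely generated additive groups of real numbers\<close>

definition int_span :: "real set \<Rightarrow> real set"
  where "int_span B = range (\<lambda>c. \<Sum>b\<in>B. of_int (c b) * b)"

lemma int_spanI: "x = (\<Sum>b\<in>B. of_int (c b) * b) \<Longrightarrow> x \<in> int_span B"
  by (simp add: int_span_def)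

lemma int_spanE:
  assumes "x \<in> int_span B"
  obtains c where "x = (\<Sum>b\<in>B. of_int (c b) * b)"
  using assms by (auto simp: int_span_def)

lemma int_span_lin:
  assumes "x \<in> int_span B" "y \<in> int_span B"
  shows "of_int p * x + of_int q * y \<in> int_span B"
proof -
  obtain c d where "x = (\<Sum>b\<in>B. of_int (c b) * b)" "y = (\<Sum>b\<in>B. of_int (d b) * b)"
    using assms by (elim int_spanE)
  then have "of_int p * x + of_int q * y = (\<Sum>b\<in>B. of_int (p * c b + q * d b) * b)"
    by (simp add: sum_distrib_left sum.distrib algebra_simps)
  then show ?thesis by (rule int_spanI)
qed

lemma int_span_zero: "0 \<in> int_span B"
  by (rule int_spanI[where c = "\<lambda>_. 0"]) simp

lemma int_span_add: "x \<in> int_span B \<Longrightarrow> y \<in> int_span B \<Longrightarrow> x + y \<in> int_span B"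
  using int_span_lin[of x B y 1 1] by simp

lemma int_span_diff: "x \<in> int_span B \<Longrightarrow> y \<in> int_span B \<Longrightarrow> x - y \<in> int_span B"
  using int_span_lin[of x B y 1 "-1"] by simp

lemma int_span_scale: "x \<in> int_span B \<Longrightarrow> of_int p * x \<in> int_span B"
  using int_span_lin[of x B x p 0] by simp

lemma int_span_minus: "x \<in> int_span B \<Longrightarrow> - x \<in> int_span B"
  using int_span_scale[of x B "-1"] by simp

lemma int_span_sum: "(\<And>a. a \<in> A \<Longrightarrow> f a \<in> int_span B) \<Longrightarrow> (\<Sum>a\<in>A. f a) \<in> int_span B"
  by (induction A rule: infinite_finite_induct) (auto simp: int_span_zero int_span_add)

lemma int_span_gen:
  assumes "finite B" "b \<in> B"
  shows "b \<in> int_span B"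
proof -
  have "b = (\<Sum>b'\<in>B. of_int (if b' = b then 1 else 0) * b')"
    using assms by (simp add: if_distrib[of "\<lambda>z. of_int z * _"] cong: if_cong)
  then show ?thesis by (rule int_spanI)
qed

lemma common_denominator:
  fixes f :: "'b \<Rightarrow> rat"
  assumes "finite B"
  shows "\<exists>D>0. \<forall>b\<in>B. \<exists>z. of_int D * f b = of_int z"
  using assms
proof (induction B)
  case (insert a B)
  then obtain D where D: "0 < D" "\<forall>b\<in>B. \<exists>z. of_int D * f b = of_int z" by blast
  obtain p q where pq: "f a = of_int p / of_int q" "0 < q"
    by (metis Fract_of_int_quotient quotient_of_denom_pos quotient_of_div surj_pair)
  have "\<exists>z. of_int (D * q) * f b = of_int z" if b: "b \<in> insert a B" for b
  proof (cases "b = a")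
    case True
    then show ?thesis using pq by (intro exI[of _ "D * p"]) simp
  next
    case False
    then obtain z where z: "of_int D * f b = of_int z" using D(2) b False by auto
    have "of_int (D * q) * f b = of_int q * (of_int D * f b)" by (simp add: ac_simps)
    also have "\<dots> = of_int (q * z)" by (simp add: z)
    finally show ?thesis by blast
  qed
  then show ?case using D(1) pq(2) by (intro exI[of _ "D * q"]) simp
qed (intro exI[of _ 1], simp)

lemma rat_sum_scale:
  fixes f :: "'b \<Rightarrow> rat"
  shows "of_int (2 * D) * (\<Sum>b\<in>B. of_int (c b) * f b) = 2 * (\<Sum>b\<in>B. of_int (c b) * (of_int D * f b))"
  by (simp add: sum_distrib_left ac_simps)

text \<open>A rational-linear \<open>f\<close> with \<open>f x = 1\<close> has values with a common
  denominator \<open>D\<close> on the span. The modulus is \<open>2 * D\<close> because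
  \<open>x = 2 * D * y\<close> then makes 1 twice an integer, a contradiction even when
  \<open>D = 1\<close>.\<close>

lemma int_span_not_divisible:
  assumes "finite B" "x \<noteq> 0"
  shows "\<exists>n>0. \<forall>y\<in>int_span B. x \<noteq> real n * y"
proof -
  interpret vector_space_pair "\<lambda>(q::rat) (r::real). of_rat q * r" "(*) :: rat \<Rightarrow> rat \<Rightarrow> rat"
    by unfold_locales (auto simp: algebra_simps of_rat_add of_rat_mult)
  have "vs1.independent {x}" using assms(2) by simp
  then obtain f where f: "Vector_Spaces.linear (\<lambda>(q::rat) (r::real). of_rat q * r) ((*) :: rat \<Rightarrow> rat \<Rightarrow> rat) f" "f x = 1"
    using linear_independent_extend[of "{x}" "\<lambda>_. 1"] by blast
  have f_sum: "f (\<Sum>b\<in>B. of_int (c b) * b) = (\<Sum>b\<in>B. of_int (c b) * f b)" for c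
  proof -
    have "f (of_int k * b) = of_int k * f b" for k b
      using linear_scale[OF f(1), of "of_int k" b] by simp
    then show ?thesis by (simp add: linear_sum[OF f(1)])
  qed
  have "\<exists>D>0. \<forall>b\<in>B. \<exists>z. of_int D * f b = of_int z"
    using assms(1) by (rule common_denominator)
  then obtain D where D: "0 < D" "\<And>b. b \<in> B \<Longrightarrow> \<exists>z. of_int D * f b = of_int z" by blast
  then obtain z where z: "\<And>b. b \<in> B \<Longrightarrow> of_int D * f b = of_int (z b)" by metis
  show ?thesis
  proof (intro exI[of _ "nat (2 * D)"] conjI ballI notI)
    fix y assume "y \<in> int_span B" and x: "x = real (nat (2 * D)) * y"
    then obtain c where c: "y = (\<Sum>b\<in>B. of_int (c b) * b)" by (elim int_spanE)
    have "x = of_rat (of_int (2 * D)) * y" using x D(1) by (simp add: of_rat_mult)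
    then have "f x = of_int (2 * D) * f y" using linear_scale[OF f(1)] by metis
    also have "\<dots> = 2 * (\<Sum>b\<in>B. of_int (c b) * (of_int D * f b))"
      unfolding c f_sum by (rule rat_sum_scale)
    also have "(\<Sum>b\<in>B. of_int (c b) * (of_int D * f b)) = of_int (\<Sum>b\<in>B. c b * z b)"
      by (simp add: z)
    finally have "(1 :: rat) = of_int (2 * (\<Sum>b\<in>B. c b * z b))" using f(2) by simp
    then have "1 = 2 * (\<Sum>b\<in>B. c b * z b)" by (metis of_int_1 of_int_eq_iff)
    then show False by presburger
  qed (use D in simp)
qed

text \<open>By the product formula for cosines, the integer span is closed under multiplication by
  these generators. The number 1 is added because it is a coordinate of the simple roots, whereas
  \<open>k = 0\<close> only gives 2.\<close>

definition cos_gens :: "nat \<Rightarrow> real set"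
  where "cos_gens N = insert 1 ((\<lambda>k. 2 * cos (real k * pi / real N)) ` {..<2 * N})"

lemma finite_cos_gens: "finite (cos_gens N)"
  by (simp add: cos_gens_def)

lemma cos_gens_periodic:
  assumes "0 < N"
  shows "2 * cos (real k * pi / real N) \<in> int_span (cos_gens N)"
proof -
  have "cos (real (r + 2 * N * q) * pi / real N) = cos (real r * pi / real N)" for r q
  proof (induction q)
    case (Suc q)
    have "real (r + 2 * N * Suc q) * pi / real N = real (r + 2 * N * q) * pi / real N + 2 * pi"
      using assms by (simp add: field_simps)
    then show ?case using Suc by (simp only: cos_periodic)
  qed simp
  from this[of "k mod (2 * N)" "k div (2 * N)"]
  have "2 * cos (real k * pi / real N) = 2 * cos (real (k mod (2 * N)) * pi / real N)"
    by simp
  moreover have "k mod (2 * N) \<in> {..<2 * N}" using assms by simp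
  ultimately have "2 * cos (real k * pi / real N) \<in> cos_gens N"
    unfolding cos_gens_def by blast
  then show ?thesis by (rule int_span_gen[OF finite_cos_gens])
qed

lemma cos_gens_mult:
  assumes "0 < N" "x \<in> int_span (cos_gens N)"
  shows "2 * cos (real k * pi / real N) * x \<in> int_span (cos_gens N)"
proof -
  have "2 * cos (real k * pi / real N) * b \<in> int_span (cos_gens N)" if b: "b \<in> cos_gens N" for b
  proof (cases "b = 1")
    case True
    then show ?thesis using cos_gens_periodic[OF assms(1)] by simp
  next
    case False
    then obtain l where l: "b = 2 * cos (real l * pi / real N)"
      using b by (auto simp: cos_gens_def)
    define \<theta> where "\<theta> = pi / real N"
    have "2 * cos (real k * \<theta>) * (2 * cos (real l * \<theta>)) =
        2 * cos (real k * \<theta> + real l * \<theta>) + 2 * cos (real k * \<theta> - real l * \<theta>)"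
      by (simp add: cos_add cos_diff)
    also have "cos (real k * \<theta> + real l * \<theta>) = cos (real (k + l) * \<theta>)"
      by (simp add: algebra_simps)
    also have "cos (real k * \<theta> - real l * \<theta>) = cos (real (if l \<le> k then k - l else l - k) * \<theta>)"
      using cos_minus[of "real k * \<theta> - real l * \<theta>"] by (simp add: algebra_simps of_nat_diff)
    finally show ?thesis
      using int_span_add[OF cos_gens_periodic[OF assms(1)] cos_gens_periodic[OF assms(1)]] l
      by (simp only: \<theta>_def times_divide_eq_right)
  qed
  moreover obtain c where "x = (\<Sum>b\<in>cos_gens N. of_int (c b) * b)"
    using assms(2) by (elim int_spanE)
  then have "2 * cos (real k * pi / real N) * x =
      (\<Sum>b\<in>cos_gens N. of_int (c b) * (2 * cos (real k * pi / real N) * b))"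
    by (simp add: sum_distrib_left mult.assoc mult.left_commute)
  ultimately show ?thesis by (auto intro!: int_span_sum int_span_scale)
qed

section \<open>Congruence subgroups\<close>

context coxeter_system
begin

text \<open>A common denominator for all angles \<open>pi / m i j\<close>. An infinite entry has
  angle 0 and contributes the factor 1.\<close>

definition angle_denom :: nat
  where "angle_denom = (\<Prod>(i, j)\<in>I \<times> I. if m i j = 0 then 1 else m i j)"

definition coeff_ring :: "real set"
  where "coeff_ring = int_span (cos_gens angle_denom)"

definition root_lattice :: "('i \<Rightarrow> real) set"
  where "root_lattice = {v. (\<forall>k. v k \<in> coeff_ring) \<and> (\<forall>k. k \<notin> I \<longrightarrow> v k = 0)}"

text \<open>The kernel of the action on the root lattice modulo \<open>n\<close>.\<close>

definition congruence_subgroup :: "nat \<Rightarrow> 'a set"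
  where "congruence_subgroup n =
    {g \<in> carrier G. \<forall>v\<in>root_lattice. \<exists>w\<in>root_lattice. geo g v = (\<lambda>k. v k + real n * w k)}"

lemma angle_denom_pos: "0 < angle_denom"
  unfolding angle_denom_def by (intro prod_pos) (auto split: if_splits)

lemma gram_angle:
  assumes "i \<in> I" "j \<in> I"
  shows "\<exists>k::nat. gram i j = - cos (real k * pi / real angle_denom)"
proof (cases "m i j = 0")
  case True
  then show ?thesis by (intro exI[of _ 0]) (simp add: gram_def)
next
  case False
  have "(if m i j = 0 then 1 else m i j) dvd angle_denom"
    unfolding angle_denom_def
    using dvd_prodI[of "I \<times> I" "(i, j)" "\<lambda>(i, j). if m i j = 0 then 1 else m i j"] finite_I assms
    by simp
  then obtain k where k: "angle_denom = m i j * k" using False by auto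
  then have "k \<noteq> 0" using angle_denom_pos by auto
  then have "pi / real (m i j) = real k * pi / real angle_denom"
    using k by simp
  then show ?thesis unfolding gram_def by metis
qed

lemma root_lattice_add:
  "v \<in> root_lattice \<Longrightarrow> w \<in> root_lattice \<Longrightarrow> (\<lambda>k. v k + w k) \<in> root_lattice"
  by (simp add: root_lattice_def coeff_ring_def int_span_add)

lemma root_lattice_minus: "v \<in> root_lattice \<Longrightarrow> (\<lambda>k. - v k) \<in> root_lattice"
  by (simp add: root_lattice_def coeff_ring_def int_span_minus)

lemma root_lattice_simple: "i \<in> I \<Longrightarrow> simple_root i \<in> root_lattice"
  using int_span_gen[OF finite_cos_gens, of 1] int_span_zero
  by (auto simp: root_lattice_def coeff_ring_def simple_root_def cos_gens_def)

lemma root_lattice_geo: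
  assumes "g \<in> carrier G" "v \<in> root_lattice"
  shows "geo g v \<in> root_lattice"
  using assms
proof (induction g rule: gen_induct)
  case (mult i g)
  let ?v = "geo g v"
  have v: "?v \<in> root_lattice" using mult by blast
  have "2 * root_pairing ?v i = (\<Sum>j\<in>I. - (- (2 * gram j i) * ?v j))"
    by (simp add: root_pairing_def sum_distrib_left ac_simps)
  also have "\<dots> \<in> coeff_ring"
    unfolding coeff_ring_def
  proof (intro int_span_sum int_span_minus)
    fix j assume "j \<in> I"
    then obtain k where "gram j i = - cos (real k * pi / real angle_denom)"
      using gram_angle[of j i] mult by blast
    then show "- (2 * gram j i) * ?v j \<in> int_span (cos_gens angle_denom)"
      using cos_gens_mult[OF angle_denom_pos, of "?v j" k] v
      by (simp add: root_lattice_def coeff_ring_def)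
  qed
  finally have "reflect i ?v \<in> root_lattice"
    using v mult(1) by (auto simp: root_lattice_def reflect_def simple_root_def coeff_ring_def int_span_diff)
  then show ?case using mult by (simp add: geo_mult)
qed simp

lemma geo_expand:
  assumes "g \<in> carrier G" "v \<in> root_lattice"
  shows "geo g v k = (\<Sum>j\<in>I. v j * geo g (simple_root j) k)"
  using assms by (intro functional_expand[of "\<lambda>v. geo g v k"])
    (auto simp: linear_mapD geo_linear finite_I root_lattice_def)

lemma congruence_subgroup_normal: "congruence_subgroup n \<lhd> G"
proof -
  let ?K = "congruence_subgroup n"
  have geo_add: "geo x (\<lambda>k. v k + real n * w k) = (\<lambda>k. geo x v k + real n * geo x w k)"
    if "x \<in> carrier G" for x v w
    using linear_mapD[OF geo_linear[OF that], of 1 v "real n" w] by simp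
  have "subgroup ?K G"
  proof (rule subgroup.intro)
    have "(\<lambda>_. 0) \<in> root_lattice"
      by (simp add: root_lattice_def coeff_ring_def int_span_zero)
    then show "\<one> \<in> ?K" by (auto simp: congruence_subgroup_def intro!: bexI[of _ "\<lambda>_. 0"])
    show "g \<otimes> h \<in> ?K" if g: "g \<in> ?K" and h: "h \<in> ?K" for g h
    proof -
      have "\<exists>w\<in>root_lattice. geo (g \<otimes> h) v = (\<lambda>k. v k + real n * w k)" if v: "v \<in> root_lattice" for v
      proof -
        obtain w where w: "w \<in> root_lattice" "geo h v = (\<lambda>k. v k + real n * w k)"
          using h v by (auto simp: congruence_subgroup_def)
        obtain w' where w': "w' \<in> root_lattice" "geo g v = (\<lambda>k. v k + real n * w' k)"
          using g v by (auto simp: congruence_subgroup_def)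
        have gh: "g \<in> carrier G" "h \<in> carrier G" using g h by (auto simp: congruence_subgroup_def)
        then have "geo (g \<otimes> h) v = (\<lambda>k. v k + real n * (w' k + geo g w k))"
          by (simp add: geo_mult w(2) geo_add w'(2) algebra_simps)
        then show ?thesis
          using root_lattice_add[OF w'(1) root_lattice_geo[OF gh(1) w(1)]]
          by (intro bexI[of _ "\<lambda>k. w' k + geo g w k"])
      qed
      then show ?thesis using g h by (auto simp: congruence_subgroup_def)
    qed
    show "inv g \<in> ?K" if g: "g \<in> ?K" for g
    proof -
      have gG: "g \<in> carrier G" using g by (simp add: congruence_subgroup_def)
      have "\<exists>w\<in>root_lattice. geo (inv g) v = (\<lambda>k. v k + real n * w k)" if v: "v \<in> root_lattice" for v
      proof -
        obtain w where w: "w \<in> root_lattice"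
            "geo g (geo (inv g) v) = (\<lambda>k. geo (inv g) v k + real n * w k)"
          using g v gG root_lattice_geo[of "inv g" v] by (auto simp: congruence_subgroup_def)
        then have "v k = geo (inv g) v k + real n * w k" for k using gG by (simp add: fun_eq_iff)
        then have "geo (inv g) v = (\<lambda>k. v k + real n * - w k)" by (simp add: fun_eq_iff)
        then show ?thesis
          using root_lattice_minus[OF w(1)] by (intro bexI[of _ "\<lambda>k. - w k"])
      qed
      then show ?thesis using gG by (simp add: congruence_subgroup_def)
    qed
  qed (auto simp: congruence_subgroup_def)
  moreover have "x \<otimes> h \<otimes> inv x \<in> ?K" if x: "x \<in> carrier G" and h: "h \<in> ?K" for x h
  proof -
    have hG: "h \<in> carrier G" using h by (simp add: congruence_subgroup_def)
    have "\<exists>w\<in>root_lattice. geo (x \<otimes> h \<otimes> inv x) v = (\<lambda>k. v k + real n * w k)" if v: "v \<in> root_lattice" for v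
    proof -
      obtain w where w: "w \<in> root_lattice"
          "geo h (geo (inv x) v) = (\<lambda>k. geo (inv x) v k + real n * w k)"
        using h v x root_lattice_geo[of "inv x" v] by (auto simp: congruence_subgroup_def)
      then have "geo (x \<otimes> h \<otimes> inv x) v = (\<lambda>k. v k + real n * geo x w k)"
        using x hG by (simp add: geo_mult geo_add)
      then show ?thesis using root_lattice_geo[OF x w(1)] by blast
    qed
    then show ?thesis using x hG by (simp add: congruence_subgroup_def)
  qed
  ultimately show ?thesis by (simp add: normal_inv_iff)
qed

text \<open>A right coset is determined by the residues modulo \<open>n\<close> of the integer
  coefficients of finitely many numbers, built from the matrix of \<open>inv g\<close>.\<close>

lemma congruence_subgroup_finite_index:
  assumes n: "0 < n"
  shows "finite (rcosets (congruence_subgroup n))"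
proof -
  let ?K = "congruence_subgroup n"
  let ?B = "cos_gens angle_denom"
  \<comment> \<open>The generators may be linearly dependent, so some expansion is chosen. Equal
    residues still give a difference in \<open>n\<close> times the ring.\<close>
  define coef where "coef x = (SOME c. x = (\<Sum>b\<in>?B. of_int (c b) * b))" for x :: real
  have coef: "x = (\<Sum>b\<in>?B. of_int (coef x b) * b)" if "x \<in> coeff_ring" for x
  proof -
    obtain c where "x = (\<Sum>b\<in>?B. of_int (c b) * b)"
      using \<open>x \<in> coeff_ring\<close> unfolding coeff_ring_def by (elim int_spanE)
    then show ?thesis unfolding coef_def by (rule someI[where P = "\<lambda>c. x = (\<Sum>b\<in>?B. of_int (c b) * b)"])
  qed
  define code where "code x = (\<lambda>b\<in>?B. coef x b mod int n)" for x
  have code: "\<exists>y\<in>coeff_ring. x - x' = real n * y"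
    if x: "x \<in> coeff_ring" "x' \<in> coeff_ring" and eq: "code x = code x'" for x x'
  proof -
    have "\<exists>d. coef x b - coef x' b = int n * d" if b: "b \<in> ?B" for b
    proof -
      have "coef x b mod int n = coef x' b mod int n"
        using fun_cong[OF eq, of b] b by (simp add: code_def)
      then show ?thesis by (metis mod_eq_dvd_iff dvd_def)
    qed
    then obtain d where d: "\<And>b. b \<in> ?B \<Longrightarrow> coef x b - coef x' b = int n * d b" by metis
    have "x - x' = (\<Sum>b\<in>?B. of_int (coef x b) * b) - (\<Sum>b\<in>?B. of_int (coef x' b) * b)"
      using coef[OF x(1)] coef[OF x(2)] by simp
    also have "\<dots> = (\<Sum>b\<in>?B. of_int (coef x b - coef x' b) * b)"
      by (simp add: sum_subtractf algebra_simps)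
    also have "\<dots> = real n * (\<Sum>b\<in>?B. of_int (d b) * b)"
      by (simp add: d sum_distrib_left mult.assoc)
    finally show ?thesis unfolding coeff_ring_def by (blast intro: int_spanI)
  qed
  have entry: "b * geo g (simple_root j) k \<in> coeff_ring"
    if "g \<in> carrier G" "j \<in> I" "b \<in> ?B" for b g j k
  proof -
    have r: "geo g (simple_root j) k \<in> coeff_ring"
      using root_lattice_geo[OF that(1) root_lattice_simple[OF that(2)]] by (simp add: root_lattice_def)
    show ?thesis
      using that(3) cos_gens_mult[OF angle_denom_pos, of "geo g (simple_root j) k"] r
      by (auto simp: cos_gens_def coeff_ring_def)
  qed
  \<comment> \<open>Recording each matrix entry multiplied by every generator \<open>b\<close> makes
    it possible to treat arbitrary lattice vectors, whose coordinates are integer combinations of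
    the \<open>b\<close>. The inverse occurs because \<open>K #> h = K #> g\<close> amounts to
    \<open>h \<otimes> inv g \<in> K\<close>.\<close>
  define f where "f g = (\<lambda>(b, j, k)\<in>?B \<times> I \<times> I. code (b * geo (inv g) (simple_root j) k))" for g
  have code_range: "code x \<in> ?B \<rightarrow>\<^sub>E {0..<int n}" for x
    unfolding code_def by (intro restrict_PiE_iff[THEN iffD2] ballI) (use n in simp)
  have "f g \<in> (?B \<times> I \<times> I) \<rightarrow>\<^sub>E (?B \<rightarrow>\<^sub>E {0..<int n})" for g
    unfolding f_def by (intro restrict_PiE_iff[THEN iffD2] ballI) (auto simp only: split_beta code_range)
  then have "f ` carrier G \<subseteq> (?B \<times> I \<times> I) \<rightarrow>\<^sub>E (?B \<rightarrow>\<^sub>E {0..<int n})"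
    by blast
  moreover have "finite \<dots>"
    using finite_cos_gens finite_I by (intro finite_PiE) auto
  ultimately have "finite (f ` carrier G)" by (rule finite_subset)
  moreover have "?K #> h = ?K #> g"
    if gh: "h \<in> carrier G" "g \<in> carrier G" and eq: "f h = f g" for g h
  proof -
    have "\<exists>w\<in>root_lattice. geo (h \<otimes> inv g) v = (\<lambda>k. v k + real n * w k)"
      if v: "v \<in> root_lattice" for v
    proof -
      have "\<exists>y\<in>coeff_ring. geo (inv g) v k - geo (inv h) v k = real n * y" if k: "k \<in> I" for k
      proof -
        have "\<exists>y\<in>coeff_ring. b * geo (inv g) (simple_root j) k - b * geo (inv h) (simple_root j) k = real n * y"
          if "j \<in> I" "b \<in> ?B" for j b
          using fun_cong[OF eq, of "(b, j, k)"] that k gh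
          by (intro code entry) (auto simp: f_def)
        then obtain y where y: "\<And>j b. j \<in> I \<Longrightarrow> b \<in> ?B \<Longrightarrow> y j b \<in> coeff_ring"
          "\<And>j b. j \<in> I \<Longrightarrow> b \<in> ?B \<Longrightarrow>
            b * geo (inv g) (simple_root j) k - b * geo (inv h) (simple_root j) k = real n * y j b"
          by metis
        have "geo (inv g) v k - geo (inv h) v k =
            (\<Sum>j\<in>I. v j * (geo (inv g) (simple_root j) k - geo (inv h) (simple_root j) k))"
          using gh v by (simp add: geo_expand sum_subtractf right_diff_distrib)
        also have "\<dots> = (\<Sum>j\<in>I. \<Sum>b\<in>?B. of_int (coef (v j) b) * (real n * y j b))"
        proof (rule sum.cong[OF refl])
          fix j assume j: "j \<in> I"
          let ?\<delta> = "geo (inv g) (simple_root j) k - geo (inv h) (simple_root j) k"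
          have "v j \<in> coeff_ring" using v by (simp add: root_lattice_def)
          then have "v j * ?\<delta> = (\<Sum>b\<in>?B. of_int (coef (v j) b) * b) * ?\<delta>" using coef by simp
          also have "\<dots> = (\<Sum>b\<in>?B. of_int (coef (v j) b) * (b * ?\<delta>))"
            by (simp add: sum_distrib_right mult.assoc)
          finally show "v j * ?\<delta> = (\<Sum>b\<in>?B. of_int (coef (v j) b) * (real n * y j b))"
            using y(2)[OF j] by (simp add: right_diff_distrib)
        qed
        also have "\<dots> = real n * (\<Sum>j\<in>I. \<Sum>b\<in>?B. of_int (coef (v j) b) * y j b)"
          by (simp add: sum_distrib_left mult.left_commute)
        finally have "geo (inv g) v k - geo (inv h) v k =
            real n * (\<Sum>j\<in>I. \<Sum>b\<in>?B. of_int (coef (v j) b) * y j b)" .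
        moreover have "(\<Sum>j\<in>I. \<Sum>b\<in>?B. of_int (coef (v j) b) * y j b) \<in> coeff_ring"
          using y(1) unfolding coeff_ring_def by (intro int_span_sum int_span_scale)
        ultimately show ?thesis by blast
      qed
      then obtain y where y: "\<And>k. k \<in> I \<Longrightarrow> y k \<in> coeff_ring"
        "\<And>k. k \<in> I \<Longrightarrow> geo (inv g) v k - geo (inv h) v k = real n * y k"
        by metis
      define w where "w k = (if k \<in> I then y k else 0)" for k
      have w: "w \<in> root_lattice"
        using y(1) by (auto simp: root_lattice_def w_def coeff_ring_def int_span_zero)
      have "geo (inv g) v k = geo (inv h) v k + real n * w k" for k
        using y(2)[of k] root_lattice_geo[OF _ v, of "inv g"] root_lattice_geo[OF _ v, of "inv h"] gh
        by (auto simp: w_def root_lattice_def)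
      then have "geo (inv g) v = (\<lambda>k. 1 * geo (inv h) v k + real n * w k)" by auto
      then have "geo (h \<otimes> inv g) v = geo h (\<lambda>k. 1 * geo (inv h) v k + real n * w k)"
        using gh by (simp add: geo_mult)
      also have "\<dots> = (\<lambda>k. v k + real n * geo h w k)"
        unfolding linear_mapD[OF geo_linear[OF gh(1)]] using gh by simp
      finally show ?thesis using root_lattice_geo[OF gh(1) w] by blast
    qed
    then have "h \<otimes> inv g \<in> ?K" using gh by (simp add: congruence_subgroup_def)
    moreover have sub: "subgroup ?K G" using congruence_subgroup_normal by (rule normal_imp_subgroup)
    ultimately have "?K #> (h \<otimes> inv g) = ?K"
      using gh by (intro coset_join2) auto
    then have "?K #> g = ?K #> (h \<otimes> inv g) #> g" by simp
    also have "\<dots> = ?K #> h"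
      using gh subgroup.subset[OF sub] by (simp add: coset_mult_assoc m_assoc)
    finally show ?thesis by simp
  qed
  ultimately have "finite ((\<lambda>g. ?K #> g) ` carrier G)" by (rule finite_image_factor)
  moreover have "rcosets ?K = (\<lambda>g. ?K #> g) ` carrier G" by (auto simp: RCOSETS_def)
  ultimately show ?thesis by simp
qed

text \<open>A nontrivial \<open>e\<close> moves some simple root, and a nonzero coordinate of the
  displacement is not divisible by a suitable modulus.\<close>

lemma residually_finite:
  assumes "finite E" "E \<subseteq> carrier G" "\<one> \<notin> E"
  shows "\<exists>K. K \<lhd> G \<and> finite (rcosets K) \<and> K \<inter> E = {}"
proof -
  \<comment> \<open>Covering all multiples of \<open>n\<close> lets a single modulus, the product
    over \<open>E\<close>, exclude all elements at once.\<close>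
  have "\<exists>n>0. \<forall>l>0. e \<notin> congruence_subgroup (n * l)" if e: "e \<in> E" for e
  proof -
    have eG: "e \<in> carrier G" "e \<noteq> \<one>" using e assms by auto
    then obtain j where j: "j \<in> I" "\<not> vec_nonneg (geo e (simple_root j))"
      using nonneg_on_simple_imp_one by blast
    have "vec_nonneg (simple_root j)" by (simp add: vec_nonneg_def simple_root_def)
    then have "geo e (simple_root j) \<noteq> simple_root j" using j(2) by metis
    then obtain k where k: "geo e (simple_root j) k - simple_root j k \<noteq> 0" by auto
    obtain n where n: "0 < n"
        "\<And>y. y \<in> coeff_ring \<Longrightarrow> geo e (simple_root j) k - simple_root j k \<noteq> real n * y"
      using int_span_not_divisible[OF finite_cos_gens k] unfolding coeff_ring_def by blast
    have "e \<notin> congruence_subgroup (n * l)" for l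
    proof
      assume "e \<in> congruence_subgroup (n * l)"
      then obtain w where w: "w \<in> root_lattice"
          "geo e (simple_root j) = (\<lambda>k. simple_root j k + real (n * l) * w k)"
        using root_lattice_simple[OF j(1)] by (auto simp: congruence_subgroup_def)
      then have "real l * w k \<in> coeff_ring"
        using int_span_scale[of "w k" _ "int l"] by (simp add: root_lattice_def coeff_ring_def)
      then show False using n(2)[of "real l * w k"] w(2) by (simp add: mult.assoc)
    qed
    then show ?thesis using n by blast
  qed
  then obtain n where n: "\<And>e. e \<in> E \<Longrightarrow> 0 < n e"
      "\<And>e l. e \<in> E \<Longrightarrow> 0 < l \<Longrightarrow> e \<notin> congruence_subgroup (n e * l)"
    by metis
  define N where "N = (\<Prod>e\<in>E. n e)"
  have "0 < N" unfolding N_def using n by (intro prod_pos) auto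
  have "e \<notin> congruence_subgroup N" if e: "e \<in> E" for e
  proof -
    have "N = n e * (\<Prod>e\<in>E - {e}. n e)" unfolding N_def using assms(1) e by (rule prod.remove)
    moreover have "0 < (\<Prod>e\<in>E - {e}. n e)" using n by (intro prod_pos) auto
    ultimately show ?thesis using n(2)[OF e] by metis
  qed
  then show ?thesis
    using congruence_subgroup_normal congruence_subgroup_finite_index[OF \<open>0 < N\<close>] by blast
qed

end

section \<open>The coloring\<close>

text \<open>Modulo 2, each step of the progression advances by a nonzero \<open>\<epsilon>\<close>
  of absolute value at most 1. The floor moves by at most one per step, so constant parity would
  freeze it, which is impossible once the total advance reaches 2. The bound \<open>M\<close> is
  uniform in \<open>d\<close>.\<close>

lemma parity_sequence:
  "\<exists>\<tau>::nat \<Rightarrow> bool. \<forall>t>0. \<exists>M. \<forall>d. \<exists>j\<le>M. \<tau> (d + t * j) \<noteq> \<tau> d"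
proof -
  obtain \<theta> :: real where \<theta>: "\<theta> \<notin> \<rat>"
    using uncountable_UNIV_real countable_rat by (metis UNIV_eq_I)
  define \<tau> where "\<tau> n = even \<lfloor>real n * \<theta>\<rfloor>" for n :: nat
  have "\<exists>M. \<forall>d. \<exists>j\<le>M. \<tau> (d + t * j) \<noteq> \<tau> d" if t: "0 < t" for t
  proof -
    define k where "k = round (real t * \<theta> / 2)"
    define \<epsilon> where "\<epsilon> = real t * \<theta> - 2 * of_int k"
    have "\<bar>of_int k - real t * \<theta> / 2\<bar> \<le> 1 / 2"
      unfolding k_def by (rule of_int_round_abs_le)
    then have \<epsilon>1: "\<bar>\<epsilon>\<bar> \<le> 1" unfolding \<epsilon>_def by linarith
    have "\<epsilon> \<noteq> 0"
    proof
      assume "\<epsilon> = 0"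
      then have "\<theta> = of_int (2 * k) / of_int (int t)" using t by (simp add: \<epsilon>_def field_simps)
      then show False using \<theta> by (metis Rats_divide Rats_of_int)
    qed
    define M where "M = nat \<lceil>2 / \<bar>\<epsilon>\<bar>\<rceil>"
    have "2 / \<bar>\<epsilon>\<bar> \<le> real M" unfolding M_def by (rule real_nat_ceiling_ge)
    then have M: "2 \<le> real M * \<bar>\<epsilon>\<bar>" using \<open>\<epsilon> \<noteq> 0\<close> by (simp add: field_simps)
    have "\<exists>j\<le>M. \<tau> (d + t * j) \<noteq> \<tau> d" for d
    proof (rule ccontr)
      assume "\<not> ?thesis"
      then have const: "\<And>j. j \<le> M \<Longrightarrow> \<tau> (d + t * j) = \<tau> d" by auto
      define f where "f j = \<lfloor>real d * \<theta> + real j * \<epsilon>\<rfloor>" for j :: nat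
      have "real (d + t * j) * \<theta> = real d * \<theta> + real j * \<epsilon> + of_int (2 * k * int j)" for j
        by (simp add: \<epsilon>_def algebra_simps)
      then have "\<lfloor>real (d + t * j) * \<theta>\<rfloor> = f j + 2 * k * int j" for j
        unfolding f_def by (metis floor_add_int)
      then have parity: "\<tau> (d + t * j) = even (f j)" for j by (simp add: \<tau>_def)
      have "f j = f 0" if "j \<le> M" for j
        using that
      proof (induction j)
        case (Suc j)
        have "\<bar>f (Suc j) - f j\<bar> \<le> 1"
        proof -
          have "real d * \<theta> + real (Suc j) * \<epsilon> = (real d * \<theta> + real j * \<epsilon>) + \<epsilon>"
            by (simp add: algebra_simps)
          then show ?thesis unfolding f_def using \<epsilon>1 by linarith
        qed
        moreover have "even (f (Suc j)) = even (f j)"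
          using const[of "Suc j"] const[of j] parity[of "Suc j"] parity[of j] Suc.prems by linarith
        ultimately have "f (Suc j) = f j" by presburger
        then show ?case using Suc by simp
      qed simp
      from this[of M] have "f M = f 0" by blast
      then have "\<bar>real M * \<epsilon>\<bar> < 1" unfolding f_def by linarith
      then show False using M by (simp add: abs_mult)
    qed
    then show ?thesis by blast
  qed
  then show ?thesis by blast
qed

section \<open>Nested half-spaces and translations\<close>

context coxeter_system
begin

definition nested :: "'a set \<Rightarrow> 'a set \<Rightarrow> bool"
  where "nested H L \<longleftrightarrow> H \<subseteq> L \<or> L \<subseteq> H \<or> H \<inter> L = {} \<or> carrier G \<subseteq> H \<union> L"

lemma l_coset_mono_iff:
  assumes "g \<in> carrier G" "H \<subseteq> carrier G" "L \<subseteq> carrier G"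
  shows "g <# H \<subseteq> g <# L \<longleftrightarrow> H \<subseteq> L" and "g <# H \<subset> g <# L \<longleftrightarrow> H \<subset> L"
proof -
  have mono: "g <# H \<subseteq> g <# L" if "H \<subseteq> L" for g H L
    using that by (auto simp: l_coset_def)
  have sub: "g <# H \<subseteq> g <# L \<longleftrightarrow> H \<subseteq> L" if "H \<subseteq> carrier G" "L \<subseteq> carrier G" for H L
    using mono[of H L g] mono[of "g <# H" "g <# L" "inv g"] that assms(1)
    by (auto simp: lcos_m_assoc lcos_mult_one)
  show "g <# H \<subseteq> g <# L \<longleftrightarrow> H \<subseteq> L" "g <# H \<subset> g <# L \<longleftrightarrow> H \<subset> L"
    using sub assms unfolding less_le_not_le psubset_eq by blast+
qed

text \<open>Without such a translation, nestedness lets each \<open>P\<close>-orbit contribute at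
  most one half-space to a set \<open>separating u v\<close>. Powers of \<open>g\<close> move every
  half-space between \<open>\<one>\<close> and \<open>g [^] n\<close> to one between
  \<open>\<one>\<close> and \<open>g\<close>. So all powers of \<open>g\<close> would lie in a
  finite ball.\<close>

lemma ex_nested_translate:
  assumes P: "subgroup P G" "g \<in> P" and inf: "\<And>n::nat. 0 < n \<Longrightarrow> g [^] n \<noteq> \<one>"
    and nest: "\<And>a H. a \<in> P \<Longrightarrow> H \<in> half_spaces \<Longrightarrow> nested H (a <# H)"
  shows "\<exists>a\<in>P. \<exists>H\<in>half_spaces. H \<subset> a <# H"
proof (rule ccontr)
  assume "\<not> ?thesis"
  then have no: "\<And>a H. a \<in> P \<Longrightarrow> H \<in> half_spaces \<Longrightarrow> \<not> H \<subset> a <# H" by blast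
  have PG: "\<And>a. a \<in> P \<Longrightarrow> a \<in> carrier G" using P(1) by (rule subgroup.mem_carrier)
  have one_orbit: "a <# H = H"
    if a: "a \<in> P" and H: "H \<in> half_spaces" and uv: "H \<in> separating u v" "a <# H \<in> separating u v"
      and v: "v \<in> carrier G"
    for a H u v
  proof -
    have HG: "H \<subseteq> carrier G" "a <# H \<subseteq> carrier G"
      using half_space_subset half_spaces_translate[OF PG[OF a]] H by auto
    have "\<not> H \<inter> (a <# H) = {}" "\<not> carrier G \<subseteq> H \<union> (a <# H)"
      using uv v by (auto simp: separating_def)
    then have "H \<subseteq> a <# H \<or> a <# H \<subseteq> H" using nest[OF a H] by (auto simp: nested_def)
    moreover have "\<not> a <# H \<subset> H"
    proof
      assume "a <# H \<subset> H"
      then have "inv a <# (a <# H) \<subset> inv a <# H"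
        using l_coset_mono_iff(2)[of "inv a" "a <# H" H] HG PG[OF a] by simp
      then have "H \<subset> inv a <# H" using HG PG[OF a] by (simp add: lcos_m_assoc lcos_mult_one)
      then show False using no[of "inv a" H] subgroup.m_inv_closed[OF P(1) a] H by blast
    qed
    ultimately show ?thesis using no[OF a H] by blast
  qed
  have gG: "g \<in> carrier G" using PG P by blast
  have gn: "g [^] n \<in> P" for n :: nat
    by (induction n) (use P in \<open>auto intro: subgroup.m_closed subgroup.one_closed\<close>)
  have "card (separating \<one> (g [^] n)) \<le> card (separating \<one> g)" for n :: nat
  proof -
    have "\<exists>b\<in>P. b <# H \<in> separating \<one> g" if H: "H \<in> separating \<one> (g [^] n)" for H
    proof -
      have "\<one> \<in> H" "g [^] n \<notin> H" and HH: "H \<in> half_spaces" using H by (auto simp: separating_def)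
      have "\<exists>k<n. g [^] k \<in> H \<and> g [^] Suc k \<notin> H"
      proof (rule ccontr)
        assume "\<not> ?thesis"
        then have step: "\<And>k. k < n \<Longrightarrow> g [^] k \<in> H \<Longrightarrow> g [^] Suc k \<in> H" by blast
        have "g [^] k \<in> H" if "k \<le> n" for k
          using that by (induction k) (use \<open>\<one> \<in> H\<close> step in auto)
        then show False using \<open>g [^] n \<notin> H\<close> by blast
      qed
      then obtain k where k: "g [^] k \<in> H" "g [^] Suc k \<notin> H" by blast
      let ?b = "inv (g [^] k)"
      have "?b <# H \<in> half_spaces" using HH gG by (intro half_spaces_translate) auto
      moreover have "\<one> \<in> ?b <# H" "g \<notin> ?b <# H"
        using k gG half_space_subset[OF HH] by (auto simp: mem_l_coset_iff)
      ultimately have "?b <# H \<in> separating \<one> g" by (simp add: separating_def)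
      moreover have "?b \<in> P" using gn P by (intro subgroup.m_inv_closed)
      ultimately show ?thesis by blast
    qed
    then obtain b where b: "\<And>H. H \<in> separating \<one> (g [^] n) \<Longrightarrow> b H \<in> P"
      "\<And>H. H \<in> separating \<one> (g [^] n) \<Longrightarrow> b H <# H \<in> separating \<one> g"
      by metis
    have "inj_on (\<lambda>H. b H <# H) (separating \<one> (g [^] n))"
    proof (rule inj_onI)
      fix H L assume H: "H \<in> separating \<one> (g [^] n)" and L: "L \<in> separating \<one> (g [^] n)"
        and eq: "b H <# H = b L <# L"
      have HL: "H \<in> half_spaces" "L \<in> half_spaces" "H \<subseteq> carrier G" "L \<subseteq> carrier G"
        using H L half_space_subset by (auto simp: separating_def)
      have bb: "b H \<in> carrier G" "b L \<in> carrier G" using b(1) H L PG by auto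
      have "(inv (b L) \<otimes> b H) <# H = inv (b L) <# (b H <# H)"
        using bb HL by (simp add: lcos_m_assoc)
      also have "\<dots> = L" unfolding eq using bb HL by (simp add: lcos_m_assoc lcos_mult_one)
      finally have "(inv (b L) \<otimes> b H) <# H = L" .
      moreover have "inv (b L) \<otimes> b H \<in> P"
        using b(1) H L P(1) by (simp add: subgroup.m_closed subgroup.m_inv_closed)
      ultimately show "H = L"
        using one_orbit[of "inv (b L) \<otimes> b H" H \<one> "g [^] n"] H L HL gG by simp
    qed
    then show ?thesis
      using b(2) finite_separating[OF one_closed gG] by (intro card_inj_on_le) auto
  qed
  then have "range (\<lambda>n::nat. g [^] n) \<subseteq> {u \<in> carrier G. card (separating \<one> u) \<le> card (separating \<one> g)}"
    using gG by auto
  then have "finite (range (\<lambda>n::nat. g [^] n))"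
    using finite_few_separating by (rule finite_subset)
  then have "\<not> inj (\<lambda>n::nat. g [^] n)"
    using range_inj_infinite by blast
  then obtain n n' :: nat where n: "n < n'" "g [^] n = g [^] n'"
    unfolding inj_on_def by (metis linorder_neqE_nat)
  have "g [^] n \<otimes> g [^] (n' - n) = g [^] (n + (n' - n))"
    using gG by (rule nat_pow_mult)
  also have "\<dots> = g [^] n" using n by simp
  finally have "g [^] (n' - n) = \<one>" using gG by simp
  then show False using inf[of "n' - n"] n by simp
qed

section \<open>Depth of a half-space within its class\<close>

definition depth :: "'a set \<Rightarrow> 'a \<Rightarrow> 'a set \<Rightarrow> nat"
  where "depth K h H = card {L \<in> half_spaces. h \<in> L \<and> L \<subset> H \<and>
    K #> half_space_refl L = K #> half_space_refl H}"

lemma coset_conj: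
  assumes "K \<lhd> G" "a \<in> carrier G" "b \<in> carrier G" "x \<in> carrier G" "y \<in> carrier G"
    and "K #> x = K #> y"
  shows "K #> (a \<otimes> x \<otimes> b) = K #> (a \<otimes> y \<otimes> b)"
  using assms normal.rcos_sum[OF assms(1)] by (metis m_closed)

text \<open>Conjugation permutes the cosets of a normal subgroup, so equality of classes can be read
  off from any translate.\<close>

lemma coset_conj_iff:
  assumes K: "K \<lhd> G" and a: "a \<in> carrier G" and xy: "x \<in> carrier G" "y \<in> carrier G"
  shows "K #> (a \<otimes> x \<otimes> inv a) = K #> (a \<otimes> y \<otimes> inv a) \<longleftrightarrow> K #> x = K #> y"
proof
  assume "K #> (a \<otimes> x \<otimes> inv a) = K #> (a \<otimes> y \<otimes> inv a)"
  then have "K #> (inv a \<otimes> (a \<otimes> x \<otimes> inv a) \<otimes> a) = K #> (inv a \<otimes> (a \<otimes> y \<otimes> inv a) \<otimes> a)"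
    by (rule coset_conj[OF K, rotated 4]) (use a xy in auto)
  moreover have "inv a \<otimes> (a \<otimes> z \<otimes> inv a) \<otimes> a = z" if "z \<in> carrier G" for z
    using a that by (simp add: m_assoc) (simp add: m_assoc[symmetric])
  ultimately show "K #> x = K #> y" using xy by simp
next
  assume "K #> x = K #> y"
  then show "K #> (a \<otimes> x \<otimes> inv a) = K #> (a \<otimes> y \<otimes> inv a)"
    by (rule coset_conj[OF K, rotated 4]) (use a xy in auto)
qed

lemma half_space_refl_closed: "H \<in> half_spaces \<Longrightarrow> half_space_refl H \<in> carrier G"
  using half_space_refl_reflection reflection_square(1) by blast

lemma translate_class_iff:
  assumes "K \<lhd> G" "g \<in> carrier G" "H \<in> half_spaces" "L \<in> half_spaces"
  shows "K #> half_space_refl (g <# L) = K #> half_space_refl (g <# H) \<longleftrightarrow>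
    K #> half_space_refl L = K #> half_space_refl H"
  using assms by (simp add: half_space_refl_translate coset_conj_iff half_space_refl_closed)

lemma translate_half_spaces_image:
  assumes g: "g \<in> carrier G" and PQ: "\<And>L. L \<in> half_spaces \<Longrightarrow> Q (g <# L) \<longleftrightarrow> P L"
  shows "{L \<in> half_spaces. Q L} = (\<lambda>L. g <# L) ` {L \<in> half_spaces. P L}"
    and "card {L \<in> half_spaces. Q L} = card {L \<in> half_spaces. P L}"
proof -
  show eq: "{L \<in> half_spaces. Q L} = (\<lambda>L. g <# L) ` {L \<in> half_spaces. P L}"
  proof (intro subset_antisym subsetI)
    fix L assume L: "L \<in> {L \<in> half_spaces. Q L}"
    then have "L = g <# (inv g <# L)" "inv g <# L \<in> half_spaces"
      using g half_space_subset half_spaces_translate by (auto simp: lcos_m_assoc lcos_mult_one)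
    then show "L \<in> (\<lambda>L. g <# L) ` {L \<in> half_spaces. P L}"
      using L PQ by (metis (mono_tags, lifting) image_eqI mem_Collect_eq)
  qed (use g PQ half_spaces_translate in auto)
  have "inj_on (\<lambda>L. g <# L) {L \<in> half_spaces. P L}"
    using g half_space_subset l_coset_cancel[OF g] by (intro inj_onI) simp
  then show "card {L \<in> half_spaces. Q L} = card {L \<in> half_spaces. P L}"
    unfolding eq by (rule card_image)
qed

lemma depth_translate:
  assumes K: "K \<lhd> G" and g: "g \<in> carrier G" and h: "h \<in> carrier G" and H: "H \<in> half_spaces"
  shows "depth K (g \<otimes> h) (g <# H) = depth K h H"
  unfolding depth_def
proof (rule translate_half_spaces_image(2)[OF g])
  fix L assume L: "L \<in> half_spaces"
  have "g \<otimes> h \<in> g <# L \<longleftrightarrow> h \<in> L"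
    using g h half_space_subset[OF L] by (simp add: mem_l_coset_iff m_assoc[symmetric])
  then show "g \<otimes> h \<in> g <# L \<and> g <# L \<subset> g <# H \<and>
      K #> half_space_refl (g <# L) = K #> half_space_refl (g <# H) \<longleftrightarrow>
    h \<in> L \<and> L \<subset> H \<and> K #> half_space_refl L = K #> half_space_refl H"
    using translate_class_iff[OF K g H L] l_coset_mono_iff(2)[OF g]
      half_space_subset[OF L] half_space_subset[OF H] by simp
qed

lemma finite_half_spaces_between:
  assumes "u \<in> carrier G" "H \<in> half_spaces"
  shows "finite {L \<in> half_spaces. u \<in> L \<and> L \<subset> H \<and> Q L}"
proof -
  obtain v where v: "v \<in> carrier G" "v \<notin> H"
    using half_space_ne[OF half_spaces_compl[OF assms(2)]] by blast
  then have "{L \<in> half_spaces. u \<in> L \<and> L \<subset> H \<and> Q L} \<subseteq> separating u v"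
    by (auto simp: separating_def)
  then show ?thesis using finite_separating[OF assms(1) v(1)] finite_subset by blast
qed

text \<open>A half-space of the class that contains \<open>h\<close> and lies in \<open>H'\<close>
  meets \<open>H\<close> and does not cover the group together with it. Nestedness leaves two cases:
  it lies strictly inside \<open>H\<close> or contains \<open>H\<close>.\<close>

lemma depth_step:
  assumes nest: "\<And>H L. H \<in> half_spaces \<Longrightarrow> L \<in> half_spaces \<Longrightarrow>
      K #> half_space_refl H = K #> half_space_refl L \<Longrightarrow> nested H L"
    and H: "H \<in> half_spaces" "H' \<in> half_spaces" "H \<subset> H'"
      "K #> half_space_refl H' = K #> half_space_refl H" and h: "h \<in> H"
  shows "depth K h H' = depth K h H +
    card {L \<in> half_spaces. H \<subseteq> L \<and> L \<subset> H' \<and> K #> half_space_refl L = K #> half_space_refl H}"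
proof -
  let ?c = "\<lambda>L. K #> half_space_refl L"
  have hG: "h \<in> carrier G" using h half_space_subset[OF H(1)] by blast
  have "{L \<in> half_spaces. h \<in> L \<and> L \<subset> H' \<and> ?c L = ?c H'} =
    {L \<in> half_spaces. h \<in> L \<and> L \<subset> H \<and> ?c L = ?c H} \<union>
    {L \<in> half_spaces. H \<subseteq> L \<and> L \<subset> H' \<and> ?c L = ?c H}" (is "?A = ?B \<union> ?C")
  proof
    show "?A \<subseteq> ?B \<union> ?C"
    proof
      fix L assume L: "L \<in> ?A"
      then have "nested L H" using nest[of L H] H by simp
      moreover have "\<not> L \<inter> H = {}" using L h by blast
      moreover have "L \<union> H \<subseteq> H'" using L H(3) by auto
      then have "\<not> carrier G \<subseteq> L \<union> H" using half_space_ne[OF half_spaces_compl[OF H(2)]] by auto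
      ultimately have "L \<subseteq> H \<or> H \<subseteq> L" by (auto simp: nested_def)
      then show "L \<in> ?B \<union> ?C" using L H by auto
    qed
    show "?B \<union> ?C \<subseteq> ?A" using H h by auto
  qed
  moreover have "?B \<inter> ?C = {}" by blast
  moreover have "finite ?A" using finite_half_spaces_between[OF hG H(2)] .
  ultimately show ?thesis unfolding depth_def by (simp add: card_Un_disjoint)
qed

text \<open>The difference \<open>t\<close> counts the half-spaces of the class from
  \<open>H\<close>, included, to \<open>a <# H\<close>, excluded. It is positive because of
  \<open>H\<close> itself, does not depend on \<open>h\<close>, and is the same for every gap
  because \<open>a [^] j\<close> translates the first gap to the later ones.\<close>

lemma depth_arithmetic:
  assumes K: "K \<lhd> G"
    and nest: "\<And>H L. H \<in> half_spaces \<Longrightarrow> L \<in> half_spaces \<Longrightarrow>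
      K #> half_space_refl H = K #> half_space_refl L \<Longrightarrow> nested H L"
    and a: "a \<in> carrier G"
      "\<And>x. x \<in> reflections G (s ` I) \<Longrightarrow> K #> (a \<otimes> x \<otimes> inv a) = K #> x"
    and H: "H \<in> half_spaces" "H \<subset> a <# H"
  shows "\<exists>t>0. \<forall>h\<in>H. \<forall>j::nat. depth K h (a [^] j <# H) = depth K h H + t * j"
proof -
  let ?c = "\<lambda>L. K #> half_space_refl L"
  define T where "T = {L \<in> half_spaces. H \<subseteq> L \<and> L \<subset> a <# H \<and> ?c L = ?c H}"
  obtain u where u: "u \<in> H" using half_space_ne[OF H(1)] by blast
  have HG: "H \<subseteq> carrier G" using half_space_subset[OF H(1)] .
  have "T \<subseteq> {L \<in> half_spaces. u \<in> L \<and> L \<subset> a <# H \<and> True}" using u by (auto simp: T_def)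
  moreover have "finite {L \<in> half_spaces. u \<in> L \<and> L \<subset> a <# H \<and> True}"
    using u HG a H by (intro finite_half_spaces_between half_spaces_translate) auto
  ultimately have "finite T" by (rule finite_subset)
  moreover have "H \<in> T" using H by (auto simp: T_def)
  ultimately have t: "0 < card T" by (auto simp: card_gt_0_iff)
  have ca: "?c (a <# L) = ?c L" if "L \<in> half_spaces" for L
    using a that half_space_refl_reflection by (simp add: half_space_refl_translate)
  have Hj: "a [^] j <# H \<in> half_spaces" "a [^] Suc j <# H = a [^] j <# (a <# H)"
      "?c (a [^] j <# H) = ?c H" for j :: nat
  proof -
    show Hj: "a [^] j <# H \<in> half_spaces" for j :: nat
      using a H by (intro half_spaces_translate) auto
    show "a [^] Suc j <# H = a [^] j <# (a <# H)"
      using a HG by (simp add: lcos_m_assoc)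
    show "?c (a [^] j <# H) = ?c H"
    proof (induction j)
      case 0
      then show ?case using HG by (simp add: lcos_mult_one)
    next
      case (Suc j)
      have "a [^] Suc j <# H = a <# (a [^] j <# H)"
        using a HG nat_pow_Suc2[of a j] by (simp add: lcos_m_assoc del: nat_pow_Suc)
      then show ?case using ca[OF Hj] Suc by simp
    qed
  qed
  have "depth K h (a [^] j <# H) = depth K h H + card T * j" if h: "h \<in> H" for h and j :: nat
  proof (induction j)
    case 0
    then show ?case using HG by (simp add: lcos_mult_one)
  next
    case (Suc j)
    have sub: "a [^] j <# H \<subset> a [^] Suc j <# H" for j :: nat
      using l_coset_mono_iff(2)[of "a [^] j" H "a <# H"] a H HG Hj(2)[of j]
        half_space_subset[OF half_spaces_translate[OF a(1) H(1)]] by simp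
    have "h \<in> a [^] j <# H" for j :: nat
    proof (induction j)
      case 0
      then show ?case using h HG by (simp add: lcos_mult_one)
    next
      case (Suc j)
      then show ?case using sub[of j] by blast
    qed
    then have "depth K h (a [^] Suc j <# H) = depth K h (a [^] j <# H) +
        card {L \<in> half_spaces. a [^] j <# H \<subseteq> L \<and> L \<subset> a [^] Suc j <# H \<and> ?c L = ?c (a [^] j <# H)}"
    proof (intro depth_step[OF nest])
      show "?c (a [^] Suc j <# H) = ?c (a [^] j <# H)"
        using Hj(3)[of "Suc j"] Hj(3)[of j] by (rule trans[OF _ sym])
      show "a [^] Suc j <# H \<in> half_spaces" "a [^] j <# H \<in> half_spaces"
        by (rule Hj(1))+
      show "a [^] j <# H \<subset> a [^] Suc j <# H" by (rule sub)
    qed auto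
    also have "card {L \<in> half_spaces. a [^] j <# H \<subseteq> L \<and> L \<subset> a [^] Suc j <# H \<and> ?c L = ?c (a [^] j <# H)} = card T"
      unfolding T_def
    proof (rule translate_half_spaces_image(2)[of "a [^] j"])
      fix L assume L: "L \<in> half_spaces"
      show "a [^] j <# H \<subseteq> a [^] j <# L \<and> a [^] j <# L \<subset> a [^] Suc j <# H \<and>
          ?c (a [^] j <# L) = ?c (a [^] j <# H) \<longleftrightarrow> H \<subseteq> L \<and> L \<subset> a <# H \<and> ?c L = ?c H"
        unfolding Hj(2)
        using translate_class_iff[OF K _ H(1) L, of "a [^] j"] a HG half_space_subset[OF L]
          half_space_subset[OF half_spaces_translate[OF a(1) H(1)]]
        by (simp add: l_coset_mono_iff)
    qed (use a in simp)
    finally show ?case using Suc by (simp add: algebra_simps)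
  qed
  then show ?thesis using t by blast
qed

definition positive_side :: "'a \<Rightarrow> 'a set"
  where "positive_side x = (THE H. H \<in> half_spaces \<and> half_space_refl H = x \<and> \<one> \<in> H)"

lemma positive_side_eq:
  assumes "H \<in> half_spaces" "\<one> \<in> H"
  shows "positive_side (half_space_refl H) = H"
  unfolding positive_side_def
  using assms half_space_refl_eqD by (intro the_equality) auto

text \<open>The link between the coloring and its translates: at the wall of \<open>H\<close>, the
  translate by \<open>h\<close> shows the depth measured from \<open>h\<close> instead of the
  identity.\<close>

lemma depth_positive_side:
  assumes K: "K \<lhd> G" and h: "h \<in> H" and H: "H \<in> half_spaces"
  shows "depth K \<one> (positive_side (inv h \<otimes> half_space_refl H \<otimes> h)) = depth K h H"
proof -
  have hG: "h \<in> carrier G" using h half_space_subset[OF H] by blast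
  have H': "inv h <# H \<in> half_spaces" using hG H by (intro half_spaces_translate) auto
  have "\<one> \<in> inv h <# H" using h hG half_space_subset[OF H] by (simp add: mem_l_coset_iff)
  moreover have "half_space_refl (inv h <# H) = inv h \<otimes> half_space_refl H \<otimes> h"
    using hG H by (simp add: half_space_refl_translate)
  ultimately have "positive_side (inv h \<otimes> half_space_refl H \<otimes> h) = inv h <# H"
    using positive_side_eq[OF H'] by simp
  then show ?thesis using depth_translate[OF K _ hG H, of "inv h"] hG by simp
qed

lemma coset_eqD:
  assumes "K \<lhd> G" "x \<in> carrier G" "y \<in> carrier G" "K #> x = K #> y"
  shows "x \<otimes> inv y \<in> K"
proof -
  have K: "subgroup K G" using assms(1) by (rule normal_imp_subgroup)
  have "x \<in> K #> y" using rcos_self[OF assms(2) K] assms(4) by simp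
  then obtain k where k: "k \<in> K" "x = k \<otimes> y" by (auto simp: r_coset_def)
  then show ?thesis using assms(3) subgroup.mem_carrier[OF K] by (simp add: m_assoc)
qed

lemma commutes_gens_imp_central:
  assumes "g \<in> carrier G" "\<And>i. i \<in> I \<Longrightarrow> g \<otimes> s i = s i \<otimes> g" "x \<in> carrier G"
  shows "g \<otimes> x = x \<otimes> g"
  using assms(3)
proof (induction x rule: gen_induct)
  case (mult i x)
  have "g \<otimes> (s i \<otimes> x) = (s i \<otimes> g) \<otimes> x"
    using assms(1,2) mult by (simp add: m_assoc[symmetric])
  also have "\<dots> = s i \<otimes> x \<otimes> g"
    using assms(1) mult by (simp add: m_assoc)
  finally show ?case .
qed (use assms in simp)

text \<open>If the walls crossed, the product of their reflections would have finite order and lie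
  in \<open>K\<close>. A conjugate would lie in \<open>spherical\<close> and in \<open>K\<close>,
  hence be trivial, and the walls would coincide.\<close>

lemma same_class_nested:
  assumes K: "K \<lhd> G" "K \<inter> (spherical - {\<one>}) = {}"
    and H: "H \<in> half_spaces" and L: "L \<in> half_spaces"
    and eq: "K #> half_space_refl H = K #> half_space_refl L"
  shows "nested H L"
proof (rule ccontr)
  assume not: "\<not> nested H L"
  let ?x = "half_space_refl H" and ?y = "half_space_refl L"
  have x: "?x \<in> carrier G" and y: "?y \<in> carrier G" "inv ?y = ?y" "?y \<otimes> ?y = \<one>"
    using half_space_refl_reflection H L reflection_square by auto
  have sub: "H \<subseteq> carrier G" "L \<subseteq> carrier G" using H L half_space_subset by auto
  have "H \<inter> L \<noteq> {}" "H - L \<noteq> {}" "L - H \<noteq> {}" "carrier G - (H \<union> L) \<noteq> {}"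
    using not by (auto simp: nested_def)
  then obtain n :: nat where n: "0 < n" "(?x \<otimes> ?y) [^] n = \<one>"
    using crossing_finite_order[OF H L] by blast
  define z where "z = ?x \<otimes> ?y"
  have z: "z \<in> carrier G" using x y by (simp add: z_def)
  obtain u where u: "u \<in> carrier G" "inv u \<otimes> z \<otimes> u \<in> spherical"
    using finite_order_conj_spherical[OF z n(1)] n(2) z_def by blast
  have "z \<in> K" using coset_eqD[OF K(1) x y(1) eq] y by (simp add: z_def)
  then have "inv u \<otimes> z \<otimes> u \<in> K" using normal.inv_op_closed1[OF K(1) u(1)] by blast
  then have "inv u \<otimes> z \<otimes> u = \<one>" using u K(2) by blast
  then have "u \<otimes> (inv u \<otimes> z \<otimes> u) \<otimes> inv u = \<one>" using u by simp
  then have "z = \<one>" using u(1) z by (simp add: m_assoc) (simp add: m_assoc[symmetric])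
  then have "?x = ?y" using x y inv_equality[of ?x ?y] by (simp add: z_def)
  then have "H = L \<or> H = carrier G - L" using half_space_refl_eqD[OF H L] by blast
  then show False using not sub by (auto simp: nested_def)
qed

text \<open>The theorem without walls and topology. The condition on finite sets \<open>Y\<close> is
  membership in the closure of the orbit for the product of discrete spaces, and the conclusion is
  that \<open>g\<close> acts trivially.\<close>

lemma reflection_coloring:
  "\<exists>F c. finite (F :: nat set) \<and> c \<in> reflections G (s ` I) \<rightarrow> F \<and>
    (\<forall>\<psi>. \<forall>g\<in>carrier G.
      (\<forall>Y. finite Y \<and> Y \<subseteq> reflections G (s ` I) \<longrightarrow>
        (\<exists>h\<in>carrier G. \<forall>y\<in>Y. \<psi> y = c (inv h \<otimes> y \<otimes> h))) \<and>
      (\<forall>x\<in>reflections G (s ` I). \<psi> (g \<otimes> x \<otimes> inv g) = \<psi> x) \<longrightarrow>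
      (\<forall>x\<in>reflections G (s ` I). g \<otimes> x \<otimes> inv g = x))"
proof -
  let ?R = "reflections G (s ` I)"
  \<comment> \<open>Avoiding \<open>spherical\<close> makes the half-spaces of one class nested.
    Avoiding the commutators of its elements with the generators forces a finite-order element that
    preserves all classes to be central.\<close>
  define E where "E = (spherical \<union> (\<lambda>(g, i). g \<otimes> s i \<otimes> inv g \<otimes> s i) ` (spherical \<times> I)) - {\<one>}"
  have "finite E" using finite_spherical finite_I by (simp add: E_def)
  moreover have "E \<subseteq> carrier G" using spherical_subset by (auto simp: E_def)
  ultimately obtain K where K: "K \<lhd> G" "finite (rcosets K)" "K \<inter> E = {}"
    using residually_finite[of E] by (auto simp: E_def)
  obtain \<tau> :: "nat \<Rightarrow> bool" where \<tau>: "\<And>t. 0 < t \<Longrightarrow> \<exists>M. \<forall>d. \<exists>j\<le>M. \<tau> (d + t * j) \<noteq> \<tau> d"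
    using parity_sequence by blast
  have "finite ((rcosets K) \<times> (UNIV :: bool set))" using K by simp
  from finite_imp_inj_to_nat_seg[OF this] obtain e :: "'a set \<times> bool \<Rightarrow> nat" where e: "inj_on e ((rcosets K) \<times> UNIV)"
    by (elim exE conjE)
  define c where "c x = e (K #> x, \<tau> (depth K \<one> (positive_side x)))" for x
  define F where "F = e ` ((rcosets K) \<times> UNIV)"
  have coset: "K #> x \<in> rcosets K" if "x \<in> carrier G" for x
    using that by (auto simp: RCOSETS_def)
  have RG: "x \<in> carrier G" if "x \<in> ?R" for x using that reflection_square by blast
  have c_eqD: "K #> x = K #> y" "\<tau> (depth K \<one> (positive_side x)) = \<tau> (depth K \<one> (positive_side y))"
    if "x \<in> carrier G" "y \<in> carrier G" "c x = c y" for x y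
    using inj_onD[OF e that(3)[unfolded c_def]] coset that by auto
  have nest: "nested H L"
    if "H \<in> half_spaces" "L \<in> half_spaces" "K #> half_space_refl H = K #> half_space_refl L" for H L
    using same_class_nested[OF K(1) _ that] K(3) by (auto simp: E_def)
  have sR: "a \<otimes> x \<otimes> inv a \<in> ?R" if "a \<in> carrier G" "x \<in> ?R" for a x
    using reflections_conjugate[of "s ` I"] that by auto
  have main: "g \<otimes> x \<otimes> inv g = x"
    if g: "g \<in> carrier G"
      and lim: "\<And>Y. finite Y \<Longrightarrow> Y \<subseteq> ?R \<Longrightarrow> \<exists>h\<in>carrier G. \<forall>y\<in>Y. \<psi> y = c (inv h \<otimes> y \<otimes> h)"
      and fixed: "\<And>x. x \<in> ?R \<Longrightarrow> \<psi> (g \<otimes> x \<otimes> inv g) = \<psi> x"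
      and x: "x \<in> ?R"
    for \<psi> :: "'a \<Rightarrow> nat" and g x
  proof -
    have coset_fixed: "K #> (a \<otimes> y \<otimes> inv a) = K #> y"
      if a: "a \<in> carrier G" and y: "y \<in> ?R" and eq: "\<psi> (a \<otimes> y \<otimes> inv a) = \<psi> y" for a y
    proof -
      have R: "a \<otimes> y \<otimes> inv a \<in> ?R" "y \<in> ?R" using sR a y by auto
      then obtain h where h: "h \<in> carrier G" "\<psi> y = c (inv h \<otimes> y \<otimes> h)"
          "\<psi> (a \<otimes> y \<otimes> inv a) = c (inv h \<otimes> (a \<otimes> y \<otimes> inv a) \<otimes> h)"
        using lim[of "{y, a \<otimes> y \<otimes> inv a}"] by auto
      then have "K #> (inv h \<otimes> (a \<otimes> y \<otimes> inv a) \<otimes> h) = K #> (inv h \<otimes> y \<otimes> h)"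
        using R[THEN RG] eq by (intro c_eqD(1)) auto
      then show ?thesis
        using coset_conj_iff[OF K(1), of "inv h" "a \<otimes> y \<otimes> inv a" y] R[THEN RG] h(1) by simp
    qed
    show ?thesis
    proof (cases "\<exists>n::nat. 0 < n \<and> g [^] n = \<one>")
      case True
      then obtain n :: nat where n: "0 < n" "g [^] n = \<one>" by blast
      then obtain u where u: "u \<in> carrier G" "inv u \<otimes> g \<otimes> u \<in> spherical"
        using finite_order_conj_spherical[OF g] by blast
      define g0 where "g0 = inv u \<otimes> g \<otimes> u"
      have g0: "g0 \<in> carrier G" "g0 \<in> spherical" "g = u \<otimes> g0 \<otimes> inv u"
        using u g by (simp_all add: g0_def m_assoc) (simp add: m_assoc[symmetric])
      have "g0 \<otimes> s i = s i \<otimes> g0" if i: "i \<in> I" for i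
      proof -
        let ?y = "u \<otimes> s i \<otimes> inv u"
        have y: "?y \<in> ?R" using u i by (auto simp: reflections_def)
        have "g \<otimes> ?y \<otimes> inv g = u \<otimes> (g0 \<otimes> s i \<otimes> inv g0) \<otimes> inv u"
        proof -
          have "inv u \<otimes> (u \<otimes> v) = v" if "v \<in> carrier G" for v
            using u that by (simp add: m_assoc[symmetric])
          then show ?thesis using u g0(1) i by (simp add: g0(3) m_assoc inv_mult_group)
        qed
        then have "K #> (u \<otimes> (g0 \<otimes> s i \<otimes> inv g0) \<otimes> inv u) = K #> ?y"
          using coset_fixed[OF g y fixed[OF y]] by simp
        then have "K #> (g0 \<otimes> s i \<otimes> inv g0) = K #> s i"
          using coset_conj_iff[OF K(1) u(1)] g0 i by simp
        from coset_eqD[OF K(1) _ _ this] have "g0 \<otimes> s i \<otimes> inv g0 \<otimes> s i \<in> K"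
          using g0 i by simp
        then have "g0 \<otimes> s i \<otimes> inv g0 \<otimes> s i = \<one>"
          using K(3) g0(2) i by (force simp: E_def)
        then have "g0 \<otimes> s i \<otimes> inv g0 = s i"
          using g0 i inv_equality[of "g0 \<otimes> s i \<otimes> inv g0" "s i"] by simp
        then have "g0 \<otimes> s i \<otimes> inv g0 \<otimes> g0 = s i \<otimes> g0" by simp
        then show ?thesis using g0 i by (simp add: m_assoc)
      qed
      then have central: "g0 \<otimes> v = v \<otimes> g0" if "v \<in> carrier G" for v
        using commutes_gens_imp_central[OF g0(1)] that by blast
      have "u \<otimes> g0 = g0 \<otimes> u" using central[OF u(1)] by simp
      then have "g = g0 \<otimes> u \<otimes> inv u" using g0(3) by simp
      then have "g = g0" using g0(1) u(1) by (simp add: m_assoc)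
      then have "g \<otimes> x \<otimes> inv g = x \<otimes> g \<otimes> inv g" using central[OF RG[OF x]] by simp
      then show ?thesis using RG[OF x] g by (simp add: m_assoc)
    next
      case False
      \<comment> \<open>The stabilizer of \<open>\<psi>\<close>. The translating element
        \<open>a\<close> found below lies in it but need not be a power of \<open>g\<close>.\<close>
      define P where "P = {a \<in> carrier G. \<forall>x\<in>?R. \<psi> (a \<otimes> x \<otimes> inv a) = \<psi> x}"
      have "subgroup P G"
      proof (rule subgroup.intro)
        show "\<one> \<in> P" using RG by (simp add: P_def)
        show "a \<otimes> b \<in> P" if ab: "a \<in> P" "b \<in> P" for a b
        proof -
          have "\<psi> (a \<otimes> b \<otimes> x \<otimes> inv (a \<otimes> b)) = \<psi> x" if x: "x \<in> ?R" for x
          proof -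
            have "a \<otimes> b \<otimes> x \<otimes> inv (a \<otimes> b) = a \<otimes> (b \<otimes> x \<otimes> inv b) \<otimes> inv a"
              using ab RG[OF x] by (simp add: P_def m_assoc inv_mult_group)
            then show ?thesis using ab sR[of b x] x by (simp add: P_def)
          qed
          then show ?thesis using ab by (simp add: P_def)
        qed
        show "inv a \<in> P" if a: "a \<in> P" for a
        proof -
          have "\<psi> (inv a \<otimes> x \<otimes> inv (inv a)) = \<psi> x" if x: "x \<in> ?R" for x
          proof -
            have aG: "a \<in> carrier G" using a by (simp add: P_def)
            have "a \<otimes> (inv a \<otimes> x \<otimes> inv (inv a)) \<otimes> inv a = x"
              using aG RG[OF x] by (simp add: m_assoc) (simp add: m_assoc[symmetric])
            then show ?thesis using a aG sR[of "inv a" x] x by (force simp: P_def)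
          qed
          then show ?thesis using a by (simp add: P_def)
        qed
      qed (auto simp: P_def)
      have P_class: "K #> half_space_refl (a <# H) = K #> half_space_refl H"
        if a: "a \<in> P" and H: "H \<in> half_spaces" for a H
        using coset_fixed[of a "half_space_refl H"] a half_space_refl_reflection[OF H]
        by (simp add: half_space_refl_translate[OF _ H] P_def)
      have "\<exists>a\<in>P. \<exists>H\<in>half_spaces. H \<subset> a <# H"
      proof (rule ex_nested_translate[OF \<open>subgroup P G\<close>])
        show "g \<in> P" using g fixed by (simp add: P_def)
        show "g [^] n \<noteq> \<one>" if "0 < n" for n :: nat using False that by blast
        show "nested H (a <# H)" if "a \<in> P" "H \<in> half_spaces" for a H
          using that P_class by (intro nest half_spaces_translate) (auto simp: P_def)
      qed
      then obtain a H where a: "a \<in> P" and H: "H \<in> half_spaces" "H \<subset> a <# H" by blast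
      have aG: "a \<in> carrier G" using a by (simp add: P_def)
      have HG: "H \<subseteq> carrier G" using H(1) half_space_subset by blast
      have varies: "\<exists>M::nat. \<forall>h\<in>L. \<exists>j\<le>M. \<tau> (depth K h (b [^] j <# L)) \<noteq> \<tau> (depth K h L)"
        if b: "b \<in> P" and L: "L \<in> half_spaces" "L \<subset> b <# L" for b L
      proof -
        have "\<exists>t>0. \<forall>h\<in>L. \<forall>j::nat. depth K h (b [^] j <# L) = depth K h L + t * j"
          using b L by (intro depth_arithmetic[OF K(1) nest] coset_fixed) (auto simp: P_def)
        then obtain t where t: "0 < t"
            "\<And>h j. h \<in> L \<Longrightarrow> depth K h (b [^] (j::nat) <# L) = depth K h L + t * j" by blast
        obtain M where M: "\<And>d. \<exists>j\<le>M. \<tau> (d + t * j) \<noteq> \<tau> d" using \<tau>[OF t(1)] by blast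
        show ?thesis
        proof (rule exI[of _ M], rule ballI)
          fix h assume "h \<in> L"
          then show "\<exists>j\<le>M. \<tau> (depth K h (b [^] j <# L)) \<noteq> \<tau> (depth K h L)"
            using M[of "depth K h L"] t(2) by simp
        qed
      qed
      text \<open>If the chamber \<open>h\<close> approximating \<open>\<psi>\<close> is outside \<open>H\<close>, one follows the axis of \<open>a\<close> in
        the other direction.\<close>
      define H' where "H' = carrier G - H"
      have H': "H' \<in> half_spaces" using H by (simp add: H'_def half_spaces_compl)
      have "inv a <# H \<subset> inv a <# (a <# H)"
        using l_coset_mono_iff(2)[of "inv a" H "a <# H"] aG HG H
          half_space_subset[OF half_spaces_translate[OF aG H(1)]] by simp
      then have shrink: "inv a <# H \<subset> H" using aG HG by (simp add: lcos_m_assoc lcos_mult_one)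
      have "inv a <# H' = carrier G - (inv a <# H)"
        using aG HG by (auto simp: mem_l_coset_iff H'_def)
      then have H'2: "H' \<subset> inv a <# H'" using shrink HG by (auto simp: H'_def)
      have a': "inv a \<in> P" using a \<open>subgroup P G\<close> by (simp add: subgroup.m_inv_closed)
      obtain M :: nat where "\<forall>h\<in>H. \<exists>j\<le>M. \<tau> (depth K h (a [^] j <# H)) \<noteq> \<tau> (depth K h H)"
        using varies[OF a H] by (elim exE)
      note M = this[THEN bspec]
      obtain M' :: nat where "\<forall>h\<in>H'. \<exists>j\<le>M'. \<tau> (depth K h (inv a [^] j <# H')) \<noteq> \<tau> (depth K h H')"
        using varies[OF a' H' H'2] by (elim exE)
      note M' = this[THEN bspec]
      \<comment> \<open>\<open>Y\<close> has to be fixed before the chamber \<open>h\<close> is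
        known. The bounds \<open>M\<close> and \<open>M'\<close> hold for all chambers of
        \<open>H\<close> and of \<open>H'\<close>, so that \<open>Y\<close> suffices on either
        side.\<close>
      define Y where "Y = insert (half_space_refl H) (insert (half_space_refl H')
        ((\<lambda>j. half_space_refl (a [^] j <# H)) ` {..M} \<union>
         (\<lambda>j. half_space_refl (inv a [^] j <# H')) ` {..M'}))"
      have pow: "b [^] (j::nat) \<in> P" if "b \<in> P" for b j
        using that \<open>subgroup P G\<close>
        by (induction j) (auto intro: subgroup.m_closed subgroup.one_closed)
      have PG: "b \<in> carrier G" if "b \<in> P" for b using that by (simp add: P_def)
      have "Y \<subseteq> ?R"
        unfolding Y_def using H H' pow[OF a] pow[OF a'] PG
        by (auto intro!: half_space_refl_reflection half_spaces_translate)
      moreover have "finite Y" by (simp add: Y_def)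
      ultimately obtain h where h: "h \<in> carrier G" "\<And>y. y \<in> Y \<Longrightarrow> \<psi> y = c (inv h \<otimes> y \<otimes> h)"
        using lim[of Y] by blast
      have contra: False
        if b: "b \<in> P" and L: "L \<in> half_spaces" "h \<in> L" "L \<subset> b <# L"
          and Y: "half_space_refl L \<in> Y" "\<And>j. j \<le> N \<Longrightarrow> half_space_refl (b [^] j <# L) \<in> Y"
          and N: "\<exists>j\<le>N. \<tau> (depth K h (b [^] j <# L)) \<noteq> \<tau> (depth K h L)" for b L and N :: nat
      proof -
        obtain j where j: "j \<le> N" "\<tau> (depth K h (b [^] j <# L)) \<noteq> \<tau> (depth K h L)"
          using N by blast
        have bj: "b [^] j \<in> P" using pow[OF b] .
        have Lj: "b [^] j <# L \<in> half_spaces" using PG[OF bj] L(1) by (rule half_spaces_translate)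
        have "h \<in> b [^] k <# L" for k :: nat
        proof (induction k)
          case 0
          then show ?case using L half_space_subset[OF L(1)] by (simp add: lcos_mult_one)
        next
          case (Suc k)
          have bG: "b \<in> carrier G" using b PG by blast
          have "b [^] k <# L \<subset> b [^] k <# (b <# L)"
            using l_coset_mono_iff(2)[of "b [^] k" L "b <# L"] bG L half_space_subset
              half_spaces_translate by simp
          also have "b [^] k <# (b <# L) = b [^] Suc k <# L"
            using bG half_space_subset[OF L(1)] by (simp add: lcos_m_assoc)
          finally show ?case using Suc by blast
        qed
        then have hj: "h \<in> b [^] j <# L" .
        have "\<psi> (half_space_refl (b [^] j <# L)) = \<psi> (half_space_refl L)"
          using bj half_space_refl_reflection[OF L(1)]
          by (simp add: half_space_refl_translate[OF PG[OF bj] L(1)] P_def)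
        then have "c (inv h \<otimes> half_space_refl (b [^] j <# L) \<otimes> h) = c (inv h \<otimes> half_space_refl L \<otimes> h)"
          using h(2)[OF Y(1)] h(2)[OF Y(2)[OF j(1)]] by simp
        then have "\<tau> (depth K \<one> (positive_side (inv h \<otimes> half_space_refl (b [^] j <# L) \<otimes> h))) =
            \<tau> (depth K \<one> (positive_side (inv h \<otimes> half_space_refl L \<otimes> h)))"
          using h(1) half_space_refl_closed[OF L(1)] half_space_refl_closed[OF Lj]
          by (intro c_eqD(2)) auto
        then show False
          using j(2) depth_positive_side[OF K(1) hj Lj] depth_positive_side[OF K(1) L(2,1)] by simp
      qed
      have False
      proof (cases "h \<in> H")
        case True
        show False by (rule contra[OF a H(1) True H(2) _ _ M[OF True]]) (auto simp: Y_def)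
      next
        case False
        then have hH': "h \<in> H'" using h by (simp add: H'_def)
        show False by (rule contra[OF a' H' hH' H'2 _ _ M'[OF hH']]) (auto simp: Y_def)
      qed
      then show ?thesis ..
    qed
  qed
  show ?thesis
  proof (intro exI[of _ F] exI[of _ c] conjI allI ballI impI)
    show "finite F" using K by (simp add: F_def)
    show "c \<in> ?R \<rightarrow> F" using coset RG by (auto simp: c_def F_def)
  next
    fix \<psi> g x
    assume g: "g \<in> carrier G" and x: "x \<in> ?R"
      and lim: "(\<forall>Y. finite Y \<and> Y \<subseteq> ?R \<longrightarrow> (\<exists>h\<in>carrier G. \<forall>y\<in>Y. \<psi> y = c (inv h \<otimes> y \<otimes> h))) \<and>
        (\<forall>x\<in>?R. \<psi> (g \<otimes> x \<otimes> inv g) = \<psi> x)"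
    show "g \<otimes> x \<otimes> inv g = x"
    proof (rule main[OF g _ _ x])
      fix Y assume "finite Y" "Y \<subseteq> ?R"
      then show "\<exists>h\<in>carrier G. \<forall>y\<in>Y. \<psi> y = c (inv h \<otimes> y \<otimes> h)"
        using lim by (elim conjE allE[of _ Y] impE) (rule conjI)
    qed (use lim in simp)
  qed
qed

section \<open>Walls\<close>

text \<open>A wall determines its reflection: the midpoint of an edge of the Cayley graph is fixed by no
  other reflection than the one that flips this edge.\<close>

lemma inj_on_wall: "inj_on (wall G (s ` I)) (reflections G (s ` I))"
proof (rule inj_onI)
  let ?S = "s ` I"
  fix x y assume x: "x \<in> reflections G ?S" and y: "y \<in> reflections G ?S"
    and eq: "wall G ?S x = wall G ?S y"
  obtain w i where w: "w \<in> carrier G" "i \<in> I" "x = w \<otimes> s i \<otimes> inv w"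
    using x by (rule reflection_half_space)
  have ne: "w \<noteq> w \<otimes> s i" using w s_neq_one by simp
  define p where "p v = (if v = w \<or> v = w \<otimes> s i then 1 / 2 else 0 :: real)" for v
  have "{w, w \<otimes> s i} \<in> cayley_cells G ?S"
    using w unfolding cayley_cells_def by blast
  moreover have "{v. p v \<noteq> 0} \<subseteq> {w, w \<otimes> s i}" by (auto simp: p_def)
  moreover have "sum p {w, w \<otimes> s i} = 1" using ne by (simp add: p_def)
  ultimately have p: "p \<in> cayley_graph G ?S"
    unfolding cayley_graph_def by (auto simp: p_def)
  have xw: "x \<otimes> w = w \<otimes> s i" "x \<otimes> (w \<otimes> s i) = w"
    using w by (simp_all add: m_assoc) (simp add: m_assoc[symmetric])
  note X = reflection_square[OF x] and Y = reflection_square[OF y]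
  have "p (x \<otimes> v) = p v" if v: "v \<in> carrier G" for v
  proof -
    have "x \<otimes> v = z \<longleftrightarrow> v = x \<otimes> z" if "z \<in> carrier G" for z
      using X v that by (metis m_assoc l_one)
    then show ?thesis using w xw by (auto simp: p_def)
  qed
  then have "cayley_action G ?S x p = p"
    using p X cayley_graph_outside[OF _ p] by (auto simp: cayley_action_def fun_eq_iff)
  then have "p \<in> wall G ?S y"
    unfolding eq[symmetric] using p by (simp add: wall_def invariants_def)
  then have "cayley_action G ?S y p = p" by (simp add: wall_def invariants_def)
  then have "cayley_action G ?S y p w = p w" by simp
  then have "p (y \<otimes> w) = 1 / 2" using p Y w by (simp add: cayley_action_def p_def)
  then have "y \<otimes> w = w \<or> y \<otimes> w = w \<otimes> s i" by (auto simp: p_def split: if_splits)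
  moreover have "y \<otimes> w \<noteq> w"
  proof
    assume "y \<otimes> w = w"
    then have "y = \<one>" using Y w by simp
    obtain u j where u: "u \<in> carrier G" "j \<in> I" "y = u \<otimes> s j \<otimes> inv u"
      using y by (rule reflection_half_space)
    then have "inv u \<otimes> (u \<otimes> s j \<otimes> inv u) \<otimes> u = inv u \<otimes> \<one> \<otimes> u" using \<open>y = \<one>\<close> by simp
    then have "s j = \<one>" using u by (simp add: m_assoc) (simp add: m_assoc[symmetric])
    then show False using s_neq_one u by blast
  qed
  ultimately have "y \<otimes> w \<otimes> inv w = w \<otimes> s i \<otimes> inv w" by simp
  then show "x = y" using Y w by (simp add: m_assoc)
qed

lemma wall_action_wall:
  assumes "g \<in> carrier G" "x \<in> reflections G (s ` I)"
  shows "wall_action G (s ` I) g (wall G (s ` I) x) = wall G (s ` I) (g \<otimes> x \<otimes> inv g)"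
  using assms reflection_square(1)[OF assms(2)] cayley_action_wall[of "s ` I" x g]
  by (auto simp: wall_action_def walls_def)

end

theorem theorem5:
  fixes G :: "('a, 'b) monoid_scheme"
    and I :: "'i set" and m :: "'i \<Rightarrow> 'i \<Rightarrow> nat" and s :: "'i \<Rightarrow> 'a"
  assumes "coxeter_system G I m s"
  shows "\<exists>F :: nat set. finite F \<and>
    (\<exists>\<phi> \<in> walls G (s ` I) \<rightarrow>\<^sub>E F.
      limit_aperiodic G (walls G (s ` I)) (wall_action G (s ` I)) F \<phi>)"
proof -
  interpret coxeter_system G I m s by fact
  let ?S = "s ` I"
  let ?R = "reflections G ?S"
  let ?X = "walls G ?S"
  let ?w = "wall G ?S"
  obtain F c where F: "finite (F :: nat set)" and c: "c \<in> ?R \<rightarrow> F"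
    and central: "\<forall>\<psi>. \<forall>g\<in>carrier G.
      (\<forall>Y. finite Y \<and> Y \<subseteq> ?R \<longrightarrow> (\<exists>h\<in>carrier G. \<forall>y\<in>Y. \<psi> y = c (inv\<^bsub>G\<^esub> h \<otimes>\<^bsub>G\<^esub> y \<otimes>\<^bsub>G\<^esub> h))) \<and>
      (\<forall>x\<in>?R. \<psi> (g \<otimes>\<^bsub>G\<^esub> x \<otimes>\<^bsub>G\<^esub> inv\<^bsub>G\<^esub> g) = \<psi> x) \<longrightarrow>
      (\<forall>x\<in>?R. g \<otimes>\<^bsub>G\<^esub> x \<otimes>\<^bsub>G\<^esub> inv\<^bsub>G\<^esub> g = x)"
    using reflection_coloring by (elim exE conjE)
  have sR: "a \<otimes>\<^bsub>G\<^esub> x \<otimes>\<^bsub>G\<^esub> inv\<^bsub>G\<^esub> a \<in> ?R" if "a \<in> carrier G" "x \<in> ?R" for a x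
    using reflections_conjugate[of ?S] that by auto
  have RG: "x \<in> carrier G" if "x \<in> ?R" for x using that reflection_square by blast
  define \<phi> where "\<phi> = (\<lambda>M\<in>?X. c (the_inv_into ?R ?w M))"
  have wX: "?w x \<in> ?X" if "x \<in> ?R" for x using that by (simp add: walls_def)
  have \<phi>_wall: "\<phi> (?w x) = c x" if "x \<in> ?R" for x
    using that wX the_inv_into_f_f[OF inj_on_wall] by (simp add: \<phi>_def)
  have \<phi>: "\<phi> \<in> ?X \<rightarrow>\<^sub>E F"
    using c \<phi>_wall by (auto simp: walls_def \<phi>_def)
  have action: "coloring_action G ?X (wall_action G ?S) F a \<xi> (?w x) = \<xi> (?w (inv\<^bsub>G\<^esub> a \<otimes>\<^bsub>G\<^esub> x \<otimes>\<^bsub>G\<^esub> a))"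
    if "a \<in> carrier G" "x \<in> ?R" "\<xi> \<in> ?X \<rightarrow>\<^sub>E F" for a x \<xi>
    using that wX wall_action_wall[of "inv\<^bsub>G\<^esub> a" x] by (simp add: coloring_action_def)
  have "limit_aperiodic G ?X (wall_action G ?S) F \<phi>"
    unfolding limit_aperiodic_def
  proof
    fix \<psi> assume \<psi>: "\<psi> \<in> coloring_topology ?X F closure_of orbit G (coloring_action G ?X (wall_action G ?S) F) \<phi>"
    have \<psi>X: "\<psi> \<in> ?X \<rightarrow>\<^sub>E F"
      using in_closure_of[THEN iffD1, OF \<psi>] by (simp add: coloring_topology_def)
    have lim: "\<exists>h\<in>carrier G. \<forall>y\<in>Y. \<psi> (?w y) = c (inv\<^bsub>G\<^esub> h \<otimes>\<^bsub>G\<^esub> y \<otimes>\<^bsub>G\<^esub> h)"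
      if Y: "finite Y" "Y \<subseteq> ?R" for Y
    proof -
      \<comment> \<open>The basic neighborhood of \<open>\<psi>\<close> that prescribes the colors
        of the walls from \<open>Y\<close> and leaves all others free.\<close>
      define U where "U = (\<Pi>\<^sub>E M\<in>?X. if M \<in> ?w ` Y then {\<psi> M} else F)"
      have "openin (coloring_topology ?X F) U"
        unfolding U_def coloring_topology_def openin_PiE_gen
      proof (intro disjI2 conjI ballI)
        show "finite {M \<in> ?X. (if M \<in> ?w ` Y then {\<psi> M} else F) \<noteq> topspace (discrete_topology F)}"
          by (rule finite_subset[of _ "?w ` Y"]) (use Y in auto)
      qed (use \<psi>X in auto)
      moreover have "\<psi> \<in> U" using \<psi>X by (auto simp: U_def PiE_iff)
      ultimately obtain \<xi> where \<xi>: "\<xi> \<in> orbit G (coloring_action G ?X (wall_action G ?S) F) \<phi>" "\<xi> \<in> U"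
        using in_closure_of[THEN iffD1, OF \<psi>] by blast
      then obtain h where h: "h \<in> carrier G" "\<xi> = coloring_action G ?X (wall_action G ?S) F h \<phi>"
        by (auto simp: orbit_def)
      have "\<psi> (?w y) = c (inv\<^bsub>G\<^esub> h \<otimes>\<^bsub>G\<^esub> y \<otimes>\<^bsub>G\<^esub> h)" if y: "y \<in> Y" for y
      proof -
        have yR: "y \<in> ?R" using y Y by blast
        have "\<psi> (?w y) = \<xi> (?w y)" using \<xi>(2) y wX[OF yR] by (auto simp: U_def PiE_iff dest!: bspec)
        also have "\<dots> = c (inv\<^bsub>G\<^esub> h \<otimes>\<^bsub>G\<^esub> y \<otimes>\<^bsub>G\<^esub> h)"
          using h action[OF h(1) yR \<phi>] \<phi>_wall[of "inv\<^bsub>G\<^esub> h \<otimes>\<^bsub>G\<^esub> y \<otimes>\<^bsub>G\<^esub> h"] sR[of "inv\<^bsub>G\<^esub> h" y] yR by simp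
        finally show ?thesis .
      qed
      then show ?thesis using h by blast
    qed
    show "aperiodic G ?X (wall_action G ?S) F \<psi>"
      unfolding aperiodic_def
    proof (intro ballI notI)
      fix g assume g: "g \<in> carrier G - kernel G (BijGroup ?X) (wall_action G ?S)"
        and eq: "coloring_action G ?X (wall_action G ?S) F g \<psi> = \<psi>"
      have gG: "g \<in> carrier G" using g by blast
      have fixed: "\<psi> (?w (g \<otimes>\<^bsub>G\<^esub> x \<otimes>\<^bsub>G\<^esub> inv\<^bsub>G\<^esub> g)) = \<psi> (?w x)" if x: "x \<in> ?R" for x
      proof -
        let ?y = "g \<otimes>\<^bsub>G\<^esub> x \<otimes>\<^bsub>G\<^esub> inv\<^bsub>G\<^esub> g"
        have "inv\<^bsub>G\<^esub> g \<otimes>\<^bsub>G\<^esub> ?y \<otimes>\<^bsub>G\<^esub> g = x"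
          using gG RG[OF x] by (simp add: m_assoc) (simp add: m_assoc[symmetric])
        then show ?thesis using action[OF gG sR[OF gG x] \<psi>X] eq by simp
      qed
      have "\<forall>x\<in>?R. g \<otimes>\<^bsub>G\<^esub> x \<otimes>\<^bsub>G\<^esub> inv\<^bsub>G\<^esub> g = x"
        by (rule central[THEN spec[of _ "\<lambda>x. \<psi> (?w x)"], THEN bspec, OF gG, THEN mp])
          (use lim fixed in simp)
      then have triv: "g \<otimes>\<^bsub>G\<^esub> x \<otimes>\<^bsub>G\<^esub> inv\<^bsub>G\<^esub> g = x" if "x \<in> ?R" for x
        using that by (rule bspec)
      have "wall_action G ?S g M = M" if "M \<in> ?X" for M
        using that wall_action_wall[OF gG] triv by (auto simp: walls_def)
      then have "wall_action G ?S g = (\<lambda>M\<in>?X. M)"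
        by (auto simp: wall_action_def fun_eq_iff)
      then have "g \<in> kernel G (BijGroup ?X) (wall_action G ?S)"
        using gG by (simp add: kernel_def BijGroup_def)
      then show False using g by blast
    qed
  qed
  then show ?thesis using F \<phi> by blast
qed

end
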